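(* Assume Setting (S) and the Distinctness assumptions (D), and assume in addition that $|C_n|\le M|d_nD_n|$ for all $n\in\mathbb{N}$ (no condition relating $\gamma$ and $\alpha$ is imposed). Then for every $T>\frac{2\pi}{\gamma}$, $$\int_0^T\big(|u_1(t)|^2+|u_2(t)|^2\big)dt\asymp\sum_{n=1}^\infty\big(|C_n|^2+|d_nD_n|^2\big),$$ i.e. there are constants $0<A\le B$, independent of $C_n,D_n,R_n,\mathcal{E}$, with $A\sum_n(|C_n|^2+|d_nD_n|^2)\le\int_0^T(|u_1|^2+|u_2|^2)dt\le B\sum_n(|C_n|^2+|d_nD_n|^2)$.
   Context: Setting (S): $(\omega_n),(\zeta_n),(C_n),(D_n),(c_n),(d_n)$ ($n\ge1$) are complex sequences and $(r_n),(R_n)$ are real sequences. There are constants $\gamma>0$, $\alpha>0$, $\chi<0$, $n'\in\mathbb{N}$, $\mu>0$, $\nu>1/2$, $M>0$, $0<c_1\le c_2$ such that: (H1) $\liminf_{n\to\infty}(\operatorname{Re}\omega_{n+1}-\operatorname{Re}\omega_n)=\liminf_{n\to\infty}(\operatorname{Re}\zeta_{n+1}-\operatorname{Re}\zeta_n)=\gamma$; (H2) $\operatorname{Im}\omega_n\to\alpha$, $r_n\to\chi$, $\operatorname{Im}\zeta_n\to0$; (H3) $\omega_n\ne0$, $\zeta_n\neq0$, $c_1|\zeta_n|\le|d_n|\le c_2|\zeta_n|$ and $|c_n|\le M/|\omega_n|$ for all $n$; (H4) $|R_n|\le\mu n^{-\nu}(|C_n|^2+|d_nD_n|^2)^{1/2}$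 for $n\ge n'$ and $|R_n|\le\mu(|C_n|^2+|d_nD_n|^2)^{1/2}$ for $n\le n'$; (H5) $\sum_n(|C_n|^2+|d_nD_n|^2)<\infty$. For $n_0\in\mathbb{N}$ and $t\in\mathbb{R}$, $u_1^{n_0}(t)=\sum_{n\ge n_0}\big(C_ne^{i\omega_nt}+\overline{C_n}e^{-i\overline{\omega_n}t}+R_ne^{r_nt}+D_ne^{i\zeta_nt}+\overline{D_n}e^{-i\overline{\zeta_n}t}\big)$, $u_2^{n_0}(t)=\sum_{n\ge n_0}\big(d_nD_ne^{i\zeta_nt}+\overline{d_nD_n}e^{-i\overline{\zeta_n}t}+c_nC_ne^{i\omega_nt}+\overline{c_nC_n}e^{-i\overline{\omega_n}t}\big)$. Distinctness assumptions (D): $\eta\in\mathbb{R}$ and $\mathcal{E}\in\mathbb{R}$ with $|\mathcal{E}|^2\le M\sum_{n\ge1}(|C_n|^2+|d_nD_n|^2)$; the sequences $(\omega_n)$, $(r_n)$, $(\zeta_n)$ each consist of pairwise distinct numbers; $\omega_n\ne\zeta_m$, $\omega_n\ne\overline{\zeta_m}$, $r_n\ne i\omega_m$, $r_n\ne i\zeta_m$, $r_n\ne-\eta$ for all $n,m$; and $\operatorname{Re}\omega_n>0$, $\operatorname{Re}\zeta_n>0$ for all $n$. Set $u_1(t):=u_1^{1}(t)$ and $u_2(t):=u_2^{1}(t)+\mathcal{E}e^{-\eta t}$. *)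

theory Defs
  imports "HOL-Analysis.Analysis"
begin

text \<open>Partial sums (indices 1..N) of the series defining u_1 and u_2.
  Sequences are indexed by nat; index 0 is unused.\<close>

definition u1_partial ::
  "(nat \<Rightarrow> complex) \<Rightarrow> (nat \<Rightarrow> complex) \<Rightarrow> (nat \<Rightarrow> real) \<Rightarrow> (nat \<Rightarrow> complex)
   \<Rightarrow> (nat \<Rightarrow> complex) \<Rightarrow> (nat \<Rightarrow> real) \<Rightarrow> nat \<Rightarrow> real \<Rightarrow> complex" where
  "u1_partial \<omega> \<zeta> r C D R N t =
     (\<Sum>n=1..N. C n * exp (\<i> * \<omega> n * of_real t)
              + cnj (C n) * exp (- \<i> * cnj (\<omega> n) * of_real t)
              + of_real (R n * exp (r n * t))
              + D n * exp (\<i> * \<zeta> n * of_real t)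
              + cnj (D n) * exp (- \<i> * cnj (\<zeta> n) * of_real t))"

definition u2_partial ::
  "(nat \<Rightarrow> complex) \<Rightarrow> (nat \<Rightarrow> complex) \<Rightarrow> (nat \<Rightarrow> complex) \<Rightarrow> (nat \<Rightarrow> complex)
   \<Rightarrow> (nat \<Rightarrow> complex) \<Rightarrow> (nat \<Rightarrow> complex) \<Rightarrow> real \<Rightarrow> real \<Rightarrow> nat \<Rightarrow> real \<Rightarrow> complex" where
  "u2_partial \<omega> \<zeta> c d C D \<E> \<eta> N t =
     (\<Sum>n=1..N. d n * D n * exp (\<i> * \<zeta> n * of_real t)
              + cnj (d n * D n) * exp (- \<i> * cnj (\<zeta> n) * of_real t)
              + c n * C n * exp (\<i> * \<omega> n * of_real t)
              + cnj (c n * C n) * exp (- \<i> * cnj (\<omega> n) * of_real t))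
     + of_real (\<E> * exp (- \<eta> * t))"

definition L2_limit_on :: "real \<Rightarrow> (nat \<Rightarrow> real \<Rightarrow> complex) \<Rightarrow> (real \<Rightarrow> complex) \<Rightarrow> bool" where
  "L2_limit_on T S u \<longleftrightarrow>
     u \<in> borel_measurable lborel \<and>
     set_integrable lborel {0..T} (\<lambda>t. (cmod (u t))\<^sup>2) \<and>
     (\<forall>N. set_integrable lborel {0..T} (\<lambda>t. (cmod (S N t - u t))\<^sup>2)) \<and>
     (\<lambda>N. LINT t:{0..T}|lborel. (cmod (S N t - u t))\<^sup>2) \<longlonglongrightarrow> 0"

end

theory Submission
  imports Defs
begin

text \<open>
  Write the finite sums as vector valued exponential sums with values in two-dimensional complex
  space.  For indices beyond a large threshold the vectors attached to the exponents
  \<open>\<omega>\<^sub>n\<close> and \<open>\<zeta>\<^sub>n\<close> are close to the two unit vectors, so two scalar Ingham inequalities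
  (each valid for \<open>T > 2\<pi>/\<gamma>\<close>) give a two-sided estimate of the high frequency part, for arbitrary
  coefficients.  Ingham's kernel \<open>cos (a t)\<close> tolerates exponents with small imaginary part; a limit
  \<open>\<alpha>\<close> of the imaginary parts is absorbed into the weight \<open>exp (\<alpha> t)\<close>.

  The remaining finitely many exponents and the real exponentials \<open>exp (r\<^sub>n t)\<close>, whose coefficients
  form a relatively compact set in \<open>\<ell>\<^sup>1\<close>, are treated by contradiction: take normalised coefficients
  whose sums tend to 0 in \<open>L\<^sup>2\<close>.  Products of operators \<open>f \<mapsto> f (t + h) - \<mu> f t\<close> act on
  \<open>exp (z t)\<close> as multipliers; they can be chosen to vanish at finitely many exponents and to be
  arbitrarily small on a real interval compared with their value at a given nonreal exponent.
  Hence every single high frequency coefficient tends to 0.  After passing to a subsequence on which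
  the low frequency coefficients converge, the high frequency estimate turns this into convergence in
  \<open>\<ell>\<^sup>2\<close>, and then the low frequency coefficients tend to 0 too, contradicting the normalisation.
\<close>

subsection \<open>Square integrals\<close>

text \<open>Since \<open>r\<close> converges, the exponentials \<open>exp (r n * t)\<close>
  accumulate at one exponent and admit no lower bound of Ingham type. What replaces it is the
  domination of \<open>R n\<close> by a square summable weight times the size of the n-th pair of
  coefficients: Cauchy-Schwarz turns this into l1 tails that are uniformly small, which is the
  source of the compactness. The two scalar problems decouple because \<open>d n\<close> grows at
  least linearly and \<open>c n\<close> decays: with \<open>d n * D n\<close> as the unknown, the
  \<zeta> terms are almost invisible in u1 and the \<omega> terms in u2. Difference operators
  shorten the interval, so a second length T' with 2 pi / \<gamma> < T' < T is fixed, and the total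
  shift is kept below T - T'. All estimates concern finite sums with arbitrary complex coefficients,
  without conjugate symmetry, and with constants independent of the truncation; hence they apply to
  differences and rescalings as well.\<close>

definition sqint :: "real \<Rightarrow> (real \<Rightarrow> complex) \<Rightarrow> real" where
  "sqint T f = integral {0..T} (\<lambda>t. (cmod (f t))\<^sup>2)"

lemma sq_integrable:
  assumes "continuous_on UNIV f" shows "(\<lambda>t. (cmod (f t))\<^sup>2) integrable_on {a..b::real}"
  by (intro integrable_continuous_interval continuous_intros continuous_on_subset[OF assms]) auto

lemma sqint_nonneg: "0 \<le> sqint T f"
  unfolding sqint_def by (cases "(\<lambda>t. (cmod (f t))\<^sup>2) integrable_on {0..T}")
   (auto intro: integral_nonneg simp: not_integrable_integral)

lemma norm_add_sq_le: "(cmod (a + b))\<^sup>2 \<le> 2 * (cmod a)\<^sup>2 + 2 * (cmod b)\<^sup>2"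
proof -
  have "(cmod (a + b))\<^sup>2 \<le> (cmod a + cmod b)\<^sup>2"
    by (intro power_mono norm_triangle_ineq) auto
  also have "\<dots> \<le> 2 * (cmod a)\<^sup>2 + 2 * (cmod b)\<^sup>2"
    using sum_squares_bound[of "cmod a" "cmod b"] by (simp add: power2_sum)
  finally show ?thesis .
qed

lemma sqint_add_le:
  assumes f: "continuous_on UNIV f" and g: "continuous_on UNIV g"
  shows "sqint T (\<lambda>t. f t + g t) \<le> 2 * sqint T f + 2 * sqint T g"
proof -
  have "sqint T (\<lambda>t. f t + g t) \<le> integral {0..T} (\<lambda>t. 2 * (cmod (f t))\<^sup>2 + 2 * (cmod (g t))\<^sup>2)"
    unfolding sqint_def
    by (intro integral_le sq_integrable continuous_intros f g integrable_add
        integrable_on_mult_right norm_add_sq_le)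
  also have "\<dots> = 2 * sqint T f + 2 * sqint T g"
    unfolding sqint_def by (subst integral_add) (auto intro!: integrable_on_mult_right sq_integrable f g)
  finally show ?thesis .
qed

lemma sqint_mult: "sqint T (\<lambda>t. c * f t) = (cmod c)\<^sup>2 * sqint T f"
  unfolding sqint_def by (simp add: norm_mult power_mult_distrib)

lemma sqint_diff_le:
  assumes f: "continuous_on UNIV f" and g: "continuous_on UNIV g"
  shows "sqint T (\<lambda>t. f t - g t) \<le> 2 * sqint T f + 2 * sqint T g"
  using sqint_add_le[OF f, of "\<lambda>t. -1 * g t" T] sqint_mult[of T "-1" g] g
  by (auto intro!: continuous_intros)

lemma sqint_mono_T:
  assumes f: "continuous_on UNIV f" and "T' \<le> T"
  shows "sqint T' f \<le> sqint T f"
  unfolding sqint_def by (intro integral_subset_le sq_integrable f) (use assms in auto)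

lemma sqint_bounded:
  assumes f: "continuous_on UNIV f" and b: "\<And>t. 0 \<le> t \<Longrightarrow> t \<le> T \<Longrightarrow> cmod (f t) \<le> b" and "T \<ge> 0"
  shows "sqint T f \<le> T * b\<^sup>2"
proof -
  have "sqint T f \<le> integral {0..T} (\<lambda>t. b\<^sup>2)"
    unfolding sqint_def by (intro integral_le sq_integrable f) (auto intro!: power_mono b)
  also have "\<dots> = T * b\<^sup>2" using \<open>T \<ge> 0\<close> by simp
  finally show ?thesis .
qed

lemma integral_shift_interval:
  fixes f :: "real \<Rightarrow> real"
  shows "integral {a..b} (\<lambda>t. f (t + h)) = integral {a+h..b+h} f"
  using integral_shift_real_ivl[of "a+h" h "b+h" f] by (simp add: add.commute)

lemma sqint_shift_le:
  assumes f: "continuous_on UNIV f" and "h \<ge> 0"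
  shows "sqint T (\<lambda>t. f (t + h)) \<le> sqint (T + h) f"
  unfolding sqint_def integral_shift_interval[of 0 T "\<lambda>t. (cmod (f t))\<^sup>2"]
  by (intro integral_subset_le sq_integrable f) (use assms in auto)

subsection \<open>Ingham inequalities\<close>

text \<open>Two integrations by parts give the antiderivative \<open>F\<close>. Since
  \<open>a * R = pi / 2\<close>, the cosine vanishes at both ends and only the sine terms
  survive.\<close>

lemma cos_kernel_integral:
  fixes u :: complex and a R :: real
  assumes R: "R > 0" and a: "a = pi / (2 * R)" and u: "u\<^sup>2 \<noteq> (of_real a)\<^sup>2"
  shows "((\<lambda>t. of_real (cos (a * t)) * exp (\<i> * u * of_real t)) has_integral
           of_real a * (exp (\<i> * u * of_real R) + exp (- (\<i> * u * of_real R))) / ((of_real a)\<^sup>2 - u\<^sup>2)) {-R..R}"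
proof -
  define F where "F = (\<lambda>t::real. exp (\<i> * u * of_real t) * (\<i> * u * of_real (cos (a * t)) + of_real a * of_real (sin (a * t))) / ((of_real a)\<^sup>2 - u\<^sup>2))"
  have nz: "(of_real a)\<^sup>2 - u\<^sup>2 \<noteq> 0" using u by auto
  have exp_der: "((\<lambda>t. exp (\<i> * u * of_real t)) has_vector_derivative \<i> * u * exp (\<i> * u * of_real t)) (at t within S)" for t :: real and S
    by (rule has_vector_derivative_eq_rhs, rule field_vector_diff_chain_within[unfolded o_def], rule has_vector_derivative_mult_right, rule has_vector_derivative_of_real, rule DERIV_ident[THEN DERIV_subset]) (auto intro!: derivative_eq_intros)
  have der: "(F has_vector_derivative (of_real (cos (a * t)) * exp (\<i> * u * of_real t))) (at t within {-R..R})" for t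
  proof -
    have c: "((\<lambda>t. complex_of_real (cos (a * t))) has_vector_derivative of_real (- a * sin (a * t))) (at t within {-R..R})"
      by (rule has_vector_derivative_of_real) (auto intro!: derivative_eq_intros)
    have s: "((\<lambda>t. complex_of_real (sin (a * t))) has_vector_derivative of_real (a * cos (a * t))) (at t within {-R..R})"
      by (rule has_vector_derivative_of_real) (auto intro!: derivative_eq_intros)
    have "((\<lambda>t. exp (\<i> * u * of_real t) * (\<i> * u * of_real (cos (a * t)) + of_real a * of_real (sin (a * t)))) has_vector_derivative
        exp (\<i> * u * of_real t) * (\<i> * u * of_real (- a * sin (a * t)) + of_real a * of_real (a * cos (a * t)))
        + \<i> * u * exp (\<i> * u * of_real t) * (\<i> * u * of_real (cos (a * t)) + of_real a * of_real (sin (a * t)))) (at t within {-R..R})"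
      by (intro has_vector_derivative_mult has_vector_derivative_add has_vector_derivative_mult_right c s exp_der)
    then have "(F has_vector_derivative
        (exp (\<i> * u * of_real t) * (\<i> * u * of_real (- a * sin (a * t)) + of_real a * of_real (a * cos (a * t)))
        + \<i> * u * exp (\<i> * u * of_real t) * (\<i> * u * of_real (cos (a * t)) + of_real a * of_real (sin (a * t)))) / ((of_real a)\<^sup>2 - u\<^sup>2)) (at t within {-R..R})"
      unfolding F_def by (rule has_vector_derivative_divide)
    also have "(exp (\<i> * u * of_real t) * (\<i> * u * of_real (- a * sin (a * t)) + of_real a * of_real (a * cos (a * t)))
        + \<i> * u * exp (\<i> * u * of_real t) * (\<i> * u * of_real (cos (a * t)) + of_real a * of_real (sin (a * t)))) / ((of_real a)\<^sup>2 - u\<^sup>2)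
        = of_real (cos (a * t)) * exp (\<i> * u * of_real t)"
      using nz by (simp add: divide_eq_eq) (simp add: algebra_simps power2_eq_square)
    finally show ?thesis .
  qed
  have aR: "a * R = pi / 2" using R a by simp
  have "F R - F (- R) = of_real a * (exp (\<i> * u * of_real R) + exp (- (\<i> * u * of_real R))) / ((of_real a)\<^sup>2 - u\<^sup>2)"
    unfolding F_def using nz by (simp add: aR divide_simps) (simp add: algebra_simps)
  with fundamental_theorem_of_calculus[of "-R" R F, OF _ der] R show ?thesis by simp
qed

text \<open>The denominator is (2k - 1)(2k + 1), so the sum telescopes.\<close>

lemma sum_inverse_odd_products_le: "(\<Sum>k=1..N. 1 / (4 * (real k)\<^sup>2 - 1)) \<le> 1 / 2"
proof -
  have "(\<Sum>k=1..N. 1 / (4 * (real k)\<^sup>2 - 1)) = 1 / 2 - 1 / (2 * (2 * real N + 1))"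
  proof (induction N)
    case (Suc N)
    have "4 * (real (Suc N))\<^sup>2 - 1 = (2 * real N + 1) * (2 * real N + 3)"
      by (simp add: power2_eq_square algebra_simps)
    moreover have "1 / (p * (p + 2)) = 1 / (2 * p) - 1 / (2 * (p + 2))" if "p > 0" for p :: real
      using that by (simp add: divide_simps)
    from this[of "2 * real N + 1"] have "1 / ((2 * real N + 1) * (2 * real N + 3)) = 1 / (2 * (2 * real N + 1)) - 1 / (2 * (2 * real N + 3))"
      by (simp add: add.assoc)
    ultimately show ?case using Suc by (simp add: algebra_simps)
  qed simp
  then show ?thesis by simp
qed

text \<open>Each nonzero difference occurs at most once, so positive and negative differences
  contribute at most 1/2 each. This constant 1 is what later yields the threshold
  \<open>2 * pi / g\<close>.\<close>

lemma sum_inverse_odd_products_int_le: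
  fixes J :: "int set"
  assumes "finite J"
  shows "(\<Sum>n\<in>J - {m}. 1 / (4 * (real_of_int (m - n))\<^sup>2 - 1)) \<le> 1"
proof -
  let ?b = "\<lambda>k::int. 1 / (4 * (real_of_int k)\<^sup>2 - 1)"
  have bnn: "?b k \<ge> 0" if "k \<noteq> 0" for k
  proof -
    have "1 \<le> \<bar>real_of_int k\<bar>" using that by linarith
    then have "1 \<le> (real_of_int k)\<^sup>2" by (metis abs_le_square_iff abs_1 one_power2 abs_abs)
    then show ?thesis by simp
  qed
  obtain N :: nat where N: "\<And>n. n \<in> J \<Longrightarrow> \<bar>m - n\<bar> \<le> int N"
  proof -
    have "finite ((\<lambda>n. nat \<bar>m - n\<bar>) ` J)" using assms by simp
    then obtain N where "\<forall>k\<in>(\<lambda>n. nat \<bar>m - n\<bar>) ` J. k \<le> N" using finite_nat_set_iff_bounded_le by blast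
    then show ?thesis using that[of N] by force
  qed
  have "(\<Sum>n\<in>J - {m}. ?b (m - n)) = (\<Sum>k\<in>(\<lambda>n. m - n) ` (J - {m}). ?b k)"
    by (subst sum.reindex) (auto simp: inj_on_def)
  also have "\<dots> \<le> (\<Sum>k\<in>int ` {1..N} \<union> (\<lambda>k. - int k) ` {1..N}. ?b k)"
  proof (rule sum_mono2)
    show "(\<lambda>n. m - n) ` (J - {m}) \<subseteq> int ` {1..N} \<union> (\<lambda>k. - int k) ` {1..N}"
    proof
      fix k assume "k \<in> (\<lambda>n. m - n) ` (J - {m})"
      then have k: "k \<noteq> 0" "\<bar>k\<bar> \<le> int N" using N by auto
      show "k \<in> int ` {1..N} \<union> (\<lambda>k. - int k) ` {1..N}"
      proof (cases "k > 0")
        case True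
        then show ?thesis using k by (intro UnI1 image_eqI[of _ _ "nat k"]) auto
      next
        case False
        then show ?thesis using k by (intro UnI2 image_eqI[of _ _ "nat (-k)"]) auto
      qed
    qed
    show "0 \<le> ?b k" if "k \<in> (int ` {1..N} \<union> (\<lambda>k. - int k) ` {1..N}) - (\<lambda>n. m - n) ` (J - {m})" for k
      using that by (intro bnn) auto
  qed auto
  also have "\<dots> = (\<Sum>k\<in>int ` {1..N}. ?b k) + (\<Sum>k\<in>(\<lambda>k. - int k) ` {1..N}. ?b k)"
    by (rule sum.union_disjoint) auto
  also have "\<dots> = (\<Sum>k=1..N. 1 / (4 * (real k)\<^sup>2 - 1)) + (\<Sum>k=1..N. 1 / (4 * (real k)\<^sup>2 - 1))"
    by (subst (1 2) sum.reindex) (auto simp: inj_on_def)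
  also have "\<dots> \<le> 1" using sum_inverse_odd_products_le[of N] by simp
  finally show ?thesis .
qed

text \<open>For \<open>a = pi / (2 * R)\<close> this is the integral of cos (a t) exp (i u t) over
  [-R, R], that is 2 a cos (u R) / (a^2 - u^2), at a complex frequency \<open>u\<close>.\<close>

definition ingham_kernel :: "real \<Rightarrow> real \<Rightarrow> complex \<Rightarrow> complex" where
  "ingham_kernel a R u = of_real a * (exp (\<i> * u * of_real R) + exp (- (\<i> * u * of_real R))) / ((of_real a)\<^sup>2 - u\<^sup>2)"

lemma norm_exp_sum_le:
  assumes "R > 0" shows "cmod (exp (\<i> * u * of_real R) + exp (- (\<i> * u * of_real R))) \<le> 2 * exp (R * \<bar>Im u\<bar>)"
proof -
  have "cmod (exp (\<i> * u * of_real R) + exp (- (\<i> * u * of_real R))) \<le> exp (- Im u * R) + exp (Im u * R)"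
    by (rule order_trans[OF norm_triangle_ineq]) (simp add: norm_exp_eq_Re)
  also have "\<dots> \<le> exp (R * \<bar>Im u\<bar>) + exp (R * \<bar>Im u\<bar>)"
    using assms by (intro add_mono) (auto simp: abs_if algebra_simps mult_le_0_iff zero_le_mult_iff)
  finally show ?thesis by simp
qed

text \<open>The real part alone gives |a^2 - u^2| \<ge> (Re u)^2 - a^2 \<ge> a^2 \<rho>^2 (4 k^2 -
  1), because \<rho> > 1. The factor 1 / \<rho>^2 is the gain that lets the diagonal win.\<close>

lemma ingham_kernel_offdiag:
  fixes k :: int
  assumes R: "R > 0" and a: "a > 0" and \<rho>: "\<rho> > 1" and k: "k \<noteq> 0"
    and u: "2 * a * \<rho> * \<bar>real_of_int k\<bar> \<le> \<bar>Re u\<bar>" and im: "\<bar>Im u\<bar> \<le> e"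
  shows "u\<^sup>2 \<noteq> (of_real a)\<^sup>2"
    and "cmod (ingham_kernel a R u) \<le> 2 * exp (R * e) / (a * \<rho>\<^sup>2) * (1 / (4 * (real_of_int k)\<^sup>2 - 1))"
proof -
  have k1: "1 \<le> \<bar>real_of_int k\<bar>" using k by linarith
  then have k2: "1 \<le> (real_of_int k)\<^sup>2" by (metis abs_le_square_iff abs_1 one_power2 abs_abs)
  have "(2 * a * \<rho> * \<bar>real_of_int k\<bar>)\<^sup>2 \<le> \<bar>Re u\<bar>\<^sup>2"
    using u a \<rho> by (intro power_mono) auto
  then have "4 * a\<^sup>2 * \<rho>\<^sup>2 * (real_of_int k)\<^sup>2 \<le> (Re u)\<^sup>2" by (simp add: power_mult_distrib)
  moreover have "a\<^sup>2 * 1 \<le> a\<^sup>2 * \<rho>\<^sup>2" using \<rho> by (intro mult_left_mono) (auto simp: power2_eq_square intro: less_imp_le less_1_mult)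
  ultimately have 1: "a\<^sup>2 * \<rho>\<^sup>2 * (4 * (real_of_int k)\<^sup>2 - 1) \<le> (Re u)\<^sup>2 - a\<^sup>2"
    by (simp add: algebra_simps)
  have pos: "0 < a\<^sup>2 * \<rho>\<^sup>2 * (4 * (real_of_int k)\<^sup>2 - 1)" using a \<rho> k2 by (intro mult_pos_pos) auto
  have 2: "(Re u)\<^sup>2 - a\<^sup>2 \<le> cmod ((of_real a)\<^sup>2 - u\<^sup>2)"
  proof -
    have "(Re u)\<^sup>2 - a\<^sup>2 \<le> (cmod u)\<^sup>2 - a\<^sup>2" by (simp add: cmod_power2)
    also have "\<dots> = cmod (u\<^sup>2) - cmod ((of_real a)\<^sup>2)" by (simp add: norm_power)
    also have "\<dots> \<le> cmod (u\<^sup>2 - (of_real a)\<^sup>2)" by (rule norm_triangle_ineq2)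
    finally show ?thesis by (simp add: norm_minus_commute)
  qed
  show "u\<^sup>2 \<noteq> (of_real a)\<^sup>2" using pos 1 2 by auto
  have "cmod (ingham_kernel a R u) = a * cmod (exp (\<i> * u * of_real R) + exp (- (\<i> * u * of_real R))) / cmod ((of_real a)\<^sup>2 - u\<^sup>2)"
    using a unfolding ingham_kernel_def by (simp add: norm_mult norm_divide)
  also have "\<dots> \<le> a * (2 * exp (R * e)) / (a\<^sup>2 * \<rho>\<^sup>2 * (4 * (real_of_int k)\<^sup>2 - 1))"
  proof -
    have "2 * exp (R * \<bar>Im u\<bar>) \<le> 2 * exp (R * e)" using R im by simp
    with norm_exp_sum_le[OF R, of u] have "cmod (exp (\<i> * u * of_real R) + exp (- (\<i> * u * of_real R))) \<le> 2 * exp (R * e)"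
      by linarith
    then show ?thesis using a pos 1 2 by (intro frac_le mult_left_mono) auto
  qed
  also have "\<dots> = 2 * exp (R * e) / (a * \<rho>\<^sup>2) * (1 / (4 * (real_of_int k)\<^sup>2 - 1))"
    using a by (simp add: power2_eq_square)
  finally show "cmod (ingham_kernel a R u) \<le> 2 * exp (R * e) / (a * \<rho>\<^sup>2) * (1 / (4 * (real_of_int k)\<^sup>2 - 1))" .
qed

text \<open>On the diagonal the frequency \<open>l j - cnj (l j)\<close> is purely imaginary, so the
  cosine becomes a hyperbolic cosine, which is at least 1, and the denominator becomes
  \<open>a\<^sup>2 + 4 * b\<^sup>2\<close>.\<close>

lemma ingham_kernel_diag:
  fixes b :: real
  assumes R: "R > 0" and a: "a > 0" and b: "\<bar>b\<bar> \<le> e"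
  shows "(2 * \<i> * of_real b)\<^sup>2 \<noteq> (of_real a :: complex)\<^sup>2"
    and "2 * a / (a\<^sup>2 + 4 * e\<^sup>2) \<le> Re (ingham_kernel a R (2 * \<i> * of_real b))"
    and "Re (ingham_kernel a R (2 * \<i> * of_real b)) \<le> 2 * exp (2 * R * e) / a"
proof -
  have sq: "(2 * \<i> * of_real b)\<^sup>2 = complex_of_real (- 4 * b\<^sup>2)" by (simp add: power_mult_distrib)
  have "a\<^sup>2 > 0" using a by simp
  then have "- 4 * b\<^sup>2 \<noteq> a\<^sup>2" by (smt (verit) zero_le_power2)
  then show "(2 * \<i> * of_real b)\<^sup>2 \<noteq> (of_real a :: complex)\<^sup>2" unfolding sq by (metis of_real_eq_iff of_real_power)
  have K: "ingham_kernel a R (2 * \<i> * of_real b) = of_real (a * (exp (- (2 * b * R)) + exp (2 * b * R)) / (a\<^sup>2 + 4 * b\<^sup>2))"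
  proof -
    have e: "\<i> * (2 * \<i> * of_real b) * of_real R = complex_of_real (- (2 * b * R))" by simp
    show ?thesis unfolding ingham_kernel_def sq e by (simp flip: exp_of_real)
  qed
  have be: "b\<^sup>2 \<le> e\<^sup>2" using power_mono[OF b abs_ge_zero, of 2] by simp
  have "exp (- (2 * b * R)) + exp (2 * b * R) \<ge> 2"
    using exp_ge_add_one_self[of "2 * b * R"] exp_ge_add_one_self[of "- (2 * b * R)"] by linarith
  then have "2 * a / (a\<^sup>2 + 4 * e\<^sup>2) \<le> a * (exp (- (2 * b * R)) + exp (2 * b * R)) / (a\<^sup>2 + 4 * b\<^sup>2)"
    using a be by (intro frac_le) (auto intro: add_pos_nonneg simp: sum_power2_gt_zero_iff)
  then show "2 * a / (a\<^sup>2 + 4 * e\<^sup>2) \<le> Re (ingham_kernel a R (2 * \<i> * of_real b))" by (simp add: K)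
  have "b * R \<le> e * R" "- b * R \<le> e * R"
    using mult_right_mono[of b e R] mult_right_mono[of "- b" e R] b R by auto
  then have "exp (- (2 * b * R)) \<le> exp (2 * R * e)" "exp (2 * b * R) \<le> exp (2 * R * e)"
    by (simp_all add: algebra_simps)
  then have "exp (- (2 * b * R)) + exp (2 * b * R) \<le> 2 * exp (2 * R * e)" by linarith
  then have "a * (exp (- (2 * b * R)) + exp (2 * b * R)) / (a\<^sup>2 + 4 * b\<^sup>2) \<le> a * (2 * exp (2 * R * e)) / a\<^sup>2"
    using a by (intro frac_le) auto
  also have "\<dots> = 2 * exp (2 * R * e) / a" using a by (simp add: power2_eq_square)
  finally show "Re (ingham_kernel a R (2 * \<i> * of_real b)) \<le> 2 * exp (2 * R * e) / a" by (simp add: K)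
qed

text \<open>Expanding \<open>(cmod (f t))\<^sup>2\<close> gives a quadratic form with entries
  \<open>K i j\<close>. Its off-diagonal part is bounded by the row sums of \<open>b\<close>, its
  diagonal part by the estimates for imaginary frequencies.\<close>

lemma ingham_quadratic_form:
  fixes l x :: "int \<Rightarrow> complex" and J :: "int set"
  defines "f \<equiv> \<lambda>t::real. \<Sum>j\<in>J. x j * exp (\<i> * l j * of_real t)"
  assumes J: "finite J" and R: "R > 0" and a: "a = pi / (2 * R)" and \<rho>: "\<rho> > 1"
    and gap: "\<And>i j. i \<in> J \<Longrightarrow> j \<in> J \<Longrightarrow> 2 * a * \<rho> * \<bar>real_of_int (i - j)\<bar> \<le> \<bar>Re (l i) - Re (l j)\<bar>"
    and im: "\<And>j. j \<in> J \<Longrightarrow> \<bar>Im (l j)\<bar> \<le> e"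
  shows "(2 * a / (a\<^sup>2 + 4 * e\<^sup>2) - 2 * exp (2 * R * e) / (a * \<rho>\<^sup>2)) * (\<Sum>j\<in>J. (cmod (x j))\<^sup>2)
           \<le> integral {-R..R} (\<lambda>t. cos (a * t) * (cmod (f t))\<^sup>2)"
    and "integral {-R..R} (\<lambda>t. cos (a * t) * (cmod (f t))\<^sup>2)
           \<le> 4 * exp (2 * R * e) / a * (\<Sum>j\<in>J. (cmod (x j))\<^sup>2)"
proof -
  have a0: "a > 0" using a R by simp
  define K where "K = (\<lambda>i j. ingham_kernel a R (l i - cnj (l j)))"
  define b where "b = (\<lambda>k::int. 2 * exp (2 * R * e) / (a * \<rho>\<^sup>2) * (1 / (4 * (real_of_int k)\<^sup>2 - 1)))"
  have off: "(l i - cnj (l j))\<^sup>2 \<noteq> (of_real a)\<^sup>2 \<and> cmod (K i j) \<le> b (i - j)"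
    if "i \<in> J" "j \<in> J" "i \<noteq> j" for i j
  proof -
    \<comment> \<open>Imaginary parts add up in \<open>l i - cnj (l j)\<close>, hence the exponent
      \<open>2 * R * e\<close> in all constants.\<close>
    have "\<bar>Im (l i - cnj (l j))\<bar> \<le> 2 * e" using im[OF that(1)] im[OF that(2)] by simp
    from ingham_kernel_offdiag[OF R a0 \<rho>, of "i - j" "l i - cnj (l j)", OF _ _ this] gap[OF that(1,2)] that(3)
    show ?thesis unfolding K_def b_def by (simp add: mult.assoc mult.commute[of R] mult.left_commute)
  qed
  have diag: "l i - cnj (l i) = 2 * \<i> * of_real (Im (l i))" for i by (simp add: complex_eq_iff)
  have nres: "(l i - cnj (l j))\<^sup>2 \<noteq> (of_real a)\<^sup>2" if "i \<in> J" "j \<in> J" for i j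
    using off[OF that] ingham_kernel_diag(1)[OF R a0 im[OF that(1)]] by (cases "i = j") (auto simp: diag)
  have expand: "of_real (cos (a * t) * (cmod (f t))\<^sup>2) =
      (\<Sum>i\<in>J. \<Sum>j\<in>J. x i * cnj (x j) * (of_real (cos (a * t)) * exp (\<i> * (l i - cnj (l j)) * of_real t)))" for t
  proof -
    have "of_real ((cmod (f t))\<^sup>2) = f t * cnj (f t)" by (rule complex_norm_square)
    also have "\<dots> = (\<Sum>i\<in>J. \<Sum>j\<in>J. x i * cnj (x j) * exp (\<i> * (l i - cnj (l j)) * of_real t))"
      unfolding f_def cnj_sum sum_product
      by (intro sum.cong refl) (simp add: exp_cnj algebra_simps exp_diff exp_minus divide_inverse)
    finally show ?thesis by (simp add: sum_distrib_left mult_ac)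
  qed
  have "((\<lambda>t. \<Sum>i\<in>J. \<Sum>j\<in>J. x i * cnj (x j) * (of_real (cos (a * t)) * exp (\<i> * (l i - cnj (l j)) * of_real t)))
       has_integral (\<Sum>i\<in>J. \<Sum>j\<in>J. x i * cnj (x j) * K i j)) {-R..R}"
    unfolding K_def ingham_kernel_def
    by (intro has_integral_sum J has_integral_mult_right cos_kernel_integral R a nres)
  then have "((\<lambda>t. complex_of_real (cos (a * t) * (cmod (f t))\<^sup>2)) has_integral (\<Sum>i\<in>J. \<Sum>j\<in>J. x i * cnj (x j) * K i j)) {-R..R}"
    by (simp only: expand)
  from has_integral_Re[OF this] have I: "integral {-R..R} (\<lambda>t. cos (a * t) * (cmod (f t))\<^sup>2) = Re (\<Sum>i\<in>J. \<Sum>j\<in>J. x i * cnj (x j) * K i j)"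
    by (simp add: integral_unique)
  have bsym: "b (i - j) = b (j - i)" for i j unfolding b_def by (simp add: power2_commute)
  define S where "S = (\<Sum>j\<in>J. (cmod (x j))\<^sup>2)"
  have row: "(\<Sum>j\<in>J-{i}. b (i - j)) \<le> 2 * exp (2 * R * e) / (a * \<rho>\<^sup>2)" for i
    unfolding b_def sum_distrib_left[symmetric]
    using mult_left_mono[OF sum_inverse_odd_products_int_le[OF J, of i], of "2 * exp (2 * R * e) / (a * \<rho>\<^sup>2)"] a0 by simp
  define OD where "OD = (\<Sum>i\<in>J. \<Sum>j\<in>J-{i}. x i * cnj (x j) * K i j)"
  \<comment> \<open>Schur's test: each product |x i| |x j| is split by the arithmetic-geometric
    mean, and the symmetry of \<open>b\<close> makes the two halves equal after swapping the
    sums.\<close>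
  have "cmod OD \<le> (\<Sum>i\<in>J. \<Sum>j\<in>J-{i}. (cmod (x i))\<^sup>2 / 2 * b (i - j) + (cmod (x j))\<^sup>2 / 2 * b (i - j))"
  proof -
    have "cmod (x i * cnj (x j) * K i j) \<le> (cmod (x i))\<^sup>2 / 2 * b (i - j) + (cmod (x j))\<^sup>2 / 2 * b (i - j)"
      if "i \<in> J" "j \<in> J - {i}" for i j
    proof -
      have Kb: "cmod (K i j) \<le> b (i - j)" using off that by auto
      have "cmod (x i) * cmod (x j) \<le> (cmod (x i))\<^sup>2 / 2 + (cmod (x j))\<^sup>2 / 2"
        using sum_squares_bound[of "cmod (x i)" "cmod (x j)"] by simp
      then have "cmod (x i) * cmod (x j) * cmod (K i j) \<le> ((cmod (x i))\<^sup>2 / 2 + (cmod (x j))\<^sup>2 / 2) * b (i - j)"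
        using Kb by (intro mult_mono) auto
      then show ?thesis by (simp add: norm_mult distrib_right)
    qed
    then show ?thesis unfolding OD_def by (intro order_trans[OF norm_sum] sum_mono) auto
  qed
  also have "\<dots> = (\<Sum>i\<in>J. \<Sum>j\<in>J-{i}. (cmod (x i))\<^sup>2 / 2 * b (i - j)) + (\<Sum>i\<in>J. \<Sum>j\<in>J-{i}. (cmod (x j))\<^sup>2 / 2 * b (i - j))"
    by (simp add: sum.distrib)
  also have "(\<Sum>i\<in>J. \<Sum>j\<in>J-{i}. (cmod (x j))\<^sup>2 / 2 * b (i - j)) = (\<Sum>j\<in>J. \<Sum>i\<in>J-{j}. (cmod (x j))\<^sup>2 / 2 * b (i - j))"
  proof -
    have eq: "J - {i} = {j \<in> J. j \<noteq> i}" "J - {i} = {j \<in> J. i \<noteq> j}" for i by auto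
    show ?thesis by (subst eq(1), subst eq(2)) (rule sum.swap_restrict[OF J J])
  qed
  also have "(\<Sum>i\<in>J. \<Sum>j\<in>J-{i}. (cmod (x i))\<^sup>2 / 2 * b (i - j)) + (\<Sum>j\<in>J. \<Sum>i\<in>J-{j}. (cmod (x j))\<^sup>2 / 2 * b (i - j))
      = (\<Sum>i\<in>J. (cmod (x i))\<^sup>2 * (\<Sum>j\<in>J-{i}. b (i - j)))"
    by (simp add: bsym sum_distrib_left sum.distrib[symmetric] mult.commute)
  also have "\<dots> \<le> (\<Sum>i\<in>J. (cmod (x i))\<^sup>2 * (2 * exp (2 * R * e) / (a * \<rho>\<^sup>2)))"
    by (intro sum_mono mult_left_mono row) auto
  also have "\<dots> = 2 * exp (2 * R * e) / (a * \<rho>\<^sup>2) * S" unfolding S_def by (subst mult.commute) (rule sum_distrib_right[symmetric])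
  finally have OD: "cmod OD \<le> 2 * exp (2 * R * e) / (a * \<rho>\<^sup>2) * S" .
  have "(\<Sum>i\<in>J. \<Sum>j\<in>J. x i * cnj (x j) * K i j) = (\<Sum>i\<in>J. x i * cnj (x i) * K i i) + OD"
    unfolding OD_def sum.distrib[symmetric] by (intro sum.cong refl) (simp add: sum.remove[OF J])
  also have "(\<Sum>i\<in>J. x i * cnj (x i) * K i i) = (\<Sum>i\<in>J. of_real ((cmod (x i))\<^sup>2) * K i i)"
    by (simp only: complex_norm_square)
  finally have I2: "integral {-R..R} (\<lambda>t. cos (a * t) * (cmod (f t))\<^sup>2) = (\<Sum>i\<in>J. (cmod (x i))\<^sup>2 * Re (K i i)) + Re OD"
    unfolding I by simp
  have "(\<Sum>i\<in>J. (cmod (x i))\<^sup>2 * (2 * a / (a\<^sup>2 + 4 * e\<^sup>2))) \<le> (\<Sum>i\<in>J. (cmod (x i))\<^sup>2 * Re (K i i))"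
    unfolding K_def diag by (intro sum_mono mult_left_mono ingham_kernel_diag R a0 im) auto
  then have "2 * a / (a\<^sup>2 + 4 * e\<^sup>2) * S \<le> (\<Sum>i\<in>J. (cmod (x i))\<^sup>2 * Re (K i i))"
    unfolding S_def by (subst mult.commute) (simp only: sum_distrib_right)
  then show "(2 * a / (a\<^sup>2 + 4 * e\<^sup>2) - 2 * exp (2 * R * e) / (a * \<rho>\<^sup>2)) * (\<Sum>j\<in>J. (cmod (x j))\<^sup>2)
           \<le> integral {-R..R} (\<lambda>t. cos (a * t) * (cmod (f t))\<^sup>2)"
    using OD abs_Re_le_cmod[of OD] unfolding I2 S_def[symmetric] by (simp add: left_diff_distrib)
  have "(\<Sum>i\<in>J. (cmod (x i))\<^sup>2 * Re (K i i)) \<le> (\<Sum>i\<in>J. (cmod (x i))\<^sup>2 * (2 * exp (2 * R * e) / a))"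
    unfolding K_def diag by (intro sum_mono mult_left_mono ingham_kernel_diag R a0 im) auto
  then have up: "(\<Sum>i\<in>J. (cmod (x i))\<^sup>2 * Re (K i i)) \<le> 2 * exp (2 * R * e) / a * S"
    unfolding S_def by (subst mult.commute) (simp only: sum_distrib_right)
  have "2 * exp (2 * R * e) / (a * \<rho>\<^sup>2) \<le> 2 * exp (2 * R * e) / a"
    using a0 \<rho> by (intro divide_left_mono) (auto simp: power2_eq_square intro: less_imp_le less_1_mult)
  then have rho_le: "2 * exp (2 * R * e) / (a * \<rho>\<^sup>2) * S \<le> 2 * exp (2 * R * e) / a * S"
    by (rule mult_right_mono) (auto simp: S_def sum_nonneg)
  show "integral {-R..R} (\<lambda>t. cos (a * t) * (cmod (f t))\<^sup>2)
           \<le> 4 * exp (2 * R * e) / a * (\<Sum>j\<in>J. (cmod (x j))\<^sup>2)"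
  proof -
    have "4 * exp (2 * R * e) / a * S = 2 * exp (2 * R * e) / a * S + 2 * exp (2 * R * e) / a * S"
      by (simp add: field_simps)
    moreover have "Re OD \<le> 2 * exp (2 * R * e) / a * S"
      using complex_Re_le_cmod[of OD] OD rho_le by (rule order_trans[OF order_trans])
    ultimately show ?thesis unfolding I2 S_def[symmetric] using up by (simp only: add_mono)
  qed
qed

section \<open>Scalar inequalities on [0, T] for exponents with bounded imaginary part\<close>

lemma continuous_on_exp_sum [continuous_intros]:
  "continuous_on S (\<lambda>t. \<Sum>j\<in>J. x j * exp (l j * complex_of_real t))"
  by (intro continuous_intros)

lemma exp_sum_shift:
  "(\<Sum>j\<in>J. x j * exp (\<i> * l j * of_real (s + h))) = (\<Sum>j\<in>J. x j * exp (\<i> * l j * of_real h) * exp (\<i> * l j * complex_of_real s))"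
  by (intro sum.cong refl) (simp add: exp_add[symmetric] algebra_simps)

text \<open>With \<open>R = T / 2\<close> the condition \<open>T > 2 * pi / g\<close> says exactly
  \<rho> > 1. At e = 0 the constant of the quadratic form is 2 / a - 2 / (a \<rho>^2) > 0, so by
  continuity some positive \<open>e\<close> still works.\<close>

lemma ingham_lower:
  assumes g: "g > 0" and T: "T > 2 * pi / g"
  shows "\<exists>e>0. \<exists>A>0. \<forall>(J :: int set) l x. finite J \<longrightarrow>
     (\<forall>i\<in>J. \<forall>j\<in>J. g * \<bar>real_of_int (i - j)\<bar> \<le> \<bar>Re (l i) - Re (l j)\<bar>) \<longrightarrow>
     (\<forall>j\<in>J. \<bar>Im (l j)\<bar> \<le> e) \<longrightarrow>
     A * (\<Sum>j\<in>J. (cmod (x j))\<^sup>2) \<le> sqint T (\<lambda>t. \<Sum>j\<in>J. x j * exp (\<i> * l j * of_real t))"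
proof -
  define R where "R = T / 2"
  define a where "a = pi / (2 * R)"
  define \<rho> where "\<rho> = g / (2 * a)"
  have "0 < 2 * pi / g" using g by simp
  then have T0: "T > 0" using T by linarith
  have R: "R > 0" using T0 by (simp add: R_def)
  have a0: "a > 0" using R by (simp add: a_def)
  have \<rho>: "\<rho> > 1" using T g T0 unfolding \<rho>_def a_def R_def by (simp add: field_simps)
  have "((\<lambda>e. 2 * a / (a\<^sup>2 + 4 * e\<^sup>2) - 2 * exp (2 * R * e) / (a * \<rho>\<^sup>2)) \<longlongrightarrow>
          2 * a / (a\<^sup>2 + 4 * 0\<^sup>2) - 2 * exp (2 * R * 0) / (a * \<rho>\<^sup>2)) (at_right 0)"
    using a0 \<rho> by (intro tendsto_intros) auto
  moreover have "2 * a / (a\<^sup>2 + 4 * 0\<^sup>2) - 2 * exp (2 * R * 0) / (a * \<rho>\<^sup>2) > 0"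
  proof -
    have "2 / (a * \<rho>\<^sup>2) < 2 / a" using a0 \<rho> by (simp add: field_simps one_less_power)
    then show ?thesis using a0 by (simp add: power2_eq_square)
  qed
  ultimately have "\<forall>\<^sub>F e in at_right 0. 2 * a / (a\<^sup>2 + 4 * e\<^sup>2) - 2 * exp (2 * R * e) / (a * \<rho>\<^sup>2) > 0"
    by (rule order_tendstoD)
  then have "\<forall>\<^sub>F e in at_right 0. 2 * a / (a\<^sup>2 + 4 * e\<^sup>2) - 2 * exp (2 * R * e) / (a * \<rho>\<^sup>2) > 0 \<and> e > 0"
    using eventually_at_right_less by (rule eventually_conj)
  then obtain e where e: "2 * a / (a\<^sup>2 + 4 * e\<^sup>2) - 2 * exp (2 * R * e) / (a * \<rho>\<^sup>2) > 0" "e > 0"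
    using eventually_happens'[OF trivial_limit_at_right_real] by blast
  define A0 where "A0 = 2 * a / (a\<^sup>2 + 4 * e\<^sup>2) - 2 * exp (2 * R * e) / (a * \<rho>\<^sup>2)"
  have "A0 * exp (- (2 * e * R)) * (\<Sum>j\<in>J. (cmod (x j))\<^sup>2) \<le> sqint T (\<lambda>t. \<Sum>j\<in>J. x j * exp (\<i> * l j * of_real t))"
    if J: "finite J" and gap: "\<forall>i\<in>J. \<forall>j\<in>J. g * \<bar>real_of_int (i - j)\<bar> \<le> \<bar>Re (l i) - Re (l j)\<bar>"
      and im: "\<forall>j\<in>J. \<bar>Im (l j)\<bar> \<le> e" for J :: "int set" and l x
  proof -
    \<comment> \<open>Recentring [0, T] to [-R, R] changes each coefficient in modulus by a factor
      between exp (- e R) and exp (e R).\<close>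
    define y where "y = (\<lambda>j. x j * exp (\<i> * l j * of_real R))"
    define f where "f = (\<lambda>t::real. \<Sum>j\<in>J. x j * exp (\<i> * l j * of_real t))"
    have yx: "exp (- (2 * e * R)) * (cmod (x j))\<^sup>2 \<le> (cmod (y j))\<^sup>2" if "j \<in> J" for j
    proof -
      have "Im (l j) \<le> e" using im that by auto
      then have "R * Im (l j) \<le> R * e" using R by simp
      then have "exp (- (2 * e * R)) \<le> exp (- (R * (Im (l j) * 2)))" by (simp add: algebra_simps)
      moreover have "(cmod (y j))\<^sup>2 = exp (- (R * (Im (l j) * 2))) * (cmod (x j))\<^sup>2"
        by (simp add: y_def norm_mult norm_exp_eq_Re power_mult_distrib power2_eq_square exp_add[symmetric] algebra_simps)
      ultimately show ?thesis by (simp add: mult_right_mono)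
    qed
    have fs: "(\<Sum>j\<in>J. y j * exp (\<i> * l j * of_real s)) = f (s + R)" for s
      unfolding f_def y_def exp_sum_shift ..
    have fc': "continuous_on S (\<lambda>s. f (s + R))" for S
      unfolding f_def by (intro continuous_intros)
    have "A0 * exp (- (2 * e * R)) * (\<Sum>j\<in>J. (cmod (x j))\<^sup>2) = A0 * (\<Sum>j\<in>J. exp (- (2 * e * R)) * (cmod (x j))\<^sup>2)"
      by (simp add: sum_distrib_left mult.assoc)
    also have "\<dots> \<le> A0 * (\<Sum>j\<in>J. (cmod (y j))\<^sup>2)"
      using e by (intro mult_left_mono sum_mono yx) (auto simp: A0_def)
    also have "\<dots> \<le> integral {-R..R} (\<lambda>s. cos (a * s) * (cmod (f (s + R)))\<^sup>2)"
      unfolding A0_def fs[symmetric]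
    proof (rule ingham_quadratic_form(1)[OF J R a_def \<rho>])
      show "2 * a * \<rho> * \<bar>real_of_int (i - j)\<bar> \<le> \<bar>Re (l i) - Re (l j)\<bar>" if "i \<in> J" "j \<in> J" for i j
        using gap that a0 by (auto simp: \<rho>_def)
    qed (use im in auto)
    also have "\<dots> \<le> integral {-R..R} (\<lambda>s. (cmod (f (s + R)))\<^sup>2)"
      by (intro integral_le integrable_continuous_interval continuous_intros fc') (use mult_right_mono[OF cos_le_one] in auto)
    also have "\<dots> = sqint T f"
      unfolding integral_shift_interval[of "-R" R "\<lambda>t. (cmod (f t))\<^sup>2"] sqint_def by (simp add: R_def)
    finally show ?thesis unfolding f_def .
  qed
  moreover have "A0 * exp (- (2 * e * R)) > 0" using e by (simp add: A0_def)
  ultimately show ?thesis using e(2) by blast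
qed

text \<open>The kernel may live on a larger interval: \<open>R = T + 2 * pi / g\<close> forces
  \<rho> > 1 for every T > 0. The kernel is nonnegative on [-R, R] and at least 1/2 on [-T/2, T/2],
  so it dominates half the plain integral there.\<close>

lemma ingham_upper:
  assumes g: "g > 0" and T: "T > 0"
  shows "\<exists>B>0. \<forall>(J :: int set) l x. finite J \<longrightarrow>
     (\<forall>i\<in>J. \<forall>j\<in>J. g * \<bar>real_of_int (i - j)\<bar> \<le> \<bar>Re (l i) - Re (l j)\<bar>) \<longrightarrow>
     (\<forall>j\<in>J. \<bar>Im (l j)\<bar> \<le> e) \<longrightarrow>
     sqint T (\<lambda>t. \<Sum>j\<in>J. x j * exp (\<i> * l j * of_real t)) \<le> B * (\<Sum>j\<in>J. (cmod (x j))\<^sup>2)"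
proof -
  define R where "R = T + 2 * pi / g"
  define a where "a = pi / (2 * R)"
  define \<rho> where "\<rho> = g / (2 * a)"
  have "0 < 2 * pi / g" using g by simp
  then have R: "R > 0" "T < R" using T by (auto simp: R_def)
  have a0: "a > 0" using R by (simp add: a_def)
  have \<rho>: "\<rho> > 1"
  proof -
    have "pi < g * R" using T g by (simp add: R_def algebra_simps add_pos_pos)
    then show ?thesis using R by (simp add: \<rho>_def a_def)
  qed
  define B0 where "B0 = 4 * exp (2 * R * e) / a"
  have B0: "B0 > 0" using a0 by (simp add: B0_def)
  have "sqint T (\<lambda>t. \<Sum>j\<in>J. x j * exp (\<i> * l j * of_real t)) \<le> 2 * (B0 * exp (e * T)) * (\<Sum>j\<in>J. (cmod (x j))\<^sup>2)"
    if J: "finite J" and gap: "\<forall>i\<in>J. \<forall>j\<in>J. g * \<bar>real_of_int (i - j)\<bar> \<le> \<bar>Re (l i) - Re (l j)\<bar>"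
      and im: "\<forall>j\<in>J. \<bar>Im (l j)\<bar> \<le> e" for J :: "int set" and l x
  proof -
    define y where "y = (\<lambda>j. x j * exp (\<i> * l j * of_real (T / 2)))"
    define f where "f = (\<lambda>t::real. \<Sum>j\<in>J. x j * exp (\<i> * l j * of_real t))"
    have yx: "(cmod (y j))\<^sup>2 \<le> exp (e * T) * (cmod (x j))\<^sup>2" if "j \<in> J" for j
    proof -
      have "- Im (l j) \<le> e" using im that by auto
      then have "exp (- Im (l j) * T) \<le> exp (e * T)" using T by (simp only: exp_le_cancel_iff mult_right_mono less_imp_le)
      moreover have "(cmod (y j))\<^sup>2 = exp (- Im (l j) * T) * (cmod (x j))\<^sup>2"
        by (simp add: y_def norm_mult norm_exp_eq_Re power_mult_distrib power2_eq_square exp_add[symmetric] algebra_simps)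
      ultimately show ?thesis by (simp add: mult_right_mono)
    qed
    have fs: "(\<Sum>j\<in>J. y j * exp (\<i> * l j * of_real s)) = f (s + T / 2)" for s
      unfolding f_def y_def exp_sum_shift ..
    have fc': "continuous_on S (\<lambda>s. f (s + T / 2))" for S
      unfolding f_def by (intro continuous_intros)
    have cos_nonneg: "0 \<le> cos (a * s)" if "\<bar>s\<bar> \<le> R" for s
    proof -
      have "a * \<bar>s\<bar> \<le> a * R" using that a0 by simp
      also have "\<dots> = pi / 2" using R by (simp add: a_def)
      finally have "\<bar>a * s\<bar> \<le> pi / 2" using a0 by (simp add: abs_mult)
      then show ?thesis by (intro cos_ge_zero) auto
    qed
    have cos_half: "1 / 2 \<le> cos (a * s)" if "\<bar>s\<bar> \<le> R / 2" for s
    proof -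
      have "a * \<bar>s\<bar> \<le> a * (R / 2)" using that a0 by simp
      also have "\<dots> = pi / 4" using R by (simp add: a_def)
      also have "\<dots> \<le> pi / 3" by simp
      finally have "\<bar>a * s\<bar> \<le> pi / 3" using a0 by (simp add: abs_mult)
      then have "cos (pi / 3) \<le> cos \<bar>a * s\<bar>" by (intro cos_monotone_0_pi_le) auto
      then show ?thesis by (simp add: cos_60)
    qed
    have "sqint T f = integral {-(T/2)..T/2} (\<lambda>s. (cmod (f (s + T / 2)))\<^sup>2)"
      unfolding integral_shift_interval[of "-(T/2)" "T/2" "\<lambda>t. (cmod (f t))\<^sup>2"] sqint_def by simp
    also have "\<dots> \<le> integral {-(T/2)..T/2} (\<lambda>s. 2 * (cos (a * s) * (cmod (f (s + T / 2)))\<^sup>2))"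
    proof (intro integral_le integrable_continuous_interval continuous_intros fc')
      fix s assume "s \<in> {-(T/2)..T/2}"
      then have "1 / 2 \<le> cos (a * s)" using R by (intro cos_half) auto
      then show "(cmod (f (s + T / 2)))\<^sup>2 \<le> 2 * (cos (a * s) * (cmod (f (s + T / 2)))\<^sup>2)"
        using mult_right_mono[of 1 "2 * cos (a * s)" "(cmod (f (s + T / 2)))\<^sup>2"] by (simp add: mult.assoc)
    qed
    also have "\<dots> \<le> integral {-R..R} (\<lambda>s. 2 * (cos (a * s) * (cmod (f (s + T / 2)))\<^sup>2))"
      using R T by (intro integral_subset_le integrable_continuous_interval continuous_intros fc')
        (auto intro!: mult_nonneg_nonneg cos_nonneg)
    also have "\<dots> = 2 * integral {-R..R} (\<lambda>s. cos (a * s) * (cmod (f (s + T / 2)))\<^sup>2)" by simp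
    also have "\<dots> \<le> 2 * (B0 * (\<Sum>j\<in>J. (cmod (y j))\<^sup>2))"
      unfolding B0_def fs[symmetric]
    proof (intro mult_left_mono ingham_quadratic_form(2)[OF J R(1) a_def \<rho>])
      show "2 * a * \<rho> * \<bar>real_of_int (i - j)\<bar> \<le> \<bar>Re (l i) - Re (l j)\<bar>" if "i \<in> J" "j \<in> J" for i j
        using gap that a0 by (auto simp: \<rho>_def)
    qed (use im in auto)
    also have "\<dots> \<le> 2 * (B0 * (\<Sum>j\<in>J. exp (e * T) * (cmod (x j))\<^sup>2))"
      using B0 by (intro mult_left_mono sum_mono yx) auto
    also have "\<dots> = 2 * (B0 * exp (e * T)) * (\<Sum>j\<in>J. (cmod (x j))\<^sup>2)" by (simp add: sum_distrib_left mult.assoc)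
    finally show ?thesis unfolding f_def .
  qed
  moreover have "2 * (B0 * exp (e * T)) > 0" using B0 by simp
  ultimately show ?thesis by blast
qed

text \<open>\<open>sym_ext w\<close> lists the exponents of a sequence and of its complex conjugate terms over the nonzero
  integers; the value at 0 is junk and is never used.\<close>

definition sym_ext :: "(nat \<Rightarrow> complex) \<Rightarrow> int \<Rightarrow> complex" where
  "sym_ext w j = (if j > 0 then w (nat j) else - cnj (w (nat (- j))))"

section \<open>Gaps and scalar inequalities for a sequence together with its conjugate terms\<close>

lemma Im_sym_ext: "Im (sym_ext w j) = Im (w (nat \<bar>j\<bar>))"
  by (simp add: sym_ext_def abs_if)

lemma Re_sym_ext: "j \<noteq> 0 \<Longrightarrow> Re (sym_ext w j) = of_int (sgn j) * Re (w (nat \<bar>j\<bar>))"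
  by (simp add: sym_ext_def abs_if sgn_if)

text \<open>Conjugate terms have real parts of the opposite sign, so indices of mixed sign are
  separated by a sum of two real parts. This requires Re w_n \<ge> g' n, which holds eventually
  because the increments exceed some h > g'.\<close>

lemma sym_ext_gap:
  assumes g: "liminf (\<lambda>n. ereal (Re (w (Suc n)) - Re (w n))) = ereal g" and g': "0 < g'" "g' < g"
  shows "\<exists>n1\<ge>1. \<forall>i j. int n1 \<le> \<bar>i\<bar> \<longrightarrow> int n1 \<le> \<bar>j\<bar> \<longrightarrow>
           g' * \<bar>real_of_int (i - j)\<bar> \<le> \<bar>Re (sym_ext w i) - Re (sym_ext w j)\<bar>"
proof -
  define h where "h = (g' + g) / 2"
  have h: "g' < h" "h < g" using g' by (auto simp: h_def)
  have "ereal h < liminf (\<lambda>n. ereal (Re (w (Suc n)) - Re (w n)))" using g h by simp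
  from less_LiminfD[OF this] obtain m where m: "\<And>n. n \<ge> m \<Longrightarrow> h < Re (w (Suc n)) - Re (w n)"
    by (auto simp: eventually_sequentially)
  have tele: "h * (real n - real k) \<le> Re (w n) - Re (w k)" if "k \<ge> m" "n \<ge> k" for n k
    using that(2)
  proof (induction n rule: dec_induct)
    case (step n)
    have "h < Re (w (Suc n)) - Re (w n)" using m that step by simp
    then show ?case using step by (simp add: algebra_simps)
  qed simp
  \<comment> \<open>The surplus slope \<open>h - g'\<close> has to absorb the fixed offset
    \<open>h * real m - Re (w m)\<close>.\<close>
  obtain n2 :: nat where n2: "(h * real m - Re (w m)) / (h - g') \<le> real n2" using real_arch_simple by blast
  define n1 where "n1 = Suc (max m n2)"
  have big: "g' * real n \<le> Re (w n)" if "n \<ge> n1" for n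
  proof -
    have "(h * real m - Re (w m)) / (h - g') \<le> real n" using n2 that by (simp add: n1_def)
    then have "h * real m - Re (w m) \<le> real n * (h - g')" using h by (simp add: pos_divide_le_eq)
    moreover have "m \<le> n" using that by (simp add: n1_def)
    ultimately show ?thesis using tele[of m n] by (simp add: algebra_simps)
  qed
  have same: "g' * \<bar>real n - real k\<bar> \<le> \<bar>Re (w n) - Re (w k)\<bar>" if "n \<ge> n1" "k \<ge> n1" for n k
  proof -
    have *: "g' * \<bar>real n - real k\<bar> \<le> \<bar>Re (w n) - Re (w k)\<bar>" if "n \<ge> k" "k \<ge> n1" for n k
    proof -
      have "g' * (real n - real k) \<le> h * (real n - real k)" using that h by (intro mult_right_mono) auto
      moreover have "m \<le> k" using that by (simp add: n1_def)
      ultimately show ?thesis using tele[of k n] that by simp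
    qed
    show ?thesis
    proof (cases "n \<ge> k")
      case True then show ?thesis using *[OF True] that by simp
    next
      case False then show ?thesis using *[of n k] that by (simp add: abs_minus_commute)
    qed
  qed
  have "g' * \<bar>real_of_int (i - j)\<bar> \<le> \<bar>Re (sym_ext w i) - Re (sym_ext w j)\<bar>"
    if i: "int n1 \<le> \<bar>i\<bar>" and j: "int n1 \<le> \<bar>j\<bar>" for i j
  proof -
    have ni: "nat \<bar>i\<bar> \<ge> n1" "nat \<bar>j\<bar> \<ge> n1" "i \<noteq> 0" "j \<noteq> 0" using i j by (auto simp: n1_def)
    have s: "g' * \<bar>\<bar>real_of_int i\<bar> - \<bar>real_of_int j\<bar>\<bar> \<le> \<bar>Re (w (nat \<bar>i\<bar>)) - Re (w (nat \<bar>j\<bar>))\<bar>"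
      using same[OF ni(1,2)] by simp
    have b: "g' * \<bar>real_of_int i\<bar> \<le> Re (w (nat \<bar>i\<bar>))" "g' * \<bar>real_of_int j\<bar> \<le> Re (w (nat \<bar>j\<bar>))"
      using big[OF ni(1)] big[OF ni(2)] by auto
    then have b2: "g' * (\<bar>real_of_int i\<bar> + \<bar>real_of_int j\<bar>) \<le> \<bar>Re (w (nat \<bar>i\<bar>)) + Re (w (nat \<bar>j\<bar>))\<bar>"
      unfolding distrib_left by linarith
    show ?thesis
    proof (cases "i > 0"; cases "j > 0")
      assume "i > 0" "j > 0" then show ?thesis using s by (simp add: sym_ext_def)
    next
      assume "i > 0" "\<not> j > 0" then show ?thesis using b2 by (simp add: sym_ext_def)
    next
      assume "\<not> i > 0" "j > 0" then show ?thesis using b2 by (simp add: sym_ext_def abs_minus_commute add.commute)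
    next
      assume "\<not> i > 0" "\<not> j > 0" then show ?thesis using s by (simp add: sym_ext_def abs_minus_commute add.commute)
    qed
  qed
  then show ?thesis by (intro exI[of _ n1]) (auto simp: n1_def)
qed

text \<open>Since w and -cnj w have the same imaginary part, one weight exp (\<alpha> t) moves all
  exponents of large index close to the real axis. On [0, T] the square of this weight is at most
  \<open>E\<close>. Choosing \<open>g'\<close> strictly between \<open>2 * pi / T\<close> and
  \<open>g\<close> preserves the threshold.\<close>

lemma ingham_seq_lower:
  assumes g: "liminf (\<lambda>n. ereal (Re (w (Suc n)) - Re (w n))) = ereal g" "g > 0"
    and im: "(\<lambda>n. Im (w n)) \<longlonglongrightarrow> \<alpha>" and T: "T > 2 * pi / g"
  shows "\<exists>A>0. \<exists>n1\<ge>1. \<forall>J x. finite J \<longrightarrow> (\<forall>j\<in>J. int n1 \<le> \<bar>j\<bar>) \<longrightarrow>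
     A * (\<Sum>j\<in>J. (cmod (x j))\<^sup>2) \<le> sqint T (\<lambda>t. \<Sum>j\<in>J. x j * exp (\<i> * sym_ext w j * of_real t))"
proof -
  have "0 < 2 * pi / g" using g by simp
  then have T0: "T > 0" using T by linarith
  have "2 * pi / T < g" using T T0 g(2) by (simp add: field_simps)
  then obtain g' where g': "2 * pi / T < g'" "g' < g" using dense by blast
  moreover have "0 < 2 * pi / T" using T0 by simp
  ultimately have g'0: "g' > 0" by linarith
  have T': "T > 2 * pi / g'" using g' g'0 T0 by (simp add: field_simps)
  from ingham_lower[OF g'0 T'] obtain e A where e: "e > 0" "A > 0" and
    low: "\<And>(J :: int set) l x. finite J \<Longrightarrow>
     (\<forall>i\<in>J. \<forall>j\<in>J. g' * \<bar>real_of_int (i - j)\<bar> \<le> \<bar>Re (l i) - Re (l j)\<bar>) \<Longrightarrow>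
     (\<forall>j\<in>J. \<bar>Im (l j)\<bar> \<le> e) \<Longrightarrow>
     A * (\<Sum>j\<in>J. (cmod (x j))\<^sup>2) \<le> sqint T (\<lambda>t. \<Sum>j\<in>J. x j * exp (\<i> * l j * of_real t))" by blast
  from sym_ext_gap[OF g(1) g'0 g'(2)] obtain n1 where n1: "n1 \<ge> 1" and
    gap: "\<And>i j. int n1 \<le> \<bar>i\<bar> \<Longrightarrow> int n1 \<le> \<bar>j\<bar> \<Longrightarrow>
           g' * \<bar>real_of_int (i - j)\<bar> \<le> \<bar>Re (sym_ext w i) - Re (sym_ext w j)\<bar>" by blast
  from LIMSEQ_D[OF im e(1)] obtain n2 where n2: "\<And>n. n \<ge> n2 \<Longrightarrow> \<bar>Im (w n) - \<alpha>\<bar> < e" by auto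
  define E where "E = exp (2 * \<bar>\<alpha>\<bar> * T)"
  have E: "E > 0" by (simp add: E_def)
  have "A / E * (\<Sum>j\<in>J. (cmod (x j))\<^sup>2) \<le> sqint T (\<lambda>t. \<Sum>j\<in>J. x j * exp (\<i> * sym_ext w j * of_real t))"
    if J: "finite J" "\<forall>j\<in>J. int (max n1 n2) \<le> \<bar>j\<bar>" for J x
  proof -
    define f where "f = (\<lambda>t::real. \<Sum>j\<in>J. x j * exp (\<i> * sym_ext w j * of_real t))"
    have fc: "continuous_on S f" for S unfolding f_def by (intro continuous_intros)
    have "A * (\<Sum>j\<in>J. (cmod (x j))\<^sup>2) \<le> sqint T (\<lambda>t. \<Sum>j\<in>J. x j * exp (\<i> * (sym_ext w j - \<i> * of_real \<alpha>) * of_real t))"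
    proof (rule low[OF J(1)])
      show "\<forall>i\<in>J. \<forall>j\<in>J. g' * \<bar>real_of_int (i - j)\<bar> \<le> \<bar>Re (sym_ext w i - \<i> * of_real \<alpha>) - Re (sym_ext w j - \<i> * of_real \<alpha>)\<bar>"
      proof (intro ballI)
        fix i j assume "i \<in> J" "j \<in> J"
        with J(2) have "int n1 \<le> \<bar>i\<bar>" "int n1 \<le> \<bar>j\<bar>" by auto
        from gap[OF this] show "g' * \<bar>real_of_int (i - j)\<bar> \<le> \<bar>Re (sym_ext w i - \<i> * of_real \<alpha>) - Re (sym_ext w j - \<i> * of_real \<alpha>)\<bar>"
          by simp
      qed
      show "\<forall>j\<in>J. \<bar>Im (sym_ext w j - \<i> * of_real \<alpha>)\<bar> \<le> e"
        using n2 J(2) by (auto simp: Im_sym_ext intro!: less_imp_le)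
    qed
    also have "(\<lambda>t. \<Sum>j\<in>J. x j * exp (\<i> * (sym_ext w j - \<i> * of_real \<alpha>) * of_real t)) = (\<lambda>t. exp (of_real (\<alpha> * t)) * f t)"
      unfolding f_def sum_distrib_left
      by (intro ext sum.cong refl) (simp add: algebra_simps exp_add[symmetric])
    also have "sqint T (\<lambda>t. exp (of_real (\<alpha> * t)) * f t) \<le> integral {0..T} (\<lambda>t. E * (cmod (f t))\<^sup>2)"
      unfolding sqint_def
    proof (intro integral_le integrable_continuous_interval continuous_intros fc)
      fix t assume t: "t \<in> {0..T}"
      have "\<alpha> * t \<le> \<bar>\<alpha>\<bar> * T" using t by (intro mult_mono) auto
      then have "(exp (\<alpha> * t))\<^sup>2 \<le> E" by (simp add: E_def power2_eq_square flip: exp_add)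
      then show "(cmod (exp (of_real (\<alpha> * t)) * f t))\<^sup>2 \<le> E * (cmod (f t))\<^sup>2"
        by (simp add: norm_mult power_mult_distrib mult_right_mono)
    qed
    also have "\<dots> = E * sqint T f" by (simp add: sqint_def)
    finally show ?thesis using E by (simp add: f_def field_simps)
  qed
  then show ?thesis using e E n1 by (intro exI[of _ "A / E"] conjI exI[of _ "max n1 n2"]) auto
qed

lemma sqint_sum_bounded:
  assumes J: "finite J" and T: "T \<ge> 0" and l: "\<And>j. j \<in> J \<Longrightarrow> \<bar>Re (l j)\<bar> \<le> e"
  shows "sqint T (\<lambda>t. \<Sum>j\<in>J. x j * exp (l j * of_real t)) \<le> T * (exp (e * T) * (\<Sum>j\<in>J. cmod (x j)))\<^sup>2"
proof (rule sqint_bounded[OF _ _ T])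
  fix t assume t: "0 \<le> t" "t \<le> T"
  have "cmod (\<Sum>j\<in>J. x j * exp (l j * of_real t)) \<le> (\<Sum>j\<in>J. exp (e * T) * cmod (x j))"
  proof (rule order_trans[OF norm_sum sum_mono])
    fix j assume j: "j \<in> J"
    have "Re (l j) * t \<le> e * t" using l[OF j] t by (intro mult_right_mono) auto
    also have "e * t \<le> e * T" using l[OF j] t by (intro mult_left_mono) auto
    finally have "Re (l j) * t \<le> e * T" .
    then show "cmod (x j * exp (l j * of_real t)) \<le> exp (e * T) * cmod (x j)"
      by (simp add: norm_mult norm_exp_eq_Re mult.commute mult_left_mono)
  qed
  then show "cmod (\<Sum>j\<in>J. x j * exp (l j * of_real t)) \<le> exp (e * T) * (\<Sum>j\<in>J. cmod (x j))"
    by (simp add: sum_distrib_left)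
qed (intro continuous_intros)

text \<open>Indices below the gap threshold \<open>n1\<close> number at most
  \<open>2 * n1 + 1\<close> and are handled by Cauchy-Schwarz, so \<open>J\<close> may contain small
  indices, in contrast to the lower bound.\<close>

lemma ingham_seq_upper:
  assumes g: "liminf (\<lambda>n. ereal (Re (w (Suc n)) - Re (w n))) = ereal g" "g > 0"
    and im: "(\<lambda>n. Im (w n)) \<longlonglongrightarrow> \<alpha>" and T: "T > 0"
  shows "\<exists>B>0. \<forall>J x. finite J \<longrightarrow>
     sqint T (\<lambda>t. \<Sum>j\<in>J. x j * exp (\<i> * sym_ext w j * of_real t)) \<le> B * (\<Sum>j\<in>J. (cmod (x j))\<^sup>2)"
proof -
  have g2: "0 < g / 2" "g / 2 < g" using g by auto
  from convergent_imp_Bseq[OF convergentI[OF im]] obtain e where e: "\<And>n. \<bar>Im (w n)\<bar> \<le> e"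
    by (auto simp: Bseq_def)
  from ingham_upper[OF g2(1) T] obtain B where B: "B > 0" and
    up: "\<And>(J :: int set) l x. finite J \<Longrightarrow>
     (\<forall>i\<in>J. \<forall>j\<in>J. g / 2 * \<bar>real_of_int (i - j)\<bar> \<le> \<bar>Re (l i) - Re (l j)\<bar>) \<Longrightarrow>
     (\<forall>j\<in>J. \<bar>Im (l j)\<bar> \<le> e) \<Longrightarrow>
     sqint T (\<lambda>t. \<Sum>j\<in>J. x j * exp (\<i> * l j * of_real t)) \<le> B * (\<Sum>j\<in>J. (cmod (x j))\<^sup>2)" by blast
  from sym_ext_gap[OF g(1) g2] obtain n1 where n1: "n1 \<ge> 1" and
    gap: "\<And>i j. int n1 \<le> \<bar>i\<bar> \<Longrightarrow> int n1 \<le> \<bar>j\<bar> \<Longrightarrow>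
           g / 2 * \<bar>real_of_int (i - j)\<bar> \<le> \<bar>Re (sym_ext w i) - Re (sym_ext w j)\<bar>" by blast
  define B1 where "B1 = T * ((exp (e * T))\<^sup>2 * (2 * real n1 + 1))"
  have B1: "B1 \<ge> 0" using T by (simp add: B1_def)
  have "sqint T (\<lambda>t. \<Sum>j\<in>J. x j * exp (\<i> * sym_ext w j * of_real t)) \<le> (2 * B + 2 * B1) * (\<Sum>j\<in>J. (cmod (x j))\<^sup>2)"
    if J: "finite J" for J x
  proof -
    define H where "H = {j \<in> J. int n1 \<le> \<bar>j\<bar>}"
    define L where "L = {j \<in> J. \<bar>j\<bar> < int n1}"
    have HL: "finite H" "finite L" "H \<inter> L = {}" "J = H \<union> L" using J by (auto simp: H_def L_def)
    let ?s = "\<lambda>J (t::real). \<Sum>j\<in>J. x j * exp (\<i> * sym_ext w j * of_real t)"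
    have "sqint T (?s J) = sqint T (\<lambda>t. ?s H t + ?s L t)" using HL by (simp add: sum.union_disjoint)
    also have "\<dots> \<le> 2 * sqint T (?s H) + 2 * sqint T (?s L)"
      by (intro sqint_add_le continuous_intros)
    also have "sqint T (?s H) \<le> B * (\<Sum>j\<in>H. (cmod (x j))\<^sup>2)"
    proof (rule up[OF HL(1)])
      show "\<forall>i\<in>H. \<forall>j\<in>H. g / 2 * \<bar>real_of_int (i - j)\<bar> \<le> \<bar>Re (sym_ext w i) - Re (sym_ext w j)\<bar>"
        unfolding H_def using gap by blast
    qed (auto simp: Im_sym_ext e)
    also have "(\<Sum>j\<in>H. (cmod (x j))\<^sup>2) \<le> (\<Sum>j\<in>J. (cmod (x j))\<^sup>2)"
      using J by (intro sum_mono2) (auto simp: H_def)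
    also have "sqint T (?s L) \<le> T * (exp (e * T) * (\<Sum>j\<in>L. cmod (x j)))\<^sup>2"
      using T by (intro sqint_sum_bounded HL) (auto simp: Im_sym_ext e)
    also have "(exp (e * T) * (\<Sum>j\<in>L. cmod (x j)))\<^sup>2 = (exp (e * T))\<^sup>2 * (\<Sum>j\<in>L. cmod (x j))\<^sup>2"
      by (rule power_mult_distrib)
    also have "(\<Sum>j\<in>L. cmod (x j))\<^sup>2 \<le> real (card L) * (\<Sum>j\<in>L. (cmod (x j))\<^sup>2)"
      using sum_squared_le_sum_of_squares[of "\<lambda>j. cmod (x j)" L] by (simp add: mult.commute)
    also have "\<dots> \<le> (2 * real n1 + 1) * (\<Sum>j\<in>J. (cmod (x j))\<^sup>2)"
    proof (intro mult_mono sum_mono2)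
      have "card L \<le> card {- int n1..int n1}" by (intro card_mono) (auto simp: L_def)
      then show "real (card L) \<le> 2 * real n1 + 1" by simp
    qed (use J in \<open>auto simp: L_def sum_nonneg\<close>)
    finally show ?thesis using B T by (simp add: B1_def algebra_simps)
  qed
  then show ?thesis using B B1 by (intro exI[of _ "2 * B + 2 * B1"]) auto
qed

subsection \<open>Difference operators\<close>

definition shift_op :: "real \<times> complex \<Rightarrow> (real \<Rightarrow> complex) \<Rightarrow> real \<Rightarrow> complex" where
  "shift_op p f = (\<lambda>t. f (t + fst p) - snd p * f t)"

primrec shift_ops :: "(real \<times> complex) list \<Rightarrow> (real \<Rightarrow> complex) \<Rightarrow> real \<Rightarrow> complex" where
  "shift_ops [] f = f"
| "shift_ops (p # ps) f = shift_op p (shift_ops ps f)"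

text \<open>The eigenvalue of \<open>shift_ops ps\<close> on exp (z t).\<close>

definition shift_mult :: "(real \<times> complex) list \<Rightarrow> complex \<Rightarrow> complex" where
  "shift_mult ps z = (\<Prod>p\<leftarrow>ps. exp (z * of_real (fst p)) - snd p)"

lemma shift_mult_simps [simp]:
  "shift_mult [] z = 1"
  "shift_mult (p # ps) z = (exp (z * of_real (fst p)) - snd p) * shift_mult ps z"
  "shift_mult (ps @ qs) z = shift_mult ps z * shift_mult qs z"
  "shift_mult (replicate n p) z = (exp (z * of_real (fst p)) - snd p) ^ n"
  by (simp_all add: shift_mult_def prod_list_replicate)

lemma shift_ops_exp_sum:
  "shift_ops ps (\<lambda>t. \<Sum>j\<in>J. x j * exp (z j * of_real t)) =
     (\<lambda>t. \<Sum>j\<in>J. shift_mult ps (z j) * x j * exp (z j * of_real t))"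
proof (induction ps)
  case (Cons p ps)
  show ?case unfolding shift_ops.simps Cons.IH shift_op_def sum_distrib_left sum_subtractf[symmetric]
    by (intro ext sum.cong refl) (simp add: algebra_simps exp_add)
qed simp

lemma continuous_on_shift_ops:
  assumes "continuous_on UNIV f" shows "continuous_on UNIV (shift_ops ps f)"
proof (induction ps)
  case (Cons p ps)
  have "continuous_on UNIV (\<lambda>t. shift_ops ps f (t + fst p))"
    by (rule continuous_on_compose2[OF Cons]) (auto intro!: continuous_intros)
  then show ?case by (auto simp: shift_op_def intro!: continuous_intros Cons)
qed (simp add: assms)

text \<open>Translations go forward only, so data on [0, T] determine the result on an interval
  shorter by the sum of the shifts. The constant depends on \<open>ps\<close> and not on
  \<open>f\<close>.\<close>

lemma shift_ops_bound:
  assumes "\<forall>p\<in>set ps. fst p \<ge> 0"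
  shows "\<exists>c\<ge>0. \<forall>f. continuous_on UNIV f \<longrightarrow> sqint (T - (\<Sum>p\<leftarrow>ps. fst p)) (shift_ops ps f) \<le> c * sqint T f"
  using assms
proof (induction ps)
  case Nil
  then show ?case by (intro exI[of _ 1]) simp
next
  case (Cons p ps)
  then obtain c where c: "c \<ge> 0" "\<And>f. continuous_on UNIV f \<Longrightarrow> sqint (T - (\<Sum>p\<leftarrow>ps. fst p)) (shift_ops ps f) \<le> c * sqint T f"
    by auto
  define c' where "c' = 2 + 2 * (cmod (snd p))\<^sup>2"
  have "sqint (T - (\<Sum>p\<leftarrow>p # ps. fst p)) (shift_ops (p # ps) f) \<le> (c' * c) * sqint T f" if f: "continuous_on UNIV f" for f
  proof -
    define F where "F = shift_ops ps f"
    define T1 where "T1 = T - (\<Sum>p\<leftarrow>ps. fst p)"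
    have F: "continuous_on UNIV F" unfolding F_def by (rule continuous_on_shift_ops[OF f])
    have F': "continuous_on UNIV (\<lambda>t. F (t + fst p))"
      by (rule continuous_on_compose2[OF F]) (auto intro!: continuous_intros)
    have "sqint (T1 - fst p) (\<lambda>t. F (t + fst p) - snd p * F t) \<le> 2 * sqint (T1 - fst p) (\<lambda>t. F (t + fst p)) + 2 * sqint (T1 - fst p) (\<lambda>t. snd p * F t)"
      by (intro sqint_diff_le F' continuous_intros F)
    also have "sqint (T1 - fst p) (\<lambda>t. F (t + fst p)) \<le> sqint T1 F"
      using sqint_shift_le[OF F, of "fst p" "T1 - fst p"] Cons.prems by simp
    also have "sqint (T1 - fst p) (\<lambda>t. snd p * F t) \<le> sqint T1 (\<lambda>t. snd p * F t)"
      using Cons.prems by (intro sqint_mono_T continuous_intros F) auto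
    also have "\<dots> = (cmod (snd p))\<^sup>2 * sqint T1 F" by (rule sqint_mult)
    finally have "sqint (T1 - fst p) (\<lambda>t. F (t + fst p) - snd p * F t) \<le> c' * sqint T1 F"
      by (simp add: c'_def algebra_simps)
    also have "\<dots> \<le> c' * (c * sqint T f)"
      unfolding F_def T1_def by (intro mult_left_mono c f) (simp add: c'_def)
    finally show ?thesis by (simp add: F_def T1_def shift_op_def algebra_simps)
  qed
  moreover have "c' * c \<ge> 0" using c by (simp add: c'_def)
  ultimately show ?case by blast
qed

text \<open>For each \<open>l\<close> one factor with \<mu> = exp (l h) kills that exponent. It
  would also kill \<open>z0\<close> only if (z0 - l) h were a multiple of 2 pi i, which |z0 - l| h
  \<le> 1 excludes.\<close>

lemma killing_shifts:
  assumes "finite L" "z0 \<notin> L" "\<delta> > 0"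
  shows "\<exists>ps. (\<forall>p\<in>set ps. fst p \<ge> 0) \<and> (\<Sum>p\<leftarrow>ps. fst p) \<le> \<delta> \<and> (\<forall>l\<in>L. shift_mult ps l = 0) \<and> shift_mult ps z0 \<noteq> 0"
  using assms
proof (induction L arbitrary: \<delta> rule: finite_induct)
  case empty
  then show ?case by (intro exI[of _ "[]"]) auto
next
  case (insert l L)
  from insert.IH[of "\<delta> / 2"] insert.prems obtain ps where ps: "\<forall>p\<in>set ps. fst p \<ge> 0" "(\<Sum>p\<leftarrow>ps. fst p) \<le> \<delta> / 2"
    "\<forall>l\<in>L. shift_mult ps l = 0" "shift_mult ps z0 \<noteq> 0" by auto
  \<comment> \<open>Half of the length budget goes to the new factor, the other half to the
    induction hypothesis.\<close>
  define h where "h = min (\<delta> / 2) (1 / cmod (z0 - l))"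
  have ne: "z0 - l \<noteq> 0" using insert.prems by auto
  then have h: "h > 0" "h \<le> \<delta> / 2" using insert.prems by (auto simp: h_def)
  have "exp (z0 * of_real h) \<noteq> exp (l * of_real h)"
  proof
    assume "exp (z0 * of_real h) = exp (l * of_real h)"
    then have "exp ((z0 - l) * of_real h) = 1" by (simp add: left_diff_distrib exp_diff)
    then obtain n :: int where n: "Re ((z0 - l) * of_real h) = 0" "Im ((z0 - l) * of_real h) = of_int (2 * n) * pi"
      by (auto simp: exp_eq_1)
    have "\<bar>Im ((z0 - l) * of_real h)\<bar> \<le> cmod ((z0 - l) * of_real h)" by (rule abs_Im_le_cmod)
    also have "\<dots> = cmod (z0 - l) * h" using h by (simp add: norm_mult)
    also have "\<dots> \<le> cmod (z0 - l) * (1 / cmod (z0 - l))" by (intro mult_left_mono) (auto simp: h_def)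
    also have "\<dots> = 1" using ne by simp
    finally have "\<bar>of_int (2 * n)\<bar> * pi \<le> 1" unfolding n(2) by (simp add: abs_mult)
    have "n = 0"
    proof (rule ccontr)
      assume "n \<noteq> 0"
      then have "1 \<le> \<bar>real_of_int (2 * n)\<bar>" by linarith
      then have "1 * pi \<le> \<bar>real_of_int (2 * n)\<bar> * pi" by (intro mult_right_mono) auto
      then show False using \<open>\<bar>of_int (2 * n)\<bar> * pi \<le> 1\<close> pi_gt3 by linarith
    qed
    then have "(z0 - l) * of_real h = 0" using n by (simp add: complex_eq_iff)
    then show False using ne h by simp
  qed
  then show ?case using ps h
    by (intro exI[of _ "(h, exp (l * of_real h)) # ps"]) (auto simp: field_simps)
qed

text \<open>For small \<open>h\<close> the multiplier divided by \<open>h\<close> is close to \<open>z + \<i> Y\<close>.  If \<open>Y\<close> is large and has the sign of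
  \<open>Im z0\<close>, then \<open>\<bar>z + \<i> Y\<bar>\<close> is larger at \<open>z0\<close> than on the real interval \<open>[-K, K]\<close>.\<close>

lemma contracting_shift:
  fixes z0 :: complex and K :: real
  assumes im: "Im z0 \<noteq> 0" and K: "K \<ge> 0"
  shows "\<exists>Y h0 \<theta>. h0 > 0 \<and> 0 \<le> \<theta> \<and> \<theta> < 1 \<and> (\<forall>h. 0 < h \<longrightarrow> h \<le> h0 \<longrightarrow>
      exp (z0 * of_real h) - (1 - \<i> * of_real (Y * h)) \<noteq> 0 \<and>
      (\<forall>r::real. \<bar>r\<bar> \<le> K \<longrightarrow> cmod (exp (of_real r * of_real h) - (1 - \<i> * of_real (Y * h))) \<le> \<theta> * cmod (exp (z0 * of_real h) - (1 - \<i> * of_real (Y * h)))))"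
proof -
  define b where "b = \<bar>Im z0\<bar>"
  have b: "b > 0" using im by (simp add: b_def)
  \<comment> \<open>Chosen so that y b = 4 K^2 + b, hence (y + b/2)^2 > y^2 + 4 K^2. The 4 K^2 stems
    from |exp (r h) - 1| \<le> 2 K h, and b/2 in place of b leaves room for the passage h to
    0.\<close>
  define y where "y = 4 * K\<^sup>2 / b + 1"
  have y: "y > 0" using b K by (auto simp: y_def intro: add_nonneg_pos)
  define Y where "Y = sgn (Im z0) * y"
  define \<theta> where "\<theta> = sqrt (4 * K\<^sup>2 + y\<^sup>2) / (y + b / 2)"
  have "y * b = 4 * K\<^sup>2 + b" using b by (simp add: y_def field_simps)
  then have "4 * K\<^sup>2 + y\<^sup>2 < (y + b / 2)\<^sup>2" using b by (simp add: power2_sum algebra_simps add_pos_pos)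
  then have "sqrt (4 * K\<^sup>2 + y\<^sup>2) < y + b / 2" using b y by (intro real_less_lsqrt) auto
  then have th: "0 \<le> \<theta>" "\<theta> < 1" using b y by (auto simp: \<theta>_def)
  have YY: "Y\<^sup>2 = y\<^sup>2" using im by (simp add: Y_def power_mult_distrib sgn_if)
  have "\<bar>Im (z0 + \<i> * of_real Y)\<bar> = b + y" using y im by (auto simp: b_def Y_def sgn_if)
  then have lim_gt: "y + b / 2 < cmod (z0 + \<i> * of_real Y)" using abs_Im_le_cmod[of "z0 + \<i> * of_real Y"] b by linarith
  have "((\<lambda>x. exp (z0 * x)) has_field_derivative z0) (at 0)" by (auto intro!: derivative_eq_intros)
  then have "((\<lambda>h. (exp (z0 * h) - 1) / h) \<longlongrightarrow> z0) (at 0)" by (simp add: has_field_derivative_iff)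
  moreover have "filterlim (\<lambda>h::real. complex_of_real h) (at 0) (at_right 0)"
    by (auto simp: filterlim_at eventually_at_filter intro!: tendsto_eq_intros)
  ultimately have "((\<lambda>h::real. (exp (z0 * of_real h) - 1) / of_real h) \<longlongrightarrow> z0) (at_right 0)"
    by (rule filterlim_compose)
  then have "((\<lambda>h::real. cmod ((exp (z0 * of_real h) - 1) / of_real h + \<i> * of_real Y)) \<longlongrightarrow> cmod (z0 + \<i> * of_real Y)) (at_right 0)"
    by (intro tendsto_intros)
  from order_tendstoD(1)[OF this lim_gt] obtain h1 where h1: "h1 > 0"
    "\<And>h. 0 < h \<Longrightarrow> h < h1 \<Longrightarrow> y + b / 2 < cmod ((exp (z0 * of_real h) - 1) / of_real h + \<i> * of_real Y)"
    by (auto simp: eventually_at_right_field)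
  \<comment> \<open>The second bound gives K h \<le> 1, so that the quadratic estimate of the
    exponential applies on [-K, K].\<close>
  define h0 where "h0 = min (h1 / 2) (1 / (K + 1))"
  have h0: "h0 > 0" using h1 K by (simp add: h0_def)
  have "exp (z0 * of_real h) - (1 - \<i> * of_real (Y * h)) \<noteq> 0 \<and>
      (\<forall>r::real. \<bar>r\<bar> \<le> K \<longrightarrow> cmod (exp (of_real r * of_real h) - (1 - \<i> * of_real (Y * h))) \<le> \<theta> * cmod (exp (z0 * of_real h) - (1 - \<i> * of_real (Y * h))))"
    if h: "0 < h" "h \<le> h0" for h
  proof -
    have "h < h1" using h h1(1) by (auto simp: h0_def)
    from h1(2)[OF h(1) this] have "h * (y + b / 2) < h * cmod ((exp (z0 * of_real h) - 1) / of_real h + \<i> * of_real Y)"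
      using h by simp
    also have "\<dots> = cmod (of_real h * ((exp (z0 * of_real h) - 1) / of_real h + \<i> * of_real Y))"
      using h by (simp add: norm_mult)
    also have "of_real h * ((exp (z0 * of_real h) - 1) / of_real h + \<i> * of_real Y) = exp (z0 * of_real h) - (1 - \<i> * of_real (Y * h))"
      using h by (simp add: field_simps)
    finally have big: "h * (y + b / 2) < cmod (exp (z0 * of_real h) - (1 - \<i> * of_real (Y * h)))" .
    moreover have "h * (y + b / 2) > 0" using h b y by simp
    ultimately have nz: "exp (z0 * of_real h) - (1 - \<i> * of_real (Y * h)) \<noteq> 0" by auto
    have "cmod (exp (of_real r * of_real h) - (1 - \<i> * of_real (Y * h))) \<le> \<theta> * cmod (exp (z0 * of_real h) - (1 - \<i> * of_real (Y * h)))"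
      if r: "\<bar>r\<bar> \<le> K" for r
    proof -
      have "K * h \<le> (K + 1) * (1 / (K + 1))" using h K by (intro mult_mono) (auto simp: h0_def)
      then have Kh: "K * h \<le> 1" using K by simp
      have rh: "\<bar>r * h\<bar> \<le> K * h" using r h by (simp add: abs_mult)
      have "\<bar>exp (r * h) - 1\<bar> \<le> 2 * \<bar>r * h\<bar>"
      proof (cases "r * h \<ge> 0")
        case True
        then have "exp (r * h) \<le> 1 + r * h + (r * h)\<^sup>2" using rh Kh by (intro exp_bound) auto
        moreover have "(r * h)\<^sup>2 \<le> r * h" using True rh Kh by (simp add: power2_eq_square mult_left_le)
        ultimately show ?thesis using True by auto
      next
        case False
        then have "exp (r * h) \<le> 1" by (simp only: exp_le_one_iff)
        then show ?thesis using exp_ge_add_one_self[of "r * h"] False by linarith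
      qed
      also have "\<dots> \<le> 2 * (K * h)" using rh by simp
      finally have e2: "(exp (r * h) - 1)\<^sup>2 \<le> (2 * (K * h))\<^sup>2"
        by (metis abs_ge_zero power2_abs power_mono)
      have "cmod (exp (of_real r * of_real h) - (1 - \<i> * of_real (Y * h))) = sqrt ((exp (r * h) - 1)\<^sup>2 + (Y * h)\<^sup>2)"
      proof -
        have "exp (of_real r * of_real h) - (1 - \<i> * of_real (Y * h)) = Complex (exp (r * h) - 1) (Y * h)"
          by (simp add: complex_eq_iff Re_exp Im_exp)
        then show ?thesis by (simp add: cmod_def)
      qed
      also have "\<dots> \<le> sqrt (h\<^sup>2 * (4 * K\<^sup>2 + y\<^sup>2))"
        using e2 by (intro real_sqrt_le_mono) (simp add: power_mult_distrib YY algebra_simps)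
      also have "\<dots> = \<theta> * (h * (y + b / 2))" using h b y by (simp add: real_sqrt_mult \<theta>_def)
      also have "\<dots> \<le> \<theta> * cmod (exp (z0 * of_real h) - (1 - \<i> * of_real (Y * h)))"
        using big th by (intro mult_left_mono) auto
      finally show ?thesis .
    qed
    then show ?thesis using nz by blast
  qed
  then show ?thesis using h0 th by blast
qed

lemma shift_mult_bounded: "\<exists>c>0. \<forall>r::real. \<bar>r\<bar> \<le> K \<longrightarrow> cmod (shift_mult ps (of_real r)) \<le> c"
proof (induction ps)
  case Nil
  show ?case by (intro exI[of _ 1]) simp
next
  case (Cons p ps)
  then obtain c where c: "c > 0" "\<And>r::real. \<bar>r\<bar> \<le> K \<Longrightarrow> cmod (shift_mult ps (of_real r)) \<le> c" by auto
  define d where "d = exp (K * \<bar>fst p\<bar>) + cmod (snd p)"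
  have d: "d > 0" by (auto simp: d_def intro: add_pos_nonneg)
  have "cmod (shift_mult (p # ps) (of_real r)) \<le> d * c" if r: "\<bar>r\<bar> \<le> K" for r :: real
  proof -
    have "r * fst p \<le> K * \<bar>fst p\<bar>"
      using abs_ge_self[of "r * fst p"] mult_right_mono[OF r, of "\<bar>fst p\<bar>"] by (simp add: abs_mult)
    then have "cmod (exp (of_real r * of_real (fst p)) - snd p) \<le> d"
      unfolding d_def by (intro order_trans[OF norm_triangle_ineq4] add_mono) (simp_all add: norm_exp_eq_Re)
    then show ?thesis using c(2)[OF r] d by (simp add: norm_mult mult_mono)
  qed
  then show ?case using c d by (intro exI[of _ "d * c"]) auto
qed

text \<open>The killing operator comes first and has some size \<open>c\<close> on [-K, K]. A
  contracting factor is then repeated \<open>k\<close> times until \<theta>^k outweighs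
  \<open>c\<close>. The total length stays below \<delta> because \<theta> does not depend on
  \<open>h\<close>, so \<open>h\<close> can be chosen after \<open>k\<close>.\<close>

lemma separating_shifts:
  fixes z0 :: complex and K :: real
  assumes im: "Im z0 \<noteq> 0" and K: "K \<ge> 0" and L: "finite L" "z0 \<notin> L" and \<delta>: "\<delta> > 0" and \<epsilon>: "\<epsilon> > 0"
  shows "\<exists>ps. (\<forall>p\<in>set ps. fst p \<ge> 0) \<and> (\<Sum>p\<leftarrow>ps. fst p) \<le> \<delta> \<and> (\<forall>l\<in>L. shift_mult ps l = 0) \<and> shift_mult ps z0 \<noteq> 0 \<and>
     (\<forall>r::real. \<bar>r\<bar> \<le> K \<longrightarrow> cmod (shift_mult ps (of_real r)) \<le> \<epsilon> * cmod (shift_mult ps z0))"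
proof -
  from killing_shifts[OF L, of "\<delta> / 2"] \<delta> obtain ps where ps: "\<forall>p\<in>set ps. fst p \<ge> 0" "(\<Sum>p\<leftarrow>ps. fst p) \<le> \<delta> / 2"
    "\<forall>l\<in>L. shift_mult ps l = 0" "shift_mult ps z0 \<noteq> 0" by auto
  from shift_mult_bounded[of K ps] obtain c where c: "c > 0" "\<And>r::real. \<bar>r\<bar> \<le> K \<Longrightarrow> cmod (shift_mult ps (of_real r)) \<le> c" by auto
  from contracting_shift[OF im K] obtain Y h0 \<theta> where h0: "h0 > 0" and th: "0 \<le> \<theta>" "\<theta> < 1" and
    con: "\<And>h. 0 < h \<Longrightarrow> h \<le> h0 \<Longrightarrow> exp (z0 * of_real h) - (1 - \<i> * of_real (Y * h)) \<noteq> 0"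
    "\<And>h r. 0 < h \<Longrightarrow> h \<le> h0 \<Longrightarrow> \<bar>r\<bar> \<le> K \<Longrightarrow> cmod (exp (of_real r * of_real h) - (1 - \<i> * of_real (Y * h))) \<le> \<theta> * cmod (exp (z0 * of_real h) - (1 - \<i> * of_real (Y * h)))"
    by blast
  define m where "m = cmod (shift_mult ps z0)"
  have m: "m > 0" using ps by (simp add: m_def)
  have "\<epsilon> * m / c > 0" using \<epsilon> m c by simp
  then obtain k0 where k0: "\<theta> ^ k0 < \<epsilon> * m / c" using real_arch_pow_inv[OF _ th(2)] by blast
  define k where "k = Suc k0"
  have "\<theta> ^ k \<le> \<theta> ^ k0" unfolding k_def using th by (intro power_decreasing) auto
  with k0 have "\<theta> ^ k \<le> \<epsilon> * m / c" by linarith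
  then have k: "\<theta> ^ k * c \<le> \<epsilon> * m" "k > 0" using c by (auto simp: k_def pos_le_divide_eq)
  define h where "h = min h0 (\<delta> / (2 * real k))"
  have h: "0 < h" "h \<le> h0" "real k * h \<le> \<delta> / 2"
  proof -
    show "0 < h" "h \<le> h0" using h0 \<delta> k by (auto simp: h_def)
    have "real k * h \<le> real k * (\<delta> / (2 * real k))" by (intro mult_left_mono) (auto simp: h_def)
    then show "real k * h \<le> \<delta> / 2" using k by simp
  qed
  define q where "q = (h, 1 - \<i> * of_real (Y * h))"
  have "cmod (shift_mult (replicate k q @ ps) (of_real r)) \<le> \<epsilon> * cmod (shift_mult (replicate k q @ ps) z0)" if r: "\<bar>r\<bar> \<le> K" for r :: real
  proof -
    let ?q = "cmod (exp (z0 * of_real h) - (1 - \<i> * of_real (Y * h)))"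
    have "cmod (shift_mult (replicate k q @ ps) (of_real r)) = cmod (exp (of_real r * of_real h) - (1 - \<i> * of_real (Y * h))) ^ k * cmod (shift_mult ps (of_real r))"
      by (simp add: q_def norm_mult norm_power)
    also have "\<dots> \<le> (\<theta> * ?q) ^ k * c"
      by (intro mult_mono power_mono con h r c) (auto simp: th)
    also have "\<dots> = ?q ^ k * (\<theta> ^ k * c)" by (simp add: power_mult_distrib)
    also have "\<dots> \<le> ?q ^ k * (\<epsilon> * m)" using k by (intro mult_left_mono) auto
    also have "\<dots> = \<epsilon> * cmod (shift_mult (replicate k q @ ps) z0)" by (simp add: q_def norm_mult norm_power m_def)
    finally show ?thesis .
  qed
  moreover have "(\<Sum>p\<leftarrow>replicate k q @ ps. fst p) \<le> \<delta>" using ps h by (simp add: q_def sum_list_replicate)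
  moreover have "\<forall>p\<in>set (replicate k q @ ps). fst p \<ge> 0" using ps h by (auto simp: q_def)
  moreover have "shift_mult (replicate k q @ ps) z0 \<noteq> 0" using ps con(1)[OF h(1,2)] by (simp add: q_def)
  ultimately show ?thesis using ps(3) by (intro exI[of _ "replicate k q @ ps"]) auto
qed

subsection \<open>Vector valued exponential sums\<close>

text \<open>One scalar component of a vector valued sum. The weight \<open>v\<close> is kept apart
  from the coefficients \<open>s\<close> because both components share the same
  \<open>s\<close>.\<close>

definition esum :: "('i \<Rightarrow> complex) \<Rightarrow> ('i \<Rightarrow> complex) \<Rightarrow> ('i \<Rightarrow> complex) \<Rightarrow> 'i set \<Rightarrow> real \<Rightarrow> complex" where
  "esum z v s I = (\<lambda>t. \<Sum>i\<in>I. (s i * v i) * exp (z i * of_real t))"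

lemma continuous_on_esum: "continuous_on S (esum z v s I)"
  unfolding esum_def by (intro continuous_intros)

lemma esum_union:
  "finite I \<Longrightarrow> finite J \<Longrightarrow> I \<inter> J = {} \<Longrightarrow> esum z v s (I \<union> J) = (\<lambda>t. esum z v s I t + esum z v s J t)"
  unfolding esum_def by (simp add: sum.union_disjoint)

lemma esum_diff: "esum z v (\<lambda>i. s i - s' i) I = (\<lambda>t. esum z v s I t - esum z v s' I t)"
  unfolding esum_def by (simp add: sum_subtractf left_diff_distrib)

lemma esum_mono_neutral:
  "finite J \<Longrightarrow> I \<subseteq> J \<Longrightarrow> (\<And>i. i \<in> J - I \<Longrightarrow> s i = 0) \<Longrightarrow> esum z v s J = esum z v s I"
  unfolding esum_def by (intro ext sum.mono_neutral_right) auto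

lemma shift_ops_esum: "shift_ops ps (esum z v s I) = esum z v (\<lambda>i. shift_mult ps (z i) * s i) I"
  unfolding esum_def shift_ops_exp_sum by (simp add: mult.assoc)

definition enorm :: "real \<Rightarrow> ('i \<Rightarrow> complex) \<Rightarrow> ('i \<Rightarrow> complex) \<Rightarrow> ('i \<Rightarrow> complex) \<Rightarrow> ('i \<Rightarrow> complex) \<Rightarrow> 'i set \<Rightarrow> real" where
  "enorm T z p q s I = sqint T (esum z p s I) + sqint T (esum z q s I)"

lemma enorm_nonneg: "0 \<le> enorm T z p q s I"
  unfolding enorm_def by (intro add_nonneg_nonneg sqint_nonneg)

lemma enorm_union_le:
  assumes "finite I" "finite J" "I \<inter> J = {}"
  shows "enorm T z p q s (I \<union> J) \<le> 2 * enorm T z p q s I + 2 * enorm T z p q s J"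
  unfolding enorm_def esum_union[OF assms]
  using sqint_add_le[OF continuous_on_esum[of _ z p s I] continuous_on_esum[of _ z p s J], of T]
    sqint_add_le[OF continuous_on_esum[of _ z q s I] continuous_on_esum[of _ z q s J], of T] by argo

lemma enorm_part_le:
  assumes "finite I" "finite J" "I \<inter> J = {}"
  shows "enorm T z p q s I \<le> 2 * enorm T z p q s (I \<union> J) + 2 * enorm T z p q s J"
proof -
  have "sqint T (esum z v s I) \<le> 2 * sqint T (esum z v s (I \<union> J)) + 2 * sqint T (esum z v s J)" for v
  proof -
    have "esum z v s I = (\<lambda>t. esum z v s (I \<union> J) t - esum z v s J t)"
      unfolding esum_union[OF assms] by simp
    then show ?thesis using sqint_diff_le[OF continuous_on_esum[of _ z v s "I \<union> J"] continuous_on_esum[of _ z v s J], of T] by simp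
  qed
  from this[of p] this[of q] show ?thesis unfolding enorm_def by argo
qed

lemma enorm_diff_le:
  "enorm T z p q (\<lambda>i. s i - s' i) I \<le> 2 * enorm T z p q s I + 2 * enorm T z p q s' I"
  unfolding enorm_def esum_diff
  using sqint_diff_le[OF continuous_on_esum[of _ z p s I] continuous_on_esum[of _ z p s' I], of T]
    sqint_diff_le[OF continuous_on_esum[of _ z q s I] continuous_on_esum[of _ z q s' I], of T] by argo

lemma enorm_mono_neutral:
  "finite J \<Longrightarrow> I \<subseteq> J \<Longrightarrow> (\<And>i. i \<in> J - I \<Longrightarrow> s i = 0) \<Longrightarrow> enorm T z p q s J = enorm T z p q s I"
  unfolding enorm_def using esum_mono_neutral by metis

lemma enorm_mono_T: "T' \<le> T \<Longrightarrow> enorm T' z p q s I \<le> enorm T z p q s I"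
  unfolding enorm_def by (intro add_mono sqint_mono_T continuous_on_esum)

text \<open>The multipliers depend on the exponents and not on the weights, so one operator serves
  both components and returns a sum over the same \<open>I\<close>. The constant is uniform in
  \<open>s\<close> and \<open>I\<close>.\<close>

lemma enorm_shift_bound:
  assumes "\<forall>p\<in>set ps. fst p \<ge> 0" and "(\<Sum>p\<leftarrow>ps. fst p) \<le> T - T'"
  shows "\<exists>c\<ge>0. \<forall>s I. enorm T' z p q (\<lambda>i. shift_mult ps (z i) * s i) I \<le> c * enorm T z p q s I"
proof -
  from shift_ops_bound[OF assms(1), of T] obtain c where c: "c \<ge> 0"
    "\<And>f. continuous_on UNIV f \<Longrightarrow> sqint (T - (\<Sum>p\<leftarrow>ps. fst p)) (shift_ops ps f) \<le> c * sqint T f" by blast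
  have "sqint T' (esum z v (\<lambda>i. shift_mult ps (z i) * s i) I) \<le> c * sqint T (esum z v s I)" for v s I
  proof -
    have "sqint T' (shift_ops ps (esum z v s I)) \<le> sqint (T - (\<Sum>p\<leftarrow>ps. fst p)) (shift_ops ps (esum z v s I))"
      using assms(2) by (intro sqint_mono_T continuous_on_shift_ops continuous_on_esum) auto
    also have "\<dots> \<le> c * sqint T (esum z v s I)" by (intro c continuous_on_esum)
    finally show ?thesis by (simp only: shift_ops_esum)
  qed
  then have "enorm T' z p q (\<lambda>i. shift_mult ps (z i) * s i) I \<le> c * enorm T z p q s I" for s I
    unfolding enorm_def distrib_left by (intro add_mono)
  then show ?thesis using c(1) by blast
qed

lemma enorm_bounded:
  assumes "finite I" "T \<ge> 0" "\<And>i. i \<in> I \<Longrightarrow> \<bar>Re (z i)\<bar> \<le> K" "\<And>i. i \<in> I \<Longrightarrow> cmod (p i) \<le> M" "\<And>i. i \<in> I \<Longrightarrow> cmod (q i) \<le> M"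
    "(\<Sum>i\<in>I. cmod (s i)) \<le> S" "M \<ge> 0"
  shows "enorm T z p q s I \<le> 2 * (T * (exp (K * T) * (M * S))\<^sup>2)"
proof -
  have "sqint T (esum z v s I) \<le> T * (exp (K * T) * (M * S))\<^sup>2" if v: "\<And>i. i \<in> I \<Longrightarrow> cmod (v i) \<le> M" for v
  proof -
    have "(\<Sum>i\<in>I. cmod (s i * v i)) \<le> (\<Sum>i\<in>I. M * cmod (s i))"
      using v by (intro sum_mono) (auto simp: norm_mult mult.commute[of M] intro!: mult_left_mono)
    also have "\<dots> \<le> M * S" unfolding sum_distrib_left[symmetric] using assms by (intro mult_left_mono) auto
    finally have S: "(\<Sum>i\<in>I. cmod (s i * v i)) \<le> M * S" .
    have "sqint T (esum z v s I) \<le> T * (exp (K * T) * (\<Sum>i\<in>I. cmod (s i * v i)))\<^sup>2"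
      unfolding esum_def by (intro sqint_sum_bounded assms)
    also have "\<dots> \<le> T * (exp (K * T) * (M * S))\<^sup>2"
      using S assms(2) by (intro mult_left_mono power_mono) (auto intro!: mult_nonneg_nonneg sum_nonneg)
    finally show ?thesis .
  qed
  from this[of p] this[of q] show ?thesis using assms unfolding enorm_def by simp
qed

lemma sqint_exp_pos:
  assumes "T > 0" shows "sqint T (\<lambda>t. exp (z * of_real t)) > 0"
proof -
  define e where "e = exp (- (\<bar>Re z\<bar> * T)) ^ 2"
  have "T * e = integral {0..T} (\<lambda>t. e)" using assms by simp
  also have "\<dots> \<le> sqint T (\<lambda>t. exp (z * of_real t))"
    unfolding sqint_def
  proof (intro integral_le sq_integrable continuous_intros)
    fix t assume t: "t \<in> {0..T}"
    have "- (\<bar>Re z\<bar> * T) \<le> - (\<bar>Re z\<bar> * t)" using t by (simp add: mult_left_mono)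
    also have "\<dots> \<le> Re z * t" using t by (metis abs_ge_minus_self abs_mult abs_of_nonneg atLeastAtMost_iff minus_le_iff)
    finally show "e \<le> (cmod (exp (z * of_real t)))\<^sup>2"
      unfolding e_def by (intro power_mono) (auto simp: norm_exp_eq_Re)
  qed auto
  finally show ?thesis using assms by (smt (verit) e_def exp_gt_zero mult_pos_pos zero_less_power)
qed

lemma finite_convergent_subseq:
  fixes s :: "nat \<Rightarrow> 'i \<Rightarrow> complex"
  assumes "finite L" "\<And>i k. i \<in> L \<Longrightarrow> cmod (s k i) \<le> S"
  shows "\<exists>\<rho>. strict_mono \<rho> \<and> (\<forall>i\<in>L. convergent (\<lambda>k. s (\<rho> k) i))"
  using assms
proof (induction L rule: finite_induct)
  case empty
  show ?case by (intro exI[of _ "\<lambda>k. k"]) (auto simp: strict_mono_def)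
next
  case (insert j L)
  then obtain \<rho> where \<rho>: "strict_mono (\<rho> :: nat \<Rightarrow> nat)" "\<forall>i\<in>L. convergent (\<lambda>k. s (\<rho> k) i)" by auto
  have "bounded (range (\<lambda>k. s (\<rho> k) j))" using insert.prems by (auto simp: bounded_iff)
  from bounded_imp_convergent_subsequence[OF this] obtain y \<tau> where \<tau>: "strict_mono (\<tau> :: nat \<Rightarrow> nat)"
    "((\<lambda>k. s (\<rho> k) j) \<circ> \<tau>) \<longlonglongrightarrow> y" by auto
  have "convergent (\<lambda>k. s (\<rho> (\<tau> k)) i)" if "i \<in> insert j L" for i
  proof (cases "i = j")
    case True
    then show ?thesis using \<tau> by (auto simp: o_def convergent_def)
  next
    case False
    then have "convergent (\<lambda>k. s (\<rho> k) i)" using \<rho> that by auto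
    from convergent_subseq_convergent[OF this \<tau>(1)] show ?thesis by (simp add: o_def)
  qed
  moreover have "strict_mono (\<rho> \<circ> \<tau>)" using \<rho> \<tau> by (intro strict_mono_o)
  ultimately show ?case by (intro exI[of _ "\<rho> \<circ> \<tau>"]) (auto simp: o_def)
qed

lemma squeeze_0:
  fixes f g :: "nat \<Rightarrow> real"
  assumes "\<And>k. 0 \<le> f k" "\<And>k. f k \<le> g k" "g \<longlonglongrightarrow> 0"
  shows "f \<longlonglongrightarrow> 0"
  by (rule tendsto_sandwich[OF _ _ tendsto_const assms(3)]) (use assms in auto)

subsection \<open>The compactness argument\<close>

text \<open>\<open>H\<close> is the high frequency part, on which the two-sided estimate is known; \<open>L\<close> is the finite low
  frequency part; \<open>Q\<close> collects the real exponents that are not in \<open>L\<close>.\<close>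

locale exp_family =
  fixes z p q :: "'i \<Rightarrow> complex" and H L Q :: "'i set" and T T' A B K :: real
  assumes T': "0 < T'" "T' < T"
    and finL: "finite L" and disj: "H \<inter> L = {}" "H \<inter> Q = {}" "L \<inter> Q = {}"
    and A: "A > 0" and lower: "\<And>s I. finite I \<Longrightarrow> I \<subseteq> H \<Longrightarrow> A * (\<Sum>i\<in>I. (cmod (s i))\<^sup>2) \<le> enorm T' z p q s I"
    and B: "B \<ge> 0" and upper: "\<And>s I. finite I \<Longrightarrow> I \<subseteq> H \<Longrightarrow> enorm T z p q s I \<le> B * (\<Sum>i\<in>I. (cmod (s i))\<^sup>2)"
    and sepH: "\<And>i. i \<in> H \<Longrightarrow> z i \<notin> z ` L" and imH: "\<And>i. i \<in> H \<Longrightarrow> Im (z i) \<noteq> 0"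
    and K: "K \<ge> 0" and Q: "\<And>i. i \<in> Q \<Longrightarrow> Im (z i) = 0 \<and> \<bar>Re (z i)\<bar> \<le> K \<and> cmod (p i) \<le> 1 \<and> cmod (q i) \<le> 1"
begin

abbreviation "en \<equiv> enorm T z p q"
abbreviation "en' \<equiv> enorm T' z p q"

lemma enorm_Q_le:
  assumes "finite I" "I \<subseteq> Q" "(\<Sum>i\<in>I. cmod (s i)) \<le> S" "0 \<le> T0"
  shows "enorm T0 z p q s I \<le> 2 * (T0 * (exp (K * T0) * S)\<^sup>2)"
  using enorm_bounded[of I T0 z K p 1 q s S] assms Q by (auto simp: subset_eq)

lemma enorm_L_le: "\<exists>C\<ge>0. \<forall>s I. I \<subseteq> L \<longrightarrow> en s I \<le> C * (\<Sum>i\<in>L. (cmod (s i))\<^sup>2)"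
proof -
  define M where "M = (\<Sum>i\<in>L. cmod (p i) + cmod (q i) + \<bar>Re (z i)\<bar>)"
  have "cmod (p i) + cmod (q i) + \<bar>Re (z i)\<bar> \<le> M" if "i \<in> L" for i
    unfolding M_def using that finL by (intro member_le_sum) auto
  then have M: "cmod (p i) \<le> M" "cmod (q i) \<le> M" "\<bar>Re (z i)\<bar> \<le> M" if "i \<in> L" for i
    using that by (smt (verit) norm_ge_zero)+
  have M0: "M \<ge> 0" unfolding M_def by (intro sum_nonneg) auto
  define C where "C = 2 * (T * ((exp (M * T) * M)\<^sup>2 * real (card L)))"
  have "en s I \<le> C * (\<Sum>i\<in>L. (cmod (s i))\<^sup>2)" if I: "I \<subseteq> L" for s I
  proof -
    have fI: "finite I" using I finL finite_subset by blast
    have "en s I \<le> 2 * (T * (exp (M * T) * (M * (\<Sum>i\<in>L. cmod (s i))))\<^sup>2)"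
      using T' M I M0 finL by (intro enorm_bounded fI sum_mono2) auto
    also have "\<dots> = 2 * (T * ((exp (M * T) * M)\<^sup>2 * (\<Sum>i\<in>L. cmod (s i))\<^sup>2))"
      by (simp add: power_mult_distrib)
    also have "\<dots> \<le> 2 * (T * ((exp (M * T) * M)\<^sup>2 * (real (card L) * (\<Sum>i\<in>L. (cmod (s i))\<^sup>2))))"
      using sum_squared_le_sum_of_squares[of "\<lambda>i. cmod (s i)" L] T'
      by (intro mult_left_mono) (auto simp: mult.commute)
    finally show ?thesis by (simp add: C_def mult.assoc)
  qed
  moreover have "C \<ge> 0" using T' by (simp add: C_def)
  ultimately show ?thesis by blast
qed

text \<open>A multiplier that kills \<open>L\<close> and is small on [-K, K] relative to its value
  at \<open>z i\<close> leaves only \<open>H\<close> and a small \<open>Q\<close> part, to which the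
  high frequency bound on the shorter interval applies. The shift constant \<open>c\<close> grows as
  \<epsilon> shrinks, but it multiplies a quantity tending to 0.\<close>

lemma high_coeff_tendsto_0:
  assumes I: "\<And>k. finite (I k)" "\<And>k. I k \<subseteq> H \<union> L \<union> Q" and s0: "\<And>k i. i \<notin> I k \<Longrightarrow> s k i = 0"
    and S: "\<And>k. (\<Sum>i\<in>Q \<inter> I k. cmod (s k i)) \<le> S"
    and lim: "(\<lambda>k. en (s k) (I k)) \<longlonglongrightarrow> 0" and i: "i \<in> H"
  shows "(\<lambda>k::nat. s k i) \<longlonglongrightarrow> 0"
proof (rule LIMSEQ_I)
  fix r :: real assume r: "r > 0"
  \<comment> \<open>\<open>G * \<epsilon>\<^sup>2\<close> is the error from \<open>Q\<close> after
    division by \<open>A * m\<^sup>2\<close>. \<open>G\<close> must not involve \<open>ps\<close>,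
    since \<epsilon> is fixed before the multiplier is chosen.\<close>
  define G where "G = 4 * (T' * (exp (K * T') * S)\<^sup>2) / A"
  have G: "G \<ge> 0" using A T' by (simp add: G_def)
  define \<epsilon> where "\<epsilon> = sqrt (r\<^sup>2 / (2 * (G + 1)))"
  have \<epsilon>: "\<epsilon> > 0" using r G by (simp add: \<epsilon>_def)
  have "\<epsilon>\<^sup>2 = r\<^sup>2 / (2 * (G + 1))" using G by (simp add: \<epsilon>_def)
  then have "G * \<epsilon>\<^sup>2 = (r\<^sup>2 / 2) * (G / (G + 1))" using G by (simp add: field_simps)
  also have "\<dots> \<le> (r\<^sup>2 / 2) * 1" using G by (intro mult_left_mono) auto
  finally have G\<epsilon>: "G * \<epsilon>\<^sup>2 \<le> r\<^sup>2 / 2" by simp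
  obtain ps where ps: "\<forall>p\<in>set ps. fst p \<ge> 0" "(\<Sum>p\<leftarrow>ps. fst p) \<le> T - T'" "\<forall>l\<in>z ` L. shift_mult ps l = 0"
     "shift_mult ps (z i) \<noteq> 0" "\<And>r::real. \<bar>r\<bar> \<le> K \<Longrightarrow> cmod (shift_mult ps (of_real r)) \<le> \<epsilon> * cmod (shift_mult ps (z i))"
    using separating_shifts[OF imH[OF i] K _ sepH[OF i], of "T - T'" \<epsilon>] finL T' \<epsilon> by auto
  define \<mu> where "\<mu> = (\<lambda>j. shift_mult ps (z j))"
  define m where "m = cmod (\<mu> i)"
  have m: "m > 0" using ps by (simp add: m_def \<mu>_def)
  from enorm_shift_bound[OF ps(1,2), of z p q] obtain c where c: "c \<ge> 0"
    "\<And>s I. en' (\<lambda>j. \<mu> j * s j) I \<le> c * en s I" unfolding \<mu>_def by blast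
  have key: "(cmod (s k i))\<^sup>2 \<le> 2 * c / (A * m\<^sup>2) * en (s k) (I k) + G * \<epsilon>\<^sup>2" for k
  proof (cases "i \<in> I k")
    case False
    moreover have "0 \<le> 2 * c / (A * m\<^sup>2) * en (s k) (I k) + G * \<epsilon>\<^sup>2"
      using c(1) A G by (intro add_nonneg_nonneg mult_nonneg_nonneg divide_nonneg_nonneg enorm_nonneg) auto
    ultimately show ?thesis using s0 by simp
  next
    case True
    define f where "f = (\<lambda>j. \<mu> j * s k j)"
    have fin: "finite (H \<inter> I k)" "finite (Q \<inter> I k)" using I by auto
    have Qs: "(\<Sum>j\<in>Q \<inter> I k. cmod (f j)) \<le> \<epsilon> * m * S"
    proof -
      have "cmod (f j) \<le> \<epsilon> * m * cmod (s k j)" if "j \<in> Q \<inter> I k" for j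
      proof -
        have "z j = of_real (Re (z j))" "\<bar>Re (z j)\<bar> \<le> K" using Q that by (auto simp: complex_eq_iff)
        then have "cmod (\<mu> j) \<le> \<epsilon> * m" using ps(5)[of "Re (z j)"] by (simp add: m_def \<mu>_def)
        then show ?thesis unfolding f_def norm_mult by (rule mult_right_mono) auto
      qed
      then have "(\<Sum>j\<in>Q \<inter> I k. cmod (f j)) \<le> (\<Sum>j\<in>Q \<inter> I k. \<epsilon> * m * cmod (s k j))" by (rule sum_mono)
      also have "\<dots> \<le> \<epsilon> * m * S" unfolding sum_distrib_left[symmetric] using S \<epsilon> m by (intro mult_left_mono) auto
      finally show ?thesis .
    qed
    have "A * (m\<^sup>2 * (cmod (s k i))\<^sup>2) = A * (cmod (f i))\<^sup>2" by (simp add: f_def m_def norm_mult power_mult_distrib)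
    also have "\<dots> \<le> A * (\<Sum>j\<in>H \<inter> I k. (cmod (f j))\<^sup>2)"
      using A i True fin by (intro mult_left_mono member_le_sum) auto
    also have "\<dots> \<le> en' f (H \<inter> I k)" by (rule lower) (use fin in auto)
    also have "\<dots> \<le> 2 * en' f (H \<inter> I k \<union> Q \<inter> I k) + 2 * en' f (Q \<inter> I k)"
      using disj by (intro enorm_part_le fin) auto
    also have "en' f (H \<inter> I k \<union> Q \<inter> I k) = en' f (I k)"
      using I ps(3) by (intro enorm_mono_neutral[symmetric]) (auto simp: f_def \<mu>_def)
    also have "en' f (I k) \<le> c * en (s k) (I k)" unfolding f_def by (rule c)
    also have "en' f (Q \<inter> I k) \<le> 2 * (T' * (exp (K * T') * (\<epsilon> * m * S))\<^sup>2)"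
      using fin Qs T' by (intro enorm_Q_le) auto
    also have "2 * (2 * (T' * (exp (K * T') * (\<epsilon> * m * S))\<^sup>2)) = A * m\<^sup>2 * (G * \<epsilon>\<^sup>2)"
      using A by (simp add: G_def power_mult_distrib)
    finally have "A * m\<^sup>2 * (cmod (s k i))\<^sup>2 \<le> 2 * c * en (s k) (I k) + A * m\<^sup>2 * (G * \<epsilon>\<^sup>2)"
      by (simp add: mult.assoc)
    then have "(cmod (s k i))\<^sup>2 \<le> (2 * c * en (s k) (I k) + A * m\<^sup>2 * (G * \<epsilon>\<^sup>2)) / (A * m\<^sup>2)"
      using A m by (subst pos_le_divide_eq) (auto simp: mult.commute)
    also have "\<dots> = 2 * c / (A * m\<^sup>2) * en (s k) (I k) + G * \<epsilon>\<^sup>2" using A m by (simp add: add_divide_distrib)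
    finally show ?thesis .
  qed
  have "(\<lambda>k. 2 * c / (A * m\<^sup>2) * en (s k) (I k)) \<longlonglongrightarrow> 0" by (rule tendsto_mult_right_zero[OF lim])
  from LIMSEQ_D[OF this, of "r\<^sup>2 / 2"] r obtain k0 where k0: "\<And>k. k \<ge> k0 \<Longrightarrow> \<bar>2 * c / (A * m\<^sup>2) * en (s k) (I k)\<bar> < r\<^sup>2 / 2" by auto
  have "norm (s k i - 0) < r" if "k \<ge> k0" for k
  proof -
    have "(cmod (s k i))\<^sup>2 < r\<^sup>2" using key[of k] k0[OF that] G\<epsilon> by argo
    then show ?thesis using r by (simp add: power2_less_imp_less)
  qed
  then show "\<exists>k0. \<forall>k\<ge>k0. norm (s k i - 0) < r" by blast
qed

text \<open>In the finite set \<open>L\<close> all other exponents can be killed outright. What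
  remains is one exponential, whose norm is a positive multiple of |s k i|^2 because the exponent is
  not repeated and one weight is nonzero.\<close>

lemma low_coeff_tendsto_0:
  assumes i: "i \<in> L" "z i \<notin> z ` (L - {i})" "p i \<noteq> 0 \<or> q i \<noteq> 0"
    and lim: "(\<lambda>k. en (s k) L) \<longlonglongrightarrow> 0"
  shows "(\<lambda>k::nat. s k i) \<longlonglongrightarrow> 0"
proof -
  obtain ps where ps: "\<forall>p\<in>set ps. fst p \<ge> 0" "(\<Sum>p\<leftarrow>ps. fst p) \<le> T - T'" "\<forall>l\<in>z ` (L - {i}). shift_mult ps l = 0"
     "shift_mult ps (z i) \<noteq> 0"
    using killing_shifts[OF _ i(2), of "T - T'"] finL T' by auto
  from enorm_shift_bound[OF ps(1,2), of z p q] obtain c where c: "c \<ge> 0"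
    "\<And>s I. en' (\<lambda>j. shift_mult ps (z j) * s j) I \<le> c * en s I" by blast
  define \<beta> where "\<beta> = sqint T' (\<lambda>t. exp (z i * of_real t))"
  define a where "a = (cmod (shift_mult ps (z i)))\<^sup>2 * ((cmod (p i))\<^sup>2 + (cmod (q i))\<^sup>2) * \<beta>"
  have "\<beta> > 0" unfolding \<beta>_def by (rule sqint_exp_pos[OF T'(1)])
  moreover have "(cmod (p i))\<^sup>2 + (cmod (q i))\<^sup>2 > 0" using i(3) by (auto simp: sum_power2_gt_zero_iff)
  ultimately have a: "a > 0" using ps(4) by (simp add: a_def)
  have le: "(cmod (s k i))\<^sup>2 \<le> c / a * en (s k) L" for k
  proof -
    define f where "f = (\<lambda>j. shift_mult ps (z j) * s k j)"
    have "a * (cmod (s k i))\<^sup>2 = en' f {i}"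
    proof -
      have "sqint T' (esum z v f {i}) = (cmod (f i * v i))\<^sup>2 * \<beta>" for v
        unfolding esum_def \<beta>_def by (simp add: sqint_mult[symmetric])
      then show ?thesis unfolding enorm_def by (simp add: a_def f_def norm_mult power_mult_distrib algebra_simps)
    qed
    also have "\<dots> = en' f L" using finL i ps(3) by (intro enorm_mono_neutral[symmetric]) (auto simp: f_def)
    also have "\<dots> \<le> c * en (s k) L" unfolding f_def by (rule c)
    finally show ?thesis using a by (simp add: field_simps)
  qed
  have "(\<lambda>k. (cmod (s k i))\<^sup>2) \<longlonglongrightarrow> 0"
    by (rule squeeze_0[OF _ le tendsto_mult_right_zero[OF lim]]) simp
  from tendsto_real_sqrt[OF this] show ?thesis by (simp add: tendsto_norm_zero_iff)
qed

text \<open>Termwise decay on \<open>H\<close> does not give decay in l2. The lower bound is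
  therefore applied to differences of two members of a subsequence, in which the low coefficients
  converge and so nearly cancel; letting the second index tend to infinity bounds the l2 norm of the
  first. The premise \<open>tail\<close> is an implication because decay on \<open>Q\<close> is to
  be deduced, by domination, from decay on \<open>H\<close>.\<close>

lemma coeffs_tendsto_0:
  assumes I: "\<And>k. finite (I k)" "\<And>k. I k \<subseteq> H \<union> L \<union> Q" and s0: "\<And>k i. i \<notin> I k \<Longrightarrow> s k i = 0"
    and S: "\<And>k. (\<Sum>i\<in>Q \<inter> I k. cmod (s k i)) \<le> S" "\<And>k i. i \<in> L \<Longrightarrow> cmod (s k i) \<le> S"
    and lim: "(\<lambda>k::nat. en (s k) (I k)) \<longlonglongrightarrow> 0"
    and tail: "(\<And>i. i \<in> H \<Longrightarrow> (\<lambda>k. s k i) \<longlonglongrightarrow> 0) \<Longrightarrow> (\<lambda>k. \<Sum>i\<in>Q \<inter> I k. cmod (s k i)) \<longlonglongrightarrow> 0"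
  shows "\<exists>\<rho>. strict_mono \<rho> \<and> (\<lambda>k. \<Sum>i\<in>H \<inter> I (\<rho> k). (cmod (s (\<rho> k) i))\<^sup>2) \<longlonglongrightarrow> 0 \<and>
     (\<forall>i\<in>L. z i \<notin> z ` (L - {i}) \<longrightarrow> p i \<noteq> 0 \<or> q i \<noteq> 0 \<longrightarrow> (\<lambda>k. s (\<rho> k) i) \<longlonglongrightarrow> 0)"
proof -
  have sH: "(\<lambda>k. s k i) \<longlonglongrightarrow> 0" if "i \<in> H" for i
    by (rule high_coeff_tendsto_0[OF I s0 S(1) lim that])
  have sQ: "(\<lambda>k. \<Sum>i\<in>Q \<inter> I k. cmod (s k i)) \<longlonglongrightarrow> 0" by (rule tail[OF sH])
  from finite_convergent_subseq[of L s S, OF finL S(2)] obtain \<rho> where \<rho>: "strict_mono \<rho>" "\<And>i. i \<in> L \<Longrightarrow> convergent (\<lambda>k. s (\<rho> k) i)" by auto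
  define f where "f = (\<lambda>k. s (\<rho> k))"
  define J where "J = (\<lambda>k. I (\<rho> k))"
  define x where "x = (\<lambda>k. en (f k) (J k))"
  define \<sigma> where "\<sigma> = (\<lambda>k. \<Sum>i\<in>Q \<inter> J k. cmod (f k i))"
  have J: "finite (J k)" "J k \<subseteq> H \<union> L \<union> Q" for k using I by (auto simp: J_def)
  have f0: "f k i = 0" if "i \<notin> J k" for k i using s0 that by (simp add: f_def J_def)
  have fH: "(\<lambda>k. f k i) \<longlonglongrightarrow> 0" if "i \<in> H" for i
    using LIMSEQ_subseq_LIMSEQ[OF sH[OF that] \<rho>(1)] by (simp add: f_def o_def)
  have x: "x \<longlonglongrightarrow> 0" using LIMSEQ_subseq_LIMSEQ[OF lim \<rho>(1)] by (simp add: x_def f_def J_def o_def)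
  have \<sigma>: "\<sigma> \<longlonglongrightarrow> 0" using LIMSEQ_subseq_LIMSEQ[OF sQ \<rho>(1)] by (simp add: \<sigma>_def f_def J_def o_def)
  define y where "y = (\<lambda>i. lim (\<lambda>k. f k i))"
  have fL: "(\<lambda>k. f k i) \<longlonglongrightarrow> y i" if "i \<in> L" for i
    using \<rho>(2)[OF that] by (simp add: y_def f_def convergent_LIMSEQ_iff)
  from enorm_L_le obtain C where C: "C \<ge> 0" "\<And>s I. I \<subseteq> L \<Longrightarrow> en s I \<le> C * (\<Sum>i\<in>L. (cmod (s i))\<^sup>2)" by blast
  define D where "D = 2 * (T * (exp (K * T))\<^sup>2)"
  have Q_le: "en g I0 \<le> D * u\<^sup>2" if "finite I0" "I0 \<subseteq> Q" "(\<Sum>i\<in>I0. cmod (g i)) \<le> u" for g I0 u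
    using enorm_Q_le[OF that] T' by (simp add: D_def power_mult_distrib mult.assoc)
  \<comment> \<open>The left side runs over \<open>J k\<close> only, a finite set that does not
    change with \<open>l\<close>, so the limit in \<open>l\<close> can be taken term by
    term.\<close>
  have diff: "A * (\<Sum>i\<in>H \<inter> J k. (cmod (f k i - f l i))\<^sup>2) \<le>
      4 * x k + 4 * x l + 4 * (C * (\<Sum>i\<in>L. (cmod (f k i - f l i))\<^sup>2)) + 4 * (D * (\<sigma> k + \<sigma> l)\<^sup>2)" for k l
  proof -
    define U where "U = J k \<union> J l"
    define g where "g = (\<lambda>i. f k i - f l i)"
    have U: "finite U" "U \<subseteq> H \<union> L \<union> Q" using J by (auto simp: U_def)
    have fin: "finite (H \<inter> U)" "finite (L \<inter> U)" "finite (Q \<inter> U)" using U by auto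
    have "A * (\<Sum>i\<in>H \<inter> J k. (cmod (g i))\<^sup>2) \<le> A * (\<Sum>i\<in>H \<inter> U. (cmod (g i))\<^sup>2)"
      using A fin by (intro mult_left_mono sum_mono2) (auto simp: U_def)
    also have "\<dots> \<le> en' g (H \<inter> U)" by (rule lower) (use fin in auto)
    also have "\<dots> \<le> en g (H \<inter> U)" using T' by (intro enorm_mono_T) auto
    also have "\<dots> \<le> 2 * en g (H \<inter> U \<union> (L \<inter> U \<union> Q \<inter> U)) + 2 * en g (L \<inter> U \<union> Q \<inter> U)"
      using disj fin by (intro enorm_part_le) auto
    also have "H \<inter> U \<union> (L \<inter> U \<union> Q \<inter> U) = U" using U by auto
    also have "en g (L \<inter> U \<union> Q \<inter> U) \<le> 2 * en g (L \<inter> U) + 2 * en g (Q \<inter> U)"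
      using disj fin by (intro enorm_union_le) auto
    also have "en g U \<le> 2 * en (f k) U + 2 * en (f l) U" unfolding g_def by (rule enorm_diff_le)
    also have "en (f k) U = x k" unfolding x_def using U f0 by (intro enorm_mono_neutral) (auto simp: U_def)
    also have "en (f l) U = x l" unfolding x_def using U f0 by (intro enorm_mono_neutral) (auto simp: U_def)
    also have "en g (L \<inter> U) \<le> C * (\<Sum>i\<in>L. (cmod (g i))\<^sup>2)" by (rule C) auto
    also have "en g (Q \<inter> U) \<le> D * (\<sigma> k + \<sigma> l)\<^sup>2"
    proof (rule Q_le)
      have "(\<Sum>i\<in>Q \<inter> U. cmod (g i)) \<le> (\<Sum>i\<in>Q \<inter> U. cmod (f k i) + cmod (f l i))"
        unfolding g_def by (intro sum_mono norm_triangle_ineq4)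
      also have "\<dots> = (\<Sum>i\<in>Q \<inter> U. cmod (f k i)) + (\<Sum>i\<in>Q \<inter> U. cmod (f l i))" by (rule sum.distrib)
      also have "(\<Sum>i\<in>Q \<inter> U. cmod (f k i)) = \<sigma> k" unfolding \<sigma>_def using fin f0
        by (intro sum.mono_neutral_right) (auto simp: U_def)
      also have "(\<Sum>i\<in>Q \<inter> U. cmod (f l i)) = \<sigma> l" unfolding \<sigma>_def using fin f0
        by (intro sum.mono_neutral_right) (auto simp: U_def)
      finally show "(\<Sum>i\<in>Q \<inter> U. cmod (g i)) \<le> \<sigma> k + \<sigma> l" .
    qed (use fin in auto)
    finally have "A * (\<Sum>i\<in>H \<inter> J k. (cmod (g i))\<^sup>2)
        \<le> 2 * (2 * x k + 2 * x l) + 2 * (2 * (C * (\<Sum>i\<in>L. (cmod (g i))\<^sup>2)) + 2 * (D * (\<sigma> k + \<sigma> l)\<^sup>2))"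
      by simp
    then show ?thesis unfolding g_def by argo
  qed
  have lim_l: "A * (\<Sum>i\<in>H \<inter> J k. (cmod (f k i))\<^sup>2) \<le>
      4 * x k + 4 * (C * (\<Sum>i\<in>L. (cmod (f k i - y i))\<^sup>2)) + 4 * (D * (\<sigma> k)\<^sup>2)" for k
  proof (rule LIMSEQ_le)
    have "(\<lambda>l. A * (\<Sum>i\<in>H \<inter> J k. (cmod (f k i - f l i))\<^sup>2)) \<longlonglongrightarrow> A * (\<Sum>i\<in>H \<inter> J k. (cmod (f k i - 0))\<^sup>2)"
      by (intro tendsto_intros fH) auto
    then show "(\<lambda>l. A * (\<Sum>i\<in>H \<inter> J k. (cmod (f k i - f l i))\<^sup>2)) \<longlonglongrightarrow> A * (\<Sum>i\<in>H \<inter> J k. (cmod (f k i))\<^sup>2)" by simp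
    have "(\<lambda>l. 4 * x k + 4 * x l + 4 * (C * (\<Sum>i\<in>L. (cmod (f k i - f l i))\<^sup>2)) + 4 * (D * (\<sigma> k + \<sigma> l)\<^sup>2))
      \<longlonglongrightarrow> 4 * x k + 4 * 0 + 4 * (C * (\<Sum>i\<in>L. (cmod (f k i - y i))\<^sup>2)) + 4 * (D * (\<sigma> k + 0)\<^sup>2)"
      by (intro tendsto_intros fL x \<sigma>) auto
    then show "(\<lambda>l. 4 * x k + 4 * x l + 4 * (C * (\<Sum>i\<in>L. (cmod (f k i - f l i))\<^sup>2)) + 4 * (D * (\<sigma> k + \<sigma> l)\<^sup>2))
      \<longlonglongrightarrow> 4 * x k + 4 * (C * (\<Sum>i\<in>L. (cmod (f k i - y i))\<^sup>2)) + 4 * (D * (\<sigma> k)\<^sup>2)" by simp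
  qed (use diff in auto)
  have high: "(\<lambda>k. \<Sum>i\<in>H \<inter> J k. (cmod (f k i))\<^sup>2) \<longlonglongrightarrow> 0"
  proof (rule squeeze_0)
    have "(\<lambda>k. (4 * x k + 4 * (C * (\<Sum>i\<in>L. (cmod (f k i - y i))\<^sup>2)) + 4 * (D * (\<sigma> k)\<^sup>2)) / A)
      \<longlonglongrightarrow> (4 * 0 + 4 * (C * (\<Sum>i\<in>L. (cmod (y i - y i))\<^sup>2)) + 4 * (D * 0\<^sup>2)) / A"
      by (intro tendsto_intros fL x \<sigma>) (use A in auto)
    then show "(\<lambda>k. (4 * x k + 4 * (C * (\<Sum>i\<in>L. (cmod (f k i - y i))\<^sup>2)) + 4 * (D * (\<sigma> k)\<^sup>2)) / A) \<longlonglongrightarrow> 0" by simp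
    show "(\<Sum>i\<in>H \<inter> J k. (cmod (f k i))\<^sup>2) \<le> (4 * x k + 4 * (C * (\<Sum>i\<in>L. (cmod (f k i - y i))\<^sup>2)) + 4 * (D * (\<sigma> k)\<^sup>2)) / A" for k
      using lim_l[of k] A by (simp add: pos_le_divide_eq mult.commute)
  qed (auto intro!: sum_nonneg)
  \<comment> \<open>Now that the \<open>H\<close> and \<open>Q\<close> parts are negligible, the sum
    over \<open>L\<close> alone has norm tending to 0; the upper bound on \<open>H\<close> enters
    here.\<close>
  have low: "en (f k) L \<le> 2 * x k + 4 * (B * (\<Sum>i\<in>H \<inter> J k. (cmod (f k i))\<^sup>2)) + 4 * (D * (\<sigma> k)\<^sup>2)" for k
  proof -
    have fin: "finite (H \<inter> J k)" "finite (L \<inter> J k)" "finite (Q \<inter> J k)" using J by auto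
    have "en (f k) L = en (f k) (L \<inter> J k)" using finL f0 by (intro enorm_mono_neutral) auto
    also have "\<dots> \<le> 2 * en (f k) (L \<inter> J k \<union> (H \<inter> J k \<union> Q \<inter> J k)) + 2 * en (f k) (H \<inter> J k \<union> Q \<inter> J k)"
      using disj fin by (intro enorm_part_le) auto
    also have "L \<inter> J k \<union> (H \<inter> J k \<union> Q \<inter> J k) = J k" using J by auto
    also have "en (f k) (H \<inter> J k \<union> Q \<inter> J k) \<le> 2 * en (f k) (H \<inter> J k) + 2 * en (f k) (Q \<inter> J k)"
      using disj fin by (intro enorm_union_le) auto
    also have "en (f k) (H \<inter> J k) \<le> B * (\<Sum>i\<in>H \<inter> J k. (cmod (f k i))\<^sup>2)" by (rule upper) (use fin in auto)
    also have "en (f k) (Q \<inter> J k) \<le> D * (\<sigma> k)\<^sup>2" by (rule Q_le) (use fin in \<open>auto simp: \<sigma>_def\<close>)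
    finally have "en (f k) L \<le> 2 * x k + 2 * (2 * (B * (\<Sum>i\<in>H \<inter> J k. (cmod (f k i))\<^sup>2)) + 2 * (D * (\<sigma> k)\<^sup>2))"
      unfolding x_def by simp
    then show ?thesis by argo
  qed
  have "(\<lambda>k. 2 * x k + 4 * (B * (\<Sum>i\<in>H \<inter> J k. (cmod (f k i))\<^sup>2)) + 4 * (D * (\<sigma> k)\<^sup>2)) \<longlonglongrightarrow> 2 * 0 + 4 * (B * 0) + 4 * (D * 0\<^sup>2)"
    by (intro tendsto_intros high x \<sigma>)
  then have "(\<lambda>k. en (f k) L) \<longlonglongrightarrow> 0"
    by (intro squeeze_0[OF enorm_nonneg low]) simp
  then have "(\<lambda>k. f k i) \<longlonglongrightarrow> 0" if "i \<in> L" "z i \<notin> z ` (L - {i})" "p i \<noteq> 0 \<or> q i \<noteq> 0" for i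
    using that by (intro low_coeff_tendsto_0)
  then show ?thesis using \<rho>(1) high unfolding f_def J_def by blast
qed

end

subsection \<open>The concrete family\<close>

text \<open>\<open>Wi\<close> and \<open>Zi\<close> index the exponents from \<open>\<omega>\<close> and \<open>\<zeta>\<close> (negative integers for the conjugate
  terms), \<open>Ri\<close> those from \<open>r\<close>, and \<open>Ei\<close> the exponent \<open>- \<eta>\<close>.\<close>

datatype idx = Wi int | Zi int | Ri nat | Ei

text \<open>The coefficient counterpart of \<open>sym_ext\<close>: index -n carries the conjugate
  coefficient, which belongs to the exponent \<open>- \<i> * cnj (w n)\<close>.\<close>

definition cnj_ext :: "(nat \<Rightarrow> complex) \<Rightarrow> int \<Rightarrow> complex" where
  "cnj_ext v j = (if j > 0 then v (nat j) else cnj (v (nat (- j))))"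

lemma cmod_cnj_ext: "cmod (cnj_ext v j) = cmod (v (nat \<bar>j\<bar>))"
  by (simp add: cnj_ext_def abs_if)

text \<open>Strict at the lower end: \<open>m = 0\<close> leaves out the junk index 0, and the block
  from \<open>m\<close> to \<open>N\<close> is what the N-th partial sum adds to the m-th.\<close>

definition sym_range :: "nat \<Rightarrow> nat \<Rightarrow> int set" where "sym_range m N = {j. int m < \<bar>j\<bar> \<and> \<bar>j\<bar> \<le> int N}"

lemma sym_range_eq: "sym_range m N = int ` {m<..N} \<union> (\<lambda>n. - int n) ` {m<..N}"
proof (intro set_eqI iffI)
  fix j assume j: "j \<in> sym_range m N"
  show "j \<in> int ` {m<..N} \<union> (\<lambda>n. - int n) ` {m<..N}"
  proof (cases "j \<ge> 0")
    case True
    then show ?thesis using j by (intro UnI1 image_eqI[of _ _ "nat j"]) (auto simp: sym_range_def)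
  next
    case False
    then show ?thesis using j by (intro UnI2 image_eqI[of _ _ "nat (- j)"]) (auto simp: sym_range_def)
  qed
qed (auto simp: sym_range_def)

lemma finite_sym_range [simp]: "finite (sym_range m N)" by (simp add: sym_range_eq)

lemma sum_sym_range: "(\<Sum>j\<in>sym_range m N. f j) = (\<Sum>n\<in>{m<..N}. f (int n) + f (- int n))"
proof -
  have "(\<Sum>j\<in>sym_range m N. f j) = (\<Sum>j\<in>int ` {m<..N}. f j) + (\<Sum>j\<in>(\<lambda>n. - int n) ` {m<..N}. f j)"
    unfolding sym_range_eq by (rule sum.union_disjoint) auto
  also have "\<dots> = (\<Sum>n\<in>{m<..N}. f (int n)) + (\<Sum>n\<in>{m<..N}. f (- int n))"
    by (subst (1 2) sum.reindex) (auto simp: inj_on_def)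
  finally show ?thesis by (simp add: sum.distrib)
qed

definition pairs :: "nat \<Rightarrow> nat \<Rightarrow> idx set" where "pairs m N = Wi ` sym_range m N \<union> Zi ` sym_range m N"

lemma finite_pairs [simp]: "finite (pairs m N)" by (simp add: pairs_def)

lemma sum_pairs: "(\<Sum>i\<in>pairs m N. f i) = (\<Sum>n\<in>{m<..N}. f (Wi (int n)) + f (Wi (- int n)) + f (Zi (int n)) + f (Zi (- int n)))"
proof -
  have "(\<Sum>i\<in>pairs m N. f i) = (\<Sum>i\<in>Wi ` sym_range m N. f i) + (\<Sum>i\<in>Zi ` sym_range m N. f i)"
    unfolding pairs_def by (rule sum.union_disjoint) auto
  also have "\<dots> = (\<Sum>j\<in>sym_range m N. f (Wi j)) + (\<Sum>j\<in>sym_range m N. f (Zi j))"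
    by (subst (1 2) sum.reindex) (auto simp: inj_on_def)
  finally show ?thesis unfolding sum_sym_range by (simp add: sum.distrib add.assoc)
qed

lemma sum_split_WZ:
  assumes "finite I" "I \<subseteq> range Wi \<union> range Zi"
  shows "finite (Wi -` I)" "finite (Zi -` I)" "(\<Sum>i\<in>I. f i) = (\<Sum>j\<in>Wi -` I. f (Wi j)) + (\<Sum>j\<in>Zi -` I. f (Zi j))"
proof -
  show fin: "finite (Wi -` I)" "finite (Zi -` I)" using assms by (auto intro!: finite_vimageI simp: inj_def)
  have "I = Wi ` (Wi -` I) \<union> Zi ` (Zi -` I)" using assms(2) by auto
  then have "(\<Sum>i\<in>I. f i) = (\<Sum>i\<in>Wi ` (Wi -` I) \<union> Zi ` (Zi -` I). f i)" by simp
  also have "\<dots> = (\<Sum>i\<in>Wi ` (Wi -` I). f i) + (\<Sum>i\<in>Zi ` (Zi -` I). f i)"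
    by (rule sum.union_disjoint[OF finite_imageI[OF fin(1)] finite_imageI[OF fin(2)]]) blast
  also have "\<dots> = (\<Sum>j\<in>Wi -` I. f (Wi j)) + (\<Sum>j\<in>Zi -` I. f (Zi j))"
    by (subst (1 2) sum.reindex) (auto simp: inj_on_def)
  finally show "(\<Sum>i\<in>I. f i) = (\<Sum>j\<in>Wi -` I. f (Wi j)) + (\<Sum>j\<in>Zi -` I. f (Zi j))" .
qed

text \<open>The gap between the indices n and -n is twice |Re w_n|, so |w_n| grows at least
  linearly.\<close>

lemma inverse_cmod_tendsto_0:
  assumes g: "liminf (\<lambda>n. ereal (Re (w (Suc n)) - Re (w n))) = ereal g" "g > 0"
  shows "(\<lambda>n. 1 / cmod (w n)) \<longlonglongrightarrow> 0"
proof -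
  have g2: "0 < g / 2" "g / 2 < g" using g by auto
  from sym_ext_gap[OF g(1) g2] obtain n1 where n1: "n1 \<ge> 1" and
    gap: "\<And>i j. int n1 \<le> \<bar>i\<bar> \<Longrightarrow> int n1 \<le> \<bar>j\<bar> \<Longrightarrow>
           g / 2 * \<bar>real_of_int (i - j)\<bar> \<le> \<bar>Re (sym_ext w i) - Re (sym_ext w j)\<bar>" by blast
  have big: "g / 2 * real n \<le> cmod (w n)" if "n \<ge> n1" for n
  proof -
    have "g / 2 * \<bar>real_of_int (int n - (- int n))\<bar> \<le> \<bar>Re (sym_ext w (int n)) - Re (sym_ext w (- int n))\<bar>"
      by (rule gap) (use that in auto)
    then have "g / 2 * real n \<le> \<bar>Re (w n)\<bar>" using n1 that by (simp add: sym_ext_def)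
    then show ?thesis using abs_Re_le_cmod[of "w n"] by linarith
  qed
  have "(\<lambda>n. 2 / g * inverse (real n)) \<longlonglongrightarrow> 0" by (rule tendsto_mult_right_zero[OF lim_inverse_n])
  then show ?thesis
  proof (rule Lim_null_comparison[rotated])
    show "\<forall>\<^sub>F n in sequentially. norm (1 / cmod (w n)) \<le> 2 / g * inverse (real n)"
      unfolding eventually_sequentially
    proof (intro exI[of _ n1] allI impI)
      fix n assume n: "n \<ge> n1"
      have pos: "0 < g / 2 * real n" using g2(1) by (rule mult_pos_pos) (use n n1 in simp)
      have pos': "0 < cmod (w n)" using less_le_trans[OF pos big[OF n]] .
      have "1 / cmod (w n) \<le> 1 / (g / 2 * real n)"
        by (rule divide_left_mono[OF big[OF n] _ mult_pos_pos[OF pos' pos]]) simp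
      also have "\<dots> = 2 / g * inverse (real n)" by (simp add: field_simps)
      finally show "norm (1 / cmod (w n)) \<le> 2 / g * inverse (real n)" by simp
    qed
  qed
qed

section \<open>Weights and high frequency bounds for the concrete sums\<close>

locale obs_setting =
  fixes \<omega> \<zeta> c d :: "nat \<Rightarrow> complex" and r :: "nat \<Rightarrow> real" and \<gamma> \<alpha> \<chi>\<^sub>0 M c\<^sub>1 \<eta> T :: real
  assumes const: "\<gamma> > 0" "M > 0" "0 < c\<^sub>1"
    and H1: "liminf (\<lambda>n. ereal (Re (\<omega> (Suc n)) - Re (\<omega> n))) = ereal \<gamma>"
            "liminf (\<lambda>n. ereal (Re (\<zeta> (Suc n)) - Re (\<zeta> n))) = ereal \<gamma>"
    and H2: "(\<lambda>n. Im (\<omega> n)) \<longlonglongrightarrow> \<alpha>" "r \<longlonglongrightarrow> \<chi>\<^sub>0" "(\<lambda>n. Im (\<zeta> n)) \<longlonglongrightarrow> 0"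
    and H3: "\<And>n. n \<ge> 1 \<Longrightarrow> c\<^sub>1 * cmod (\<zeta> n) \<le> cmod (d n)" "\<And>n. n \<ge> 1 \<Longrightarrow> cmod (c n) \<le> M / cmod (\<omega> n)"
    and D_inj: "inj_on \<omega> {1..}" "inj_on \<zeta> {1..}"
    and D_dist: "\<And>n m. n \<ge> 1 \<Longrightarrow> m \<ge> 1 \<Longrightarrow> \<omega> n \<noteq> \<zeta> m"
    and D_pos: "\<And>n. n \<ge> 1 \<Longrightarrow> Re (\<omega> n) > 0" "\<And>n. n \<ge> 1 \<Longrightarrow> Re (\<zeta> n) > 0"
    and T: "T > 2 * pi / \<gamma>"
begin

text \<open>\<open>p\<close> and \<open>q\<close> are the weights with which a coefficient enters \<open>u\<^sub>1\<close> and \<open>u\<^sub>2\<close>; the coefficient at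
  \<open>Zi\<close> is \<open>d\<^sub>n D\<^sub>n\<close>, not \<open>D\<^sub>n\<close>.\<close>

primrec z :: "idx \<Rightarrow> complex" where
  "z (Wi j) = \<i> * sym_ext \<omega> j" | "z (Zi j) = \<i> * sym_ext \<zeta> j" | "z (Ri n) = of_real (r n)" | "z Ei = of_real (- \<eta>)"

primrec p :: "idx \<Rightarrow> complex" where
  "p (Wi j) = 1" | "p (Zi j) = 1 / cnj_ext d j" | "p (Ri n) = 1" | "p Ei = 0"

primrec q :: "idx \<Rightarrow> complex" where
  "q (Wi j) = cnj_ext c j" | "q (Zi j) = 1" | "q (Ri n) = 0" | "q Ei = 1"

lemma T_pos: "T > 0"
proof -
  have "0 < 2 * pi / \<gamma>" using const by simp
  then show ?thesis using T by linarith
qed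

lemma inverse_d_tendsto_0: "(\<lambda>n. 1 / cmod (d n)) \<longlonglongrightarrow> 0"
proof (rule Lim_null_comparison)
  show "(\<lambda>n. 1 / c\<^sub>1 * (1 / cmod (\<zeta> n))) \<longlonglongrightarrow> 0"
    by (rule tendsto_mult_right_zero[OF inverse_cmod_tendsto_0[OF H1(2) const(1)]])
  show "\<forall>\<^sub>F n in sequentially. norm (1 / cmod (d n)) \<le> 1 / c\<^sub>1 * (1 / cmod (\<zeta> n))"
    unfolding eventually_sequentially
  proof (intro exI[of _ 1] allI impI)
    fix n :: nat assume n: "n \<ge> 1"
    have "\<zeta> n \<noteq> 0" using D_pos(2)[OF n] by auto
    then have pos: "0 < c\<^sub>1 * cmod (\<zeta> n)" using const by simp
    have "1 / cmod (d n) \<le> 1 / (c\<^sub>1 * cmod (\<zeta> n))"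
      by (rule divide_left_mono[OF H3(1)[OF n] _ mult_pos_pos[OF less_le_trans[OF pos H3(1)[OF n]] pos]]) simp
    then show "norm (1 / cmod (d n)) \<le> 1 / c\<^sub>1 * (1 / cmod (\<zeta> n))" by simp
  qed
qed

lemma c_tendsto_0: "(\<lambda>n. cmod (c n)) \<longlonglongrightarrow> 0"
proof (rule Lim_null_comparison)
  show "(\<lambda>n. M * (1 / cmod (\<omega> n))) \<longlonglongrightarrow> 0"
    by (rule tendsto_mult_right_zero[OF inverse_cmod_tendsto_0[OF H1(1) const(1)]])
  show "\<forall>\<^sub>F n in sequentially. norm (cmod (c n)) \<le> M * (1 / cmod (\<omega> n))"
    unfolding eventually_sequentially using H3(2) by (intro exI[of _ 1]) auto
qed

lemma d_nonzero: "n \<ge> 1 \<Longrightarrow> d n \<noteq> 0"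
  using H3(1)[of n] D_pos(2)[of n] const(3) by (auto simp: mult_le_0_iff)

lemma pq_bounded: "\<exists>P>0. \<forall>j. cmod (p (Wi j)) \<le> P \<and> cmod (p (Zi j)) \<le> P \<and> cmod (q (Wi j)) \<le> P \<and> cmod (q (Zi j)) \<le> P"
proof -
  obtain P1 where P1: "\<And>n. 1 / cmod (d n) \<le> P1"
    using convergent_imp_Bseq[OF convergentI[OF inverse_d_tendsto_0]] by (auto simp: Bseq_def)
  obtain P2 where P2: "\<And>n. cmod (c n) \<le> P2"
    using convergent_imp_Bseq[OF convergentI[OF c_tendsto_0]] by (auto simp: Bseq_def)
  have "max 1 (max P1 P2) > 0" by simp
  moreover have "1 / cmod (d n) \<le> max 1 (max P1 P2)" "cmod (c n) \<le> max 1 (max P1 P2)" for n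
    using P1[of n] P2[of n] by auto
  ultimately show ?thesis
    by (intro exI[of _ "max 1 (max P1 P2)"]) (simp add: norm_divide cmod_cnj_ext)
qed

text \<open>These two weights carry the cross terms: the \<zeta> terms in u1 and the \<omega> terms
  in u2.\<close>

lemma pq_small:
  assumes "\<epsilon> > 0"
  shows "\<exists>n0. \<forall>j. int n0 \<le> \<bar>j\<bar> \<longrightarrow> cmod (p (Zi j)) \<le> \<epsilon> \<and> cmod (q (Wi j)) \<le> \<epsilon>"
proof -
  from LIMSEQ_D[OF inverse_d_tendsto_0 assms] obtain n1 where n1: "\<And>n. n \<ge> n1 \<Longrightarrow> 1 / cmod (d n) < \<epsilon>" by auto
  from LIMSEQ_D[OF c_tendsto_0 assms] obtain n2 where n2: "\<And>n. n \<ge> n2 \<Longrightarrow> cmod (c n) < \<epsilon>" by auto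
  have "cmod (p (Zi j)) \<le> \<epsilon> \<and> cmod (q (Wi j)) \<le> \<epsilon>" if "int (max n1 n2) \<le> \<bar>j\<bar>" for j
  proof -
    have "n1 \<le> nat \<bar>j\<bar>" "n2 \<le> nat \<bar>j\<bar>" using that by auto
    from n1[OF this(1)] n2[OF this(2)] show ?thesis by (simp add: norm_divide cmod_cnj_ext)
  qed
  then show ?thesis by blast
qed

lemma esum_WZ:
  assumes "finite I" "I \<subseteq> range Wi \<union> range Zi"
  shows "esum z v s I = (\<lambda>t. (\<Sum>j\<in>Wi -` I. (s (Wi j) * v (Wi j)) * exp (\<i> * sym_ext \<omega> j * of_real t))
     + (\<Sum>j\<in>Zi -` I. (s (Zi j) * v (Zi j)) * exp (\<i> * sym_ext \<zeta> j * of_real t)))"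
  unfolding esum_def by (subst sum_split_WZ(3)[OF assms]) simp

lemma sum_mult_bound:
  assumes "\<And>j. j \<in> J \<Longrightarrow> cmod (v j) \<le> P"
  shows "(\<Sum>j\<in>J. (cmod (s j * v j))\<^sup>2) \<le> P\<^sup>2 * (\<Sum>j\<in>J. (cmod (s j))\<^sup>2)"
  unfolding sum_distrib_left
proof (rule sum_mono)
  fix j assume "j \<in> J"
  then have "(cmod (v j))\<^sup>2 \<le> P\<^sup>2" using assms by (intro power_mono) auto
  then show "(cmod (s j * v j))\<^sup>2 \<le> P\<^sup>2 * (cmod (s j))\<^sup>2"
    unfolding norm_mult power_mult_distrib by (subst mult.commute) (rule mult_right_mono, auto)
qed

lemma WZ_upper: "\<exists>B>0. \<forall>s I. finite I \<longrightarrow> I \<subseteq> range Wi \<union> range Zi \<longrightarrow> enorm T z p q s I \<le> B * (\<Sum>i\<in>I. (cmod (s i))\<^sup>2)"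
proof -
  obtain B1 where B1: "B1 > 0" "\<And>J x. finite J \<Longrightarrow> sqint T (\<lambda>t. \<Sum>j\<in>J. x j * exp (\<i> * sym_ext \<omega> j * of_real t)) \<le> B1 * (\<Sum>j\<in>J. (cmod (x j))\<^sup>2)"
    using ingham_seq_upper[OF H1(1) const(1) H2(1) T_pos] by blast
  obtain B2 where B2: "B2 > 0" "\<And>J x. finite J \<Longrightarrow> sqint T (\<lambda>t. \<Sum>j\<in>J. x j * exp (\<i> * sym_ext \<zeta> j * of_real t)) \<le> B2 * (\<Sum>j\<in>J. (cmod (x j))\<^sup>2)"
    using ingham_seq_upper[OF H1(2) const(1) H2(3) T_pos] by blast
  obtain P where P: "P > 0" "\<And>j. cmod (p (Wi j)) \<le> P" "\<And>j. cmod (p (Zi j)) \<le> P" "\<And>j. cmod (q (Wi j)) \<le> P" "\<And>j. cmod (q (Zi j)) \<le> P"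
    using pq_bounded by blast
  define B where "B = 2 * ((B1 + B2) * P\<^sup>2)"
  have "sqint T (esum z v s I) \<le> B * (\<Sum>i\<in>I. (cmod (s i))\<^sup>2)"
    if I: "finite I" "I \<subseteq> range Wi \<union> range Zi" and v: "\<And>j. cmod (v (Wi j)) \<le> P" "\<And>j. cmod (v (Zi j)) \<le> P" for v s I
  proof -
    note sp = sum_split_WZ[OF I]
    define X where "X = (\<Sum>j\<in>Wi -` I. (cmod (s (Wi j)))\<^sup>2)"
    define Y where "Y = (\<Sum>j\<in>Zi -` I. (cmod (s (Zi j)))\<^sup>2)"
    have XY: "X \<ge> 0" "Y \<ge> 0" by (auto simp: X_def Y_def sum_nonneg)
    have "sqint T (\<lambda>t. \<Sum>j\<in>Wi -` I. (s (Wi j) * v (Wi j)) * exp (\<i> * sym_ext \<omega> j * of_real t)) \<le> B1 * (P\<^sup>2 * X)"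
      unfolding X_def by (rule order_trans[OF B1(2)[OF sp(1)] mult_left_mono[OF sum_mult_bound]]) (use v B1 in auto)
    moreover have "sqint T (\<lambda>t. \<Sum>j\<in>Zi -` I. (s (Zi j) * v (Zi j)) * exp (\<i> * sym_ext \<zeta> j * of_real t)) \<le> B2 * (P\<^sup>2 * Y)"
      unfolding Y_def by (rule order_trans[OF B2(2)[OF sp(2)] mult_left_mono[OF sum_mult_bound]]) (use v B2 in auto)
    moreover have "sqint T (esum z v s I) \<le> 2 * sqint T (\<lambda>t. \<Sum>j\<in>Wi -` I. (s (Wi j) * v (Wi j)) * exp (\<i> * sym_ext \<omega> j * of_real t))
       + 2 * sqint T (\<lambda>t. \<Sum>j\<in>Zi -` I. (s (Zi j) * v (Zi j)) * exp (\<i> * sym_ext \<zeta> j * of_real t))"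
      unfolding esum_WZ[OF I] by (intro sqint_add_le continuous_intros)
    ultimately have "sqint T (esum z v s I) \<le> 2 * (B1 * (P\<^sup>2 * X)) + 2 * (B2 * (P\<^sup>2 * Y))" by linarith
    also have "\<dots> \<le> 2 * ((B1 + B2) * (P\<^sup>2 * X)) + 2 * ((B1 + B2) * (P\<^sup>2 * Y))"
      using B1 B2 XY by (intro add_mono mult_left_mono mult_right_mono) auto
    also have "\<dots> = B * (X + Y)" by (simp add: B_def algebra_simps)
    finally show ?thesis by (simp add: sp(3) X_def Y_def)
  qed
  note v_le = this
  have "enorm T z p q s I \<le> (2 * B) * (\<Sum>i\<in>I. (cmod (s i))\<^sup>2)" if "finite I" "I \<subseteq> range Wi \<union> range Zi" for s I
    using add_mono[OF v_le[of I p s, OF that P(2,3)] v_le[of I q s, OF that P(4,5)]] unfolding enorm_def by simp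
  moreover have "B > 0" using B1 B2 P by (simp add: B_def)
  ultimately show ?thesis by (intro exI[of _ "2 * B"]) auto
qed

text \<open>The components separate the families: u1 mainly sees the \<omega> terms and u2 the
  \<zeta> terms. Each scalar lower bound is used in its own component, and the cross terms are
  absorbed as perturbations by the scalar upper bounds and the smallness of their weights.\<close>

lemma WZ_lower:
  assumes T': "T' > 2 * pi / \<gamma>" "T' \<le> T"
  shows "\<exists>A>0. \<exists>n0\<ge>1. \<forall>s I. finite I \<longrightarrow> I \<subseteq> Wi ` {j. int n0 \<le> \<bar>j\<bar>} \<union> Zi ` {j. int n0 \<le> \<bar>j\<bar>} \<longrightarrow>
    A * (\<Sum>i\<in>I. (cmod (s i))\<^sup>2) \<le> enorm T' z p q s I"
proof -
  obtain A1 n1 where A1: "A1 > 0" "n1 \<ge> 1" "\<And>J x. finite J \<Longrightarrow> (\<forall>j\<in>J. int n1 \<le> \<bar>j\<bar>) \<Longrightarrow> A1 * (\<Sum>j\<in>J. (cmod (x j))\<^sup>2) \<le> sqint T' (\<lambda>t. \<Sum>j\<in>J. x j * exp (\<i> * sym_ext \<omega> j * of_real t))"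
    using ingham_seq_lower[OF H1(1) const(1) H2(1) T'(1)] by blast
  obtain A2 n2 where A2: "A2 > 0" "n2 \<ge> 1" "\<And>J x. finite J \<Longrightarrow> (\<forall>j\<in>J. int n2 \<le> \<bar>j\<bar>) \<Longrightarrow> A2 * (\<Sum>j\<in>J. (cmod (x j))\<^sup>2) \<le> sqint T' (\<lambda>t. \<Sum>j\<in>J. x j * exp (\<i> * sym_ext \<zeta> j * of_real t))"
    using ingham_seq_lower[OF H1(2) const(1) H2(3) T'(1)] by blast
  obtain B1 where B1: "B1 > 0" "\<And>J x. finite J \<Longrightarrow> sqint T (\<lambda>t. \<Sum>j\<in>J. x j * exp (\<i> * sym_ext \<omega> j * of_real t)) \<le> B1 * (\<Sum>j\<in>J. (cmod (x j))\<^sup>2)"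
    using ingham_seq_upper[OF H1(1) const(1) H2(1) T_pos] by blast
  obtain B2 where B2: "B2 > 0" "\<And>J x. finite J \<Longrightarrow> sqint T (\<lambda>t. \<Sum>j\<in>J. x j * exp (\<i> * sym_ext \<zeta> j * of_real t)) \<le> B2 * (\<Sum>j\<in>J. (cmod (x j))\<^sup>2)"
    using ingham_seq_upper[OF H1(2) const(1) H2(3) T_pos] by blast
  define A where "A = min A1 A2"
  define B where "B = B1 + B2"
  have AB: "A > 0" "B > 0" "A \<le> A1" "A \<le> A2" "B1 \<le> B" "B2 \<le> B" using A1 A2 B1 B2 by (auto simp: A_def B_def)
  \<comment> \<open>With \<open>B * \<epsilon>\<^sup>2 = A / 4\<close> each cross term, doubled by
    the squared triangle inequality, costs \<open>A / 2\<close>. Adding both components leaves A (X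
    + Y) / 2 \<le> 2 enorm, hence the final constant \<open>A / 4\<close>.\<close>
  define \<epsilon> where "\<epsilon> = sqrt (A / (4 * B))"
  have \<epsilon>: "\<epsilon> > 0" "B * \<epsilon>\<^sup>2 = A / 4" using AB by (auto simp: \<epsilon>_def)
  obtain n3 where n3: "\<And>j. int n3 \<le> \<bar>j\<bar> \<Longrightarrow> cmod (p (Zi j)) \<le> \<epsilon>" "\<And>j. int n3 \<le> \<bar>j\<bar> \<Longrightarrow> cmod (q (Wi j)) \<le> \<epsilon>"
    using pq_small[OF \<epsilon>(1)] by blast
  define n0 where "n0 = max n1 (max n2 n3)"
  have "A / 4 * (\<Sum>i\<in>I. (cmod (s i))\<^sup>2) \<le> enorm T' z p q s I"
    if I: "finite I" "I \<subseteq> Wi ` {j. int n0 \<le> \<bar>j\<bar>} \<union> Zi ` {j. int n0 \<le> \<bar>j\<bar>}" for s I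
  proof -
    have I': "I \<subseteq> range Wi \<union> range Zi" using I by auto
    note sp = sum_split_WZ[OF I(1) I']
    have hi: "\<forall>j\<in>Wi -` I. int n0 \<le> \<bar>j\<bar>" "\<forall>j\<in>Zi -` I. int n0 \<le> \<bar>j\<bar>" using I by auto
    have hi': "\<forall>j\<in>Wi -` I. int n1 \<le> \<bar>j\<bar>" "\<forall>j\<in>Zi -` I. int n2 \<le> \<bar>j\<bar>"
        "\<And>j. j \<in> Wi -` I \<Longrightarrow> int n3 \<le> \<bar>j\<bar>" "\<And>j. j \<in> Zi -` I \<Longrightarrow> int n3 \<le> \<bar>j\<bar>"
    proof -
      have "int n1 \<le> int n0" "int n2 \<le> int n0" "int n3 \<le> int n0" by (auto simp: n0_def)
      then show "\<forall>j\<in>Wi -` I. int n1 \<le> \<bar>j\<bar>" "\<forall>j\<in>Zi -` I. int n2 \<le> \<bar>j\<bar>"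
        "\<And>j. j \<in> Wi -` I \<Longrightarrow> int n3 \<le> \<bar>j\<bar>" "\<And>j. j \<in> Zi -` I \<Longrightarrow> int n3 \<le> \<bar>j\<bar>"
        using hi by (blast intro: order_trans)+
    qed
    define X where "X = (\<Sum>j\<in>Wi -` I. (cmod (s (Wi j)))\<^sup>2)"
    define Y where "Y = (\<Sum>j\<in>Zi -` I. (cmod (s (Zi j)))\<^sup>2)"
    have XY: "X \<ge> 0" "Y \<ge> 0" by (auto simp: X_def Y_def sum_nonneg)
    let ?fW = "\<lambda>v t. \<Sum>j\<in>Wi -` I. (s (Wi j) * v (Wi j)) * exp (\<i> * sym_ext \<omega> j * of_real t)"
    let ?fZ = "\<lambda>v t. \<Sum>j\<in>Zi -` I. (s (Zi j) * v (Zi j)) * exp (\<i> * sym_ext \<zeta> j * of_real t)"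
    have cont: "continuous_on UNIV (?fW v)" "continuous_on UNIV (?fZ v)" for v by (intro continuous_intros)+
    have 1: "A * X \<le> sqint T' (?fW p)"
    proof -
      have "A * X \<le> A1 * X" using AB XY by (intro mult_right_mono) auto
      also have "\<dots> \<le> sqint T' (?fW p)"
        unfolding X_def using A1(3)[OF sp(1) hi'(1), of "\<lambda>j. s (Wi j) * p (Wi j)"] by simp
      finally show ?thesis .
    qed
    have 2: "A * Y \<le> sqint T' (?fZ q)"
    proof -
      have "A * Y \<le> A2 * Y" using AB XY by (intro mult_right_mono) auto
      also have "\<dots> \<le> sqint T' (?fZ q)"
        unfolding Y_def using A2(3)[OF sp(2) hi'(2), of "\<lambda>j. s (Zi j) * q (Zi j)"] by simp
      finally show ?thesis .
    qed
    have 3: "sqint T' (?fZ p) \<le> A / 4 * Y"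
    proof -
      have "sqint T' (?fZ p) \<le> sqint T (?fZ p)" by (intro sqint_mono_T cont T')
      also have "\<dots> \<le> B2 * (\<Sum>j\<in>Zi -` I. (cmod (s (Zi j) * p (Zi j)))\<^sup>2)" by (rule B2(2)[OF sp(2)])
      also have "\<dots> \<le> B * (\<epsilon>\<^sup>2 * Y)" unfolding Y_def
        using AB by (intro mult_mono sum_mult_bound sum_nonneg n3 hi') auto
      finally show ?thesis using \<epsilon>(2) by (simp add: mult.assoc[symmetric])
    qed
    have 4: "sqint T' (?fW q) \<le> A / 4 * X"
    proof -
      have "sqint T' (?fW q) \<le> sqint T (?fW q)" by (intro sqint_mono_T cont T')
      also have "\<dots> \<le> B1 * (\<Sum>j\<in>Wi -` I. (cmod (s (Wi j) * q (Wi j)))\<^sup>2)" by (rule B1(2)[OF sp(1)])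
      also have "\<dots> \<le> B * (\<epsilon>\<^sup>2 * X)" unfolding X_def
        using AB by (intro mult_mono sum_mult_bound sum_nonneg n3 hi') auto
      finally show ?thesis using \<epsilon>(2) by (simp add: mult.assoc[symmetric])
    qed
    have 5: "sqint T' (?fW p) \<le> 2 * sqint T' (esum z p s I) + 2 * sqint T' (?fZ p)"
    proof -
      have eq: "?fW p = (\<lambda>t. esum z p s I t - ?fZ p t)" unfolding esum_WZ[OF I(1) I'] by simp
      show ?thesis by (subst eq) (intro sqint_diff_le cont continuous_on_esum)
    qed
    have 6: "sqint T' (?fZ q) \<le> 2 * sqint T' (esum z q s I) + 2 * sqint T' (?fW q)"
    proof -
      have eq: "?fZ q = (\<lambda>t. esum z q s I t - ?fW q t)" unfolding esum_WZ[OF I(1) I'] by simp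
      show ?thesis by (subst eq) (intro sqint_diff_le cont continuous_on_esum)
    qed
    have "A / 4 * (X + Y) \<le> enorm T' z p q s I"
      unfolding enorm_def using 1 2 3 4 5 6 by argo
    then show ?thesis by (simp add: sp(3) X_def Y_def)
  qed
  then show ?thesis using AB A1(2) by (intro exI[of _ "A / 4"] conjI exI[of _ n0]) (auto simp: n0_def)
qed

end

section \<open>Uniform bounds for the truncated sums\<close>

lemma enorm_cong: "(\<And>i. i \<in> I \<Longrightarrow> s i = s' i) \<Longrightarrow> enorm T z p q s I = enorm T z p q s' I"
  unfolding enorm_def esum_def by simp

lemma enorm_mult: "enorm T z p q (\<lambda>i. a * s i) I = (cmod a)\<^sup>2 * enorm T z p q s I"
proof -
  have "esum z v (\<lambda>i. a * s i) I = (\<lambda>t. a * esum z v s I t)" for v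
    unfolding esum_def by (simp add: sum_distrib_left mult.assoc)
  then show ?thesis unfolding enorm_def by (simp add: sqint_mult distrib_left)
qed

text \<open>As the real parts of \<open>v\<close> and \<open>w\<close> are positive, the sign of an
  index can be read off from the real part of its frequency.\<close>

lemma sym_ext_eqD:
  assumes v: "\<And>n. n \<ge> 1 \<Longrightarrow> Re (v n) > 0" and w: "\<And>n. n \<ge> 1 \<Longrightarrow> Re (w n) > 0"
    and jk: "j \<noteq> 0" "k \<noteq> 0" and eq: "sym_ext v j = sym_ext w k"
  shows "sgn j = sgn k" "v (nat \<bar>j\<bar>) = w (nat \<bar>k\<bar>)"
proof -
  have pos: "Re (v (nat \<bar>j\<bar>)) > 0" "Re (w (nat \<bar>k\<bar>)) > 0" using v[of "nat \<bar>j\<bar>"] w[of "nat \<bar>k\<bar>"] jk by auto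
  have "Re (sym_ext v j) = Re (sym_ext w k)" using eq by simp
  then have "of_int (sgn j) * Re (v (nat \<bar>j\<bar>)) = of_int (sgn k) * Re (w (nat \<bar>k\<bar>))" using jk by (simp add: Re_sym_ext)
  then show s: "sgn j = sgn k" using jk pos by (auto simp: sgn_if split: if_splits)
  show "v (nat \<bar>j\<bar>) = w (nat \<bar>k\<bar>)"
  proof (cases "j > 0")
    case True
    then have "k > 0" using s jk by (auto simp: sgn_if split: if_splits)
    then show ?thesis using eq True by (simp add: sym_ext_def)
  next
    case False
    then have "k < 0" using s jk by (auto simp: sgn_if split: if_splits)
    then show ?thesis using eq False jk by (simp add: sym_ext_def)
  qed
qed

lemma sgn_abs_eqD: "sgn j = sgn k \<Longrightarrow> nat \<bar>j\<bar> = nat \<bar>k\<bar> \<Longrightarrow> j = (k::int)"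
  by (auto simp: sgn_if abs_if split: if_splits)

text \<open>A homogeneous condition on arbitrary coefficient functions, so that it survives the
  normalisation in the proof by contradiction.\<close>

definition dominated :: "(nat \<Rightarrow> real) \<Rightarrow> nat \<Rightarrow> (idx \<Rightarrow> complex) \<Rightarrow> bool" where
  "dominated w N s \<longleftrightarrow> (\<forall>n\<in>{1..N}. cmod (s (Ri n)) \<le> w n * sqrt ((cmod (s (Wi (int n))))\<^sup>2 + (cmod (s (Zi (int n))))\<^sup>2))"

text \<open>Cauchy-Schwarz: a square summable \<open>w\<close> converts l2 control of the \<omega>
  and \<zeta> coefficients into l1 control of the real ones.\<close>

lemma sum_Ri_le:
  assumes F: "finite F" and dom: "\<And>n. n \<in> F \<Longrightarrow> cmod (s (Ri n)) \<le> w n * sqrt ((cmod (s (Wi (int n))))\<^sup>2 + (cmod (s (Zi (int n))))\<^sup>2)"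
  shows "(\<Sum>n\<in>F. cmod (s (Ri n)))\<^sup>2 \<le> (\<Sum>n\<in>F. (w n)\<^sup>2) * (\<Sum>n\<in>F. (cmod (s (Wi (int n))))\<^sup>2 + (cmod (s (Zi (int n))))\<^sup>2)"
proof -
  have "(\<Sum>n\<in>F. cmod (s (Ri n)))\<^sup>2 \<le> (\<Sum>n\<in>F. w n * sqrt ((cmod (s (Wi (int n))))\<^sup>2 + (cmod (s (Zi (int n))))\<^sup>2))\<^sup>2"
    by (intro power_mono sum_mono dom sum_nonneg) auto
  also have "\<dots> \<le> (\<Sum>n\<in>F. (w n)\<^sup>2) * (\<Sum>n\<in>F. (sqrt ((cmod (s (Wi (int n))))\<^sup>2 + (cmod (s (Zi (int n))))\<^sup>2))\<^sup>2)"
    by (rule Cauchy_Schwarz_ineq_sum)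
  finally show ?thesis by simp
qed

lemma sum_positive_part_le:
  "(\<Sum>n\<in>{m<..N}. (cmod (s (Wi (int n))))\<^sup>2 + (cmod (s (Zi (int n))))\<^sup>2) \<le> (\<Sum>i\<in>pairs m N. (cmod (s i))\<^sup>2)"
  unfolding sum_pairs by (intro sum_mono) auto

definition indices :: "nat \<Rightarrow> idx set" where "indices N = pairs 0 N \<union> Ri ` {0<..N} \<union> {Ei}"

lemma finite_indices [simp]: "finite (indices N)" by (simp add: indices_def)

context obs_setting
begin

lemma r_bounded: "\<exists>K\<ge>0. \<forall>n. \<bar>r n\<bar> \<le> K"
proof -
  obtain K where "K > 0" "\<And>n. \<bar>r n\<bar> \<le> K"
    using convergent_imp_Bseq[OF convergentI[OF H2(2)]] by (auto simp: Bseq_def)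
  then show ?thesis by (intro exI[of _ K]) auto
qed

text \<open>The indices of the nonreal exponents, without the junk index 0.\<close>

definition principal :: "idx set" where "principal = Wi ` (- {0}) \<union> Zi ` (- {0})"

lemma pairs_subset_principal: "pairs m N \<subseteq> principal" by (auto simp: pairs_def principal_def sym_range_def)

lemma Im_z_principal: "i \<in> principal \<Longrightarrow> Im (z i) \<noteq> 0"
proof -
  have "Re (sym_ext \<omega> j) \<noteq> 0" "Re (sym_ext \<zeta> j) \<noteq> 0" if "j \<noteq> 0" for j
  proof -
    have "nat \<bar>j\<bar> \<ge> 1" using that by linarith
    from D_pos(1)[OF this] D_pos(2)[OF this] that show "Re (sym_ext \<omega> j) \<noteq> 0" "Re (sym_ext \<zeta> j) \<noteq> 0"
      by (auto simp: Re_sym_ext sgn_if)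
  qed
  then show "i \<in> principal \<Longrightarrow> Im (z i) \<noteq> 0" by (fastforce simp: principal_def)
qed

text \<open>The factor \<i> turns nonzero real parts of frequencies into nonzero imaginary parts of
  exponents, so a principal exponent never equals a real one. Two principal ones are compared first
  by the sign of their index and then by the distinctness assumptions.\<close>

lemma z_distinct:
  assumes i: "i \<in> principal" and j: "j \<in> principal \<or> j \<in> range Ri \<or> j = Ei" and eq: "z i = z j"
  shows "i = j"
proof (cases "j \<in> principal")
  case False
  then have "Im (z j) = 0" using j by auto
  then show ?thesis using Im_z_principal[OF i] eq by simp
next
  case True
  have WW: "j = k" if "j \<noteq> 0" "k \<noteq> 0" "sym_ext \<omega> j = sym_ext \<omega> k" for j k
  proof (rule sgn_abs_eqD)
    note e = sym_ext_eqD[OF D_pos(1) D_pos(1) that]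
    show "sgn j = sgn k" by (rule e(1))
    show "nat \<bar>j\<bar> = nat \<bar>k\<bar>" using inj_onD[OF D_inj(1) e(2)] that by auto
  qed
  have ZZ: "j = k" if "j \<noteq> 0" "k \<noteq> 0" "sym_ext \<zeta> j = sym_ext \<zeta> k" for j k
  proof (rule sgn_abs_eqD)
    note e = sym_ext_eqD[OF D_pos(2) D_pos(2) that]
    show "sgn j = sgn k" by (rule e(1))
    show "nat \<bar>j\<bar> = nat \<bar>k\<bar>" using inj_onD[OF D_inj(2) e(2)] that by auto
  qed
  have WZ: "sym_ext \<omega> j \<noteq> sym_ext \<zeta> k" if "j \<noteq> 0" "k \<noteq> 0" for j k
  proof
    assume "sym_ext \<omega> j = sym_ext \<zeta> k"
    from sym_ext_eqD(2)[OF D_pos(1) D_pos(2) that this] D_dist[of "nat \<bar>j\<bar>" "nat \<bar>k\<bar>"] that show False by auto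
  qed
  have ZW: "sym_ext \<zeta> j \<noteq> sym_ext \<omega> k" if "j \<noteq> 0" "k \<noteq> 0" for j k
    using WZ[OF that(2,1)] by simp
  show ?thesis using i True eq unfolding principal_def by (auto dest: WW ZZ WZ[THEN notE, rotated 2] ZW[THEN notE, rotated 2])
qed

text \<open>General \<open>m\<close> serves the Cauchy property of the partial sums,
  \<open>m = 0\<close> the upper estimate. \<open>Ei\<close> lies in no block and is estimated
  separately.\<close>

lemma block_upper:
  assumes w: "summable (\<lambda>n. (w n)\<^sup>2)"
  shows "\<exists>B>0. \<forall>s m N. dominated w N s \<longrightarrow> enorm T z p q s (pairs m N \<union> Ri ` {m<..N}) \<le> B * (\<Sum>i\<in>pairs m N. (cmod (s i))\<^sup>2)"
proof -
  obtain B where B: "B > 0" "\<And>s I. finite I \<Longrightarrow> I \<subseteq> range Wi \<union> range Zi \<Longrightarrow> enorm T z p q s I \<le> B * (\<Sum>i\<in>I. (cmod (s i))\<^sup>2)"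
    using WZ_upper by blast
  obtain K where K: "K \<ge> 0" "\<And>n. \<bar>r n\<bar> \<le> K" using r_bounded by blast
  define W where "W = (\<Sum>n. (w n)\<^sup>2)"
  have W: "W \<ge> 0" unfolding W_def by (intro suminf_nonneg w) auto
  define G where "G = 2 * (T * ((exp (K * T))\<^sup>2 * W))"
  have G: "G \<ge> 0" using W T_pos by (simp add: G_def)
  have "enorm T z p q s (pairs m N \<union> Ri ` {m<..N}) \<le> (2 * B + 2 * G) * (\<Sum>i\<in>pairs m N. (cmod (s i))\<^sup>2)"
    if dom: "dominated w N s" for s m N
  proof -
    define X where "X = (\<Sum>i\<in>pairs m N. (cmod (s i))\<^sup>2)"
    have "enorm T z p q s (pairs m N \<union> Ri ` {m<..N}) \<le> 2 * enorm T z p q s (pairs m N) + 2 * enorm T z p q s (Ri ` {m<..N})"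
      by (rule enorm_union_le) (auto simp: pairs_def)
    moreover have "enorm T z p q s (pairs m N) \<le> B * X"
      unfolding X_def by (rule B(2)) (auto simp: pairs_def)
    moreover have "enorm T z p q s (Ri ` {m<..N}) \<le> G * X"
    proof -
      have "(\<Sum>i\<in>Ri ` {m<..N}. cmod (s i)) = (\<Sum>n\<in>{m<..N}. cmod (s (Ri n)))"
        by (subst sum.reindex) (auto simp: inj_on_def)
      then have "enorm T z p q s (Ri ` {m<..N}) \<le> 2 * (T * (exp (K * T) * (1 * (\<Sum>n\<in>{m<..N}. cmod (s (Ri n)))))\<^sup>2)"
        using K T_pos by (intro enorm_bounded) auto
      also have "\<dots> = 2 * (T * ((exp (K * T))\<^sup>2 * (\<Sum>n\<in>{m<..N}. cmod (s (Ri n)))\<^sup>2))" by (simp add: power_mult_distrib)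
      also have "\<dots> \<le> 2 * (T * ((exp (K * T))\<^sup>2 * (W * X)))"
      proof -
        have "(\<Sum>n\<in>{m<..N}. cmod (s (Ri n)))\<^sup>2 \<le> (\<Sum>n\<in>{m<..N}. (w n)\<^sup>2) * (\<Sum>n\<in>{m<..N}. (cmod (s (Wi (int n))))\<^sup>2 + (cmod (s (Zi (int n))))\<^sup>2)"
          using dom by (intro sum_Ri_le) (auto simp: dominated_def)
        also have "\<dots> \<le> W * X"
          unfolding W_def X_def by (intro mult_mono sum_le_suminf w sum_positive_part_le sum_nonneg suminf_nonneg) auto
        finally show ?thesis using T_pos by (intro mult_left_mono) auto
      qed
      finally show ?thesis by (simp add: G_def mult.assoc)
    qed
    ultimately show ?thesis unfolding X_def[symmetric] by argo
  qed
  moreover have "2 * B + 2 * G > 0" using B G by simp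
  ultimately show ?thesis by blast
qed


text \<open>Only \<open>Ri n\<close> with n \<ge> n0 go into \<open>Q\<close>: they are dominated by
  the coefficients at \<open>Wi n\<close> and \<open>Zi n\<close>, which lie in \<open>H\<close>,
  where decay is proved first. For n < n0 the dominating coefficients lie in \<open>L\<close>, where
  no decay is known at that stage, so these \<open>Ri n\<close> join \<open>L\<close>, together with
  \<open>Ei\<close>.\<close>

lemma exp_family_instance:
  "\<exists>T' A B K n0. n0 \<ge> 1 \<and> exp_family z p q (Wi ` {j. int n0 \<le> \<bar>j\<bar>} \<union> Zi ` {j. int n0 \<le> \<bar>j\<bar>})
      (pairs 0 (n0 - 1) \<union> Ri ` {0<..<n0} \<union> {Ei}) (Ri ` {n0..}) T T' A B K"
proof -
  obtain T' where T': "2 * pi / \<gamma> < T'" "T' < T" using T dense by blast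
  have "0 < 2 * pi / \<gamma>" using const by simp
  then have T'0: "T' > 0" using T' by linarith
  obtain A n0 where A: "A > 0" "n0 \<ge> 1" "\<And>s I. finite I \<Longrightarrow> I \<subseteq> Wi ` {j. int n0 \<le> \<bar>j\<bar>} \<union> Zi ` {j. int n0 \<le> \<bar>j\<bar>} \<Longrightarrow>
    A * (\<Sum>i\<in>I. (cmod (s i))\<^sup>2) \<le> enorm T' z p q s I"
    using WZ_lower[OF T'(1) less_imp_le[OF T'(2)]] by blast
  obtain B where B: "B > 0" "\<And>s I. finite I \<Longrightarrow> I \<subseteq> range Wi \<union> range Zi \<Longrightarrow> enorm T z p q s I \<le> B * (\<Sum>i\<in>I. (cmod (s i))\<^sup>2)"
    using WZ_upper by blast
  obtain K where K: "K \<ge> 0" "\<And>n. \<bar>r n\<bar> \<le> K" using r_bounded by blast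
  define H where "H = Wi ` {j. int n0 \<le> \<bar>j\<bar>} \<union> Zi ` {j. int n0 \<le> \<bar>j\<bar>}"
  define L where "L = pairs 0 (n0 - 1) \<union> Ri ` {0<..<n0} \<union> {Ei}"
  have HPr: "H \<subseteq> principal" using A(2) by (auto simp: H_def principal_def)
  have HL: "H \<inter> L = {}" using A(2) by (auto simp: H_def L_def pairs_def sym_range_def)
  have "exp_family z p q H L (Ri ` {n0..}) T T' A B K"
  proof
    show "enorm T z p q s I \<le> B * (\<Sum>i\<in>I. (cmod (s i))\<^sup>2)" if "finite I" "I \<subseteq> H" for s I
      by (rule B(2)) (use that in \<open>auto simp: H_def\<close>)
    show "z i \<notin> z ` L" if "i \<in> H" for i
    proof
      assume "z i \<in> z ` L"
      then obtain j where j: "j \<in> L" "z i = z j" by auto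
      have "j \<in> principal \<or> j \<in> range Ri \<or> j = Ei" using j(1) pairs_subset_principal by (auto simp: L_def)
      from z_distinct[OF _ this j(2)] that HPr have "i = j" by auto
      then show False using HL that j by auto
    qed
    show "Im (z i) \<noteq> 0" if "i \<in> H" for i using Im_z_principal HPr that by blast
    show "Im (z i) = 0 \<and> \<bar>Re (z i)\<bar> \<le> K \<and> cmod (p i) \<le> 1 \<and> cmod (q i) \<le> 1" if "i \<in> Ri ` {n0..}" for i
      using that K by auto
  qed (use T' T'0 A B K HL in \<open>auto simp: H_def L_def pairs_def\<close>)
  then show ?thesis using A(2) unfolding H_def L_def by blast
qed

text \<open>If every constant fails, there are counterexamples of varying lengths
  \<open>N k\<close>. Normalised to unit mass on the principal indices, they contradict the
  compactness argument: this mass splits into a high part and finitely many low coefficients, all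
  tending to 0 along a subsequence.\<close>

lemma finite_lower:
  assumes w: "summable (\<lambda>n. (w n)\<^sup>2)" "\<And>n. w n \<ge> 0" and M': "M' \<ge> 0"
  shows "\<exists>A>0. \<forall>N s. dominated w N s \<longrightarrow> (cmod (s Ei))\<^sup>2 \<le> M' * (\<Sum>i\<in>pairs 0 N. (cmod (s i))\<^sup>2) \<longrightarrow>
    A * (\<Sum>i\<in>pairs 0 N. (cmod (s i))\<^sup>2) \<le> enorm T z p q s (indices N)"
proof (rule ccontr)
  assume neg: "\<not> ?thesis"
  have "\<exists>N s. dominated w N s \<and> (cmod (s Ei))\<^sup>2 \<le> M' * (\<Sum>i\<in>pairs 0 N. (cmod (s i))\<^sup>2) \<and>
      enorm T z p q s (indices N) < 1 / real (Suc k) * (\<Sum>i\<in>pairs 0 N. (cmod (s i))\<^sup>2)" for k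
  proof (rule ccontr)
    assume "\<not> ?thesis"
    then have "\<forall>N s. dominated w N s \<longrightarrow> (cmod (s Ei))\<^sup>2 \<le> M' * (\<Sum>i\<in>pairs 0 N. (cmod (s i))\<^sup>2) \<longrightarrow>
       1 / real (Suc k) * (\<Sum>i\<in>pairs 0 N. (cmod (s i))\<^sup>2) \<le> enorm T z p q s (indices N)" by (meson not_le)
    moreover have "1 / real (Suc k) > 0" by simp
    ultimately show False using neg by blast
  qed
  then obtain N s0 where N: "\<And>k. dominated w (N k) (s0 k)"
    "\<And>k. (cmod (s0 k Ei))\<^sup>2 \<le> M' * (\<Sum>i\<in>pairs 0 (N k). (cmod (s0 k i))\<^sup>2)"
    "\<And>k. enorm T z p q (s0 k) (indices (N k)) < 1 / real (Suc k) * (\<Sum>i\<in>pairs 0 (N k). (cmod (s0 k i))\<^sup>2)"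
    by metis
  define \<sigma> where "\<sigma> = (\<lambda>k. \<Sum>i\<in>pairs 0 (N k). (cmod (s0 k i))\<^sup>2)"
  have \<sigma>: "\<sigma> k > 0" for k
  proof -
    have "0 < 1 / real (Suc k) * \<sigma> k" using le_less_trans[OF enorm_nonneg N(3)[of k]] by (simp add: \<sigma>_def)
    then show ?thesis by (simp add: zero_less_mult_iff zero_less_divide_iff)
  qed
  have N\<sigma>: "(cmod (s0 k Ei))\<^sup>2 \<le> M' * \<sigma> k" "enorm T z p q (s0 k) (indices (N k)) < 1 / real (Suc k) * \<sigma> k" for k
    using N(2,3) by (auto simp: \<sigma>_def)
  define b where "b = (\<lambda>k. 1 / sqrt (\<sigma> k))"
  have b: "b k > 0" "(b k)\<^sup>2 = 1 / \<sigma> k" for k using \<sigma>[of k] by (auto simp: b_def power_divide)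
  \<comment> \<open>Coefficients are set to 0 off \<open>indices (N k)\<close>, so that families of
    different lengths can be compared index by index; \<open>b k\<close> normalises the principal
    mass to 1.\<close>
  define s where "s = (\<lambda>k i. if i \<in> indices (N k) then of_real (b k) * s0 k i else 0)"
  have cm: "(cmod (s k i))\<^sup>2 = (if i \<in> indices (N k) then (cmod (s0 k i))\<^sup>2 / \<sigma> k else 0)" for k i
    using b[of k] by (simp add: s_def norm_mult power_mult_distrib)
  have PIdx: "pairs 0 n \<subseteq> indices n" for n by (auto simp: indices_def)
  have sum1: "(\<Sum>i\<in>pairs 0 (N k). (cmod (s k i))\<^sup>2) = 1" for k
  proof -
    have "(\<Sum>i\<in>pairs 0 (N k). (cmod (s k i))\<^sup>2) = (\<Sum>i\<in>pairs 0 (N k). (cmod (s0 k i))\<^sup>2 / \<sigma> k)"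
      using PIdx by (intro sum.cong) (auto simp: cm)
    also have "\<dots> = \<sigma> k / \<sigma> k" unfolding \<sigma>_def sum_divide_distrib ..
    finally show ?thesis using \<sigma>[of k] by simp
  qed
  have en_le: "enorm T z p q (s k) (indices (N k)) \<le> 1 / real (Suc k)" for k
  proof -
    have "enorm T z p q (s k) (indices (N k)) = enorm T z p q (\<lambda>i. of_real (b k) * s0 k i) (indices (N k))"
      by (rule enorm_cong) (simp add: s_def)
    also have "\<dots> = enorm T z p q (s0 k) (indices (N k)) / \<sigma> k" using b[of k] by (simp add: enorm_mult)
    also have "\<dots> \<le> 1 / real (Suc k)"
      using N\<sigma>(2)[of k] \<sigma>[of k] by (subst pos_divide_le_eq) auto
    finally show ?thesis .
  qed
  have en0: "(\<lambda>k. enorm T z p q (s k) (indices (N k))) \<longlonglongrightarrow> 0"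
    by (rule squeeze_0[OF enorm_nonneg en_le LIMSEQ_Suc[OF lim_1_over_n]])
  define g where "g = (\<lambda>k n. (cmod (s k (Wi (int n))))\<^sup>2 + (cmod (s k (Zi (int n))))\<^sup>2)"
  have dom: "cmod (s k (Ri n)) \<le> w n * sqrt (g k n)" for k n
  proof (cases "n \<in> {1..N k}")
    case True
    then have mem: "Ri n \<in> indices (N k)" "Wi (int n) \<in> indices (N k)" "Zi (int n) \<in> indices (N k)"
      by (auto simp: indices_def pairs_def sym_range_def)
    have "b k * cmod (s0 k (Ri n)) \<le> b k * (w n * sqrt ((cmod (s0 k (Wi (int n))))\<^sup>2 + (cmod (s0 k (Zi (int n))))\<^sup>2))"
      using N(1)[of k] True b[of k] by (intro mult_left_mono) (auto simp: dominated_def)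
    also have "\<dots> = w n * (sqrt ((b k)\<^sup>2) * sqrt ((cmod (s0 k (Wi (int n))))\<^sup>2 + (cmod (s0 k (Zi (int n))))\<^sup>2))" using b(1)[of k] by simp
    also have "\<dots> = w n * sqrt (g k n)"
      using b[of k] by (simp add: g_def s_def mem norm_mult power_mult_distrib real_sqrt_mult[symmetric] distrib_left)
    finally show ?thesis using b[of k] by (simp add: s_def mem norm_mult)
  next
    case False
    then have "s k (Ri n) = 0" by (auto simp: s_def indices_def pairs_def)
    then show ?thesis using w(2) by (simp add: g_def)
  qed
  have sPr: "cmod (s k i) \<le> 1" if "i \<in> principal" for k i
  proof (cases "i \<in> pairs 0 (N k)")
    case True
    then have "(cmod (s k i))\<^sup>2 \<le> 1" using member_le_sum[of i "pairs 0 (N k)" "\<lambda>i. (cmod (s k i))\<^sup>2"] sum1[of k] by simp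
    then show ?thesis by (simp add: power_le_one_iff abs_square_le_1)
  next
    case False
    then have "i \<notin> indices (N k)" using that by (auto simp: indices_def principal_def)
    then show ?thesis by (simp add: s_def)
  qed
  define W where "W = (\<Sum>n. (w n)\<^sup>2)"
  \<comment> \<open>The bound keeps the sum of \<open>w\<close> over \<open>F\<close>, because small
    tails of \<open>w\<close>, uniform in \<open>k\<close>, are needed below.\<close>
  have sumR: "(\<Sum>n\<in>F. cmod (s k (Ri n))) \<le> sqrt (\<Sum>n\<in>F. (w n)\<^sup>2)" if F: "finite F" for F k
  proof (rule real_le_rsqrt)
    have "(\<Sum>n\<in>F. cmod (s k (Ri n)))\<^sup>2 \<le> (\<Sum>n\<in>F. (w n)\<^sup>2) * (\<Sum>n\<in>F. g k n)"
      unfolding g_def by (rule sum_Ri_le[OF F]) (use dom in \<open>simp add: g_def\<close>)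
    also have "\<dots> \<le> (\<Sum>n\<in>F. (w n)\<^sup>2) * 1"
    proof (rule mult_left_mono)
      have "(\<Sum>n\<in>F. g k n) = (\<Sum>n\<in>F \<inter> {0<..N k}. g k n)"
        using F by (intro sum.mono_neutral_right) (auto simp: g_def s_def indices_def pairs_def sym_range_def)
      also have "\<dots> \<le> (\<Sum>n\<in>{0<..N k}. g k n)" by (intro sum_mono2) (auto simp: g_def)
      also have "\<dots> \<le> 1" using sum_positive_part_le[of "s k" 0 "N k"] sum1[of k] by (simp add: g_def)
      finally show "(\<Sum>n\<in>F. g k n) \<le> 1" .
    qed (auto intro: sum_nonneg)
    finally show "(\<Sum>n\<in>F. cmod (s k (Ri n)))\<^sup>2 \<le> (\<Sum>n\<in>F. (w n)\<^sup>2)" by simp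
  qed
  have sumRW: "(\<Sum>n\<in>F. cmod (s k (Ri n))) \<le> sqrt W" if F: "finite F" for F k
    using sumR[OF F, of k] sum_le_suminf[OF w(1) F] by (fastforce simp: W_def intro: order_trans real_sqrt_le_mono)
  have W: "W \<ge> 0" unfolding W_def by (intro suminf_nonneg w) auto
  have sE: "cmod (s k Ei) \<le> sqrt M'" for k
  proof (rule real_le_rsqrt)
    have "(cmod (s k Ei))\<^sup>2 = (cmod (s0 k Ei))\<^sup>2 / \<sigma> k" by (simp add: cm indices_def)
    also have "\<dots> \<le> M'" using N\<sigma>(1)[of k] \<sigma>[of k] by (subst pos_divide_le_eq) auto
    finally show "(cmod (s k Ei))\<^sup>2 \<le> M'" .
  qed
  define S where "S = 1 + sqrt W + sqrt M'"
  from exp_family_instance obtain T' A B K n0 where n0: "n0 \<ge> 1" and fam: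
    "exp_family z p q (Wi ` {j. int n0 \<le> \<bar>j\<bar>} \<union> Zi ` {j. int n0 \<le> \<bar>j\<bar>})
      (pairs 0 (n0 - 1) \<union> Ri ` {0<..<n0} \<union> {Ei}) (Ri ` {n0..}) T T' A B K" by blast
  define H where "H = Wi ` {j. int n0 \<le> \<bar>j\<bar>} \<union> Zi ` {j. int n0 \<le> \<bar>j\<bar>}"
  define L where "L = pairs 0 (n0 - 1) \<union> Ri ` {0<..<n0} \<union> {Ei}"
  define Q where "Q = Ri ` {n0..}"
  interpret exp_family z p q H L Q T T' A B K using fam by (simp add: H_def L_def Q_def)
  have QI: "Q \<inter> indices n = Ri ` {n0..n}" for n using n0 by (auto simp: Q_def indices_def pairs_def)
  have sumQ: "(\<Sum>i\<in>Q \<inter> indices n. cmod (s k i)) = (\<Sum>m\<in>{n0..n}. cmod (s k (Ri m)))" for n k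
    unfolding QI by (subst sum.reindex) (auto simp: inj_on_def)
  have "\<exists>\<rho>. strict_mono \<rho> \<and> (\<lambda>k. \<Sum>i\<in>H \<inter> indices (N (\<rho> k)). (cmod (s (\<rho> k) i))\<^sup>2) \<longlonglongrightarrow> 0 \<and>
     (\<forall>i\<in>L. z i \<notin> z ` (L - {i}) \<longrightarrow> p i \<noteq> 0 \<or> q i \<noteq> 0 \<longrightarrow> (\<lambda>k. s (\<rho> k) i) \<longlonglongrightarrow> 0)"
  proof (rule coeffs_tendsto_0)
    show "finite (indices (N k))" for k by simp
    show "indices (N k) \<subseteq> H \<union> L \<union> Q" for k
    proof
      fix i assume "i \<in> indices (N k)"
      then show "i \<in> H \<union> L \<union> Q"
        using n0 by (cases i) (auto simp: indices_def pairs_def sym_range_def H_def L_def Q_def image_iff)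
    qed
    show "s k i = 0" if "i \<notin> indices (N k)" for k i using that by (simp add: s_def)
    show "(\<Sum>i\<in>Q \<inter> indices (N k). cmod (s k i)) \<le> S" for k
    proof -
      have "(\<Sum>i\<in>Q \<inter> indices (N k). cmod (s k i)) \<le> sqrt W" unfolding sumQ by (rule sumRW) simp
      then show ?thesis using real_sqrt_ge_zero[OF M'] unfolding S_def by linarith
    qed
    show "cmod (s k i) \<le> S" if iL: "i \<in> L" for k i
    proof -
      have S: "1 \<le> S" "sqrt W \<le> S" "sqrt M' \<le> S" using W M' by (auto simp: S_def)
      consider "i \<in> principal" | n where "i = Ri n" | "i = Ei" using iL pairs_subset_principal by (auto simp: L_def)
      then show ?thesis
      proof cases
        case 1 then show ?thesis using sPr[of i k] S by linarith
      next
        case 2 then show ?thesis using sumRW[of "{n}" k] S by simp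
      next
        case 3 then show ?thesis using sE[of k] S by simp
      qed
    qed
    show "(\<lambda>k. en (s k) (indices (N k))) \<longlonglongrightarrow> 0" by (rule en0)
    assume sH: "\<And>i. i \<in> H \<Longrightarrow> (\<lambda>k. s k i) \<longlonglongrightarrow> 0"
    have sR: "(\<lambda>k. cmod (s k (Ri n))) \<longlonglongrightarrow> 0" if "n \<ge> n0" for n
    proof (rule squeeze_0[OF _ dom])
      have "Wi (int n) \<in> H" "Zi (int n) \<in> H" using that by (auto simp: H_def)
      then have "(\<lambda>k. w n * sqrt (g k n)) \<longlonglongrightarrow> w n * sqrt ((cmod 0)\<^sup>2 + (cmod 0)\<^sup>2)"
        unfolding g_def by (intro tendsto_intros sH)
      then show "(\<lambda>k. w n * sqrt (g k n)) \<longlonglongrightarrow> 0" by simp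
    qed simp
    show "(\<lambda>k. \<Sum>i\<in>Q \<inter> indices (N k). cmod (s k i)) \<longlonglongrightarrow> 0"
      unfolding sumQ
    proof (rule LIMSEQ_I)
      fix \<epsilon> :: real assume \<epsilon>: "\<epsilon> > 0"
      then have "(\<epsilon> / 2)\<^sup>2 > 0" by simp
      \<comment> \<open>From \<open>m\<close> on the real coefficients have small sum uniformly in
        \<open>k\<close>; the finitely many earlier ones tend to 0 by \<open>sR\<close>.\<close>
      then obtain m where m: "\<And>a b. a \<ge> m \<Longrightarrow> norm (\<Sum>n\<in>{a..<b}. (w n)\<^sup>2) < (\<epsilon> / 2)\<^sup>2"
        using w(1)[unfolded summable_Cauchy] by blast
      have "(\<lambda>k. \<Sum>n\<in>{n0..<m}. cmod (s k (Ri n))) \<longlonglongrightarrow> (\<Sum>n\<in>{n0..<m}. 0)"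
        by (intro tendsto_sum sR) auto
      then have "(\<lambda>k. \<Sum>n\<in>{n0..<m}. cmod (s k (Ri n))) \<longlonglongrightarrow> 0" by simp
      from LIMSEQ_D[OF this, of "\<epsilon> / 2"] \<epsilon> obtain k0 where
        k0: "\<And>k. k \<ge> k0 \<Longrightarrow> \<bar>\<Sum>n\<in>{n0..<m}. cmod (s k (Ri n))\<bar> < \<epsilon> / 2" by auto
      have "norm ((\<Sum>n\<in>{n0..N k}. cmod (s k (Ri n))) - 0) < \<epsilon>" if "k \<ge> k0" for k
      proof -
        have "(\<Sum>n\<in>{n0..N k}. cmod (s k (Ri n))) \<le> (\<Sum>n\<in>{n0..<m} \<union> {m..<Suc (N k)}. cmod (s k (Ri n)))"
          by (rule sum_mono2) auto
        also have "\<dots> = (\<Sum>n\<in>{n0..<m}. cmod (s k (Ri n))) + (\<Sum>n\<in>{m..<Suc (N k)}. cmod (s k (Ri n)))"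
          by (rule sum.union_disjoint) auto
        also have "(\<Sum>n\<in>{m..<Suc (N k)}. cmod (s k (Ri n))) \<le> sqrt (\<Sum>n\<in>{m..<Suc (N k)}. (w n)\<^sup>2)"
          by (rule sumR) simp
        also have "\<dots> \<le> sqrt ((\<epsilon> / 2)\<^sup>2)" using m[of m "Suc (N k)"] by (intro real_sqrt_le_mono) auto
        also have "\<dots> = \<epsilon> / 2" using \<epsilon> by simp
        finally have "(\<Sum>n\<in>{n0..N k}. cmod (s k (Ri n))) < \<epsilon>" using k0[OF that] by linarith
        then show ?thesis by (simp add: sum_nonneg)
      qed
      then show "\<exists>k0. \<forall>k\<ge>k0. norm ((\<Sum>n\<in>{n0..N k}. cmod (s k (Ri n))) - 0) < \<epsilon>" by blast
    qed
  qed
  then obtain \<rho> where \<rho>: "(\<lambda>k. \<Sum>i\<in>H \<inter> indices (N (\<rho> k)). (cmod (s (\<rho> k) i))\<^sup>2) \<longlonglongrightarrow> 0"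
     "\<And>i. i \<in> L \<Longrightarrow> z i \<notin> z ` (L - {i}) \<Longrightarrow> p i \<noteq> 0 \<or> q i \<noteq> 0 \<Longrightarrow> (\<lambda>k. s (\<rho> k) i) \<longlonglongrightarrow> 0" by blast
  have sL: "(\<lambda>k. s (\<rho> k) i) \<longlonglongrightarrow> 0" if i: "i \<in> pairs 0 (n0 - 1)" for i
  proof (rule \<rho>(2))
    show "i \<in> L" using i by (simp add: L_def)
    have iPr: "i \<in> principal" using i pairs_subset_principal by auto
    show "z i \<notin> z ` (L - {i})"
    proof
      assume "z i \<in> z ` (L - {i})"
      then obtain j where j: "j \<in> L" "j \<noteq> i" "z i = z j" by auto
      have "j \<in> principal \<or> j \<in> range Ri \<or> j = Ei" using j(1) pairs_subset_principal by (auto simp: L_def)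
      from z_distinct[OF iPr this j(3)] j(2) show False by simp
    qed
    show "p i \<noteq> 0 \<or> q i \<noteq> 0" using i by (auto simp: pairs_def)
  qed
  have "(\<lambda>k. (\<Sum>i\<in>H \<inter> indices (N (\<rho> k)). (cmod (s (\<rho> k) i))\<^sup>2) + (\<Sum>i\<in>pairs 0 (n0 - 1). (cmod (s (\<rho> k) i))\<^sup>2)) \<longlonglongrightarrow> 0 + (\<Sum>i\<in>pairs 0 (n0 - 1). (cmod 0)\<^sup>2)"
    by (intro tendsto_intros \<rho>(1) sL)
  then have lim0: "(\<lambda>k. (\<Sum>i\<in>H \<inter> indices (N (\<rho> k)). (cmod (s (\<rho> k) i))\<^sup>2) + (\<Sum>i\<in>pairs 0 (n0 - 1). (cmod (s (\<rho> k) i))\<^sup>2)) \<longlonglongrightarrow> 0"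
    by simp
  \<comment> \<open>Every index in \<open>pairs 0 (N (\<rho> k))\<close> is high or lies in the
    fixed low block, so the unit mass is at most a sum of two null sequences.\<close>
  have "1 \<le> (\<Sum>i\<in>H \<inter> indices (N (\<rho> k)). (cmod (s (\<rho> k) i))\<^sup>2) + (\<Sum>i\<in>pairs 0 (n0 - 1). (cmod (s (\<rho> k) i))\<^sup>2)" for k
  proof -
    have "1 = (\<Sum>i\<in>pairs 0 (N (\<rho> k)). (cmod (s (\<rho> k) i))\<^sup>2)" using sum1 by simp
    also have "\<dots> \<le> (\<Sum>i\<in>(H \<inter> indices (N (\<rho> k))) \<union> pairs 0 (n0 - 1). (cmod (s (\<rho> k) i))\<^sup>2)"
    proof (rule sum_mono2)
      show "pairs 0 (N (\<rho> k)) \<subseteq> (H \<inter> indices (N (\<rho> k))) \<union> pairs 0 (n0 - 1)"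
        using n0 by (auto simp: pairs_def sym_range_def H_def indices_def image_iff)
    qed auto
    also have "\<dots> = (\<Sum>i\<in>H \<inter> indices (N (\<rho> k)). (cmod (s (\<rho> k) i))\<^sup>2) + (\<Sum>i\<in>pairs 0 (n0 - 1). (cmod (s (\<rho> k) i))\<^sup>2)"
      using n0 by (intro sum.union_disjoint finite_pairs) (auto simp: pairs_def sym_range_def H_def)
    finally show ?thesis .
  qed
  then have "(1::real) \<le> 0" by (intro LIMSEQ_le_const[OF lim0]) auto
  then show False by simp
qed

end

subsection \<open>Completeness of square integrable functions\<close>

text \<open>The Riesz-Fischer argument: a fast subsequence converges almost everywhere, and Fatou's
  lemma carries the Cauchy estimate of the whole sequence over to its limit.\<close>

lemma L2_limit_exists:
  assumes f: "\<And>n. continuous_on UNIV (f n)"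
    and cauchy: "\<And>e. e > 0 \<Longrightarrow> \<exists>n0. \<forall>m n. n0 \<le> m \<longrightarrow> m \<le> n \<longrightarrow> sqint T (\<lambda>t. f n t - f m t) < e"
  shows "\<exists>u. L2_limit_on T f u"
proof -
  \<comment> \<open>Truncation to [0, T] lets all integrals be taken over the whole line.\<close>
  define F where "F = (\<lambda>n t. indicator {0..T} t *\<^sub>R f n t)"
  have Fm [measurable]: "F n \<in> borel_measurable lborel" for n
    unfolding F_def using borel_measurable_continuous_onI[OF f] by measurable
  have nn: "(\<integral>\<^sup>+ t. ennreal ((cmod (F n t - F m t))\<^sup>2) \<partial>lborel) = ennreal (sqint T (\<lambda>t. f n t - f m t))" for n m
  proof -
    have "(\<lambda>t. (cmod (f n t - f m t))\<^sup>2) integrable_on {0..T}" by (intro sq_integrable continuous_intros f)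
    then have "((\<lambda>t. (cmod (f n t - f m t))\<^sup>2) has_integral sqint T (\<lambda>t. f n t - f m t)) {0..T}"
      unfolding sqint_def by (rule integrable_integral)
    then have "((\<lambda>t. if t \<in> {0..T} then (cmod (f n t - f m t))\<^sup>2 else 0) has_integral sqint T (\<lambda>t. f n t - f m t)) UNIV"
      by (simp only: has_integral_restrict_UNIV)
    also have "(\<lambda>t. if t \<in> {0..T} then (cmod (f n t - f m t))\<^sup>2 else 0) = (\<lambda>t. indicator {0..T} t * (cmod (f n t - f m t))\<^sup>2)"
      by (auto simp: indicator_def)
    finally have I: "((\<lambda>t. indicator {0..T} t * (cmod (f n t - f m t))\<^sup>2) has_integral sqint T (\<lambda>t. f n t - f m t)) UNIV" .
    have "(\<lambda>t. indicator {0..T} t * (cmod (f n t - f m t))\<^sup>2) \<in> borel_measurable borel"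
      by (intro borel_measurable_times borel_measurable_indicator borel_measurable_continuous_onI continuous_intros f) simp
    then have "(\<integral>\<^sup>+ t. ennreal (indicator {0..T} t * (cmod (f n t - f m t))\<^sup>2) \<partial>lborel) = ennreal (sqint T (\<lambda>t. f n t - f m t))"
      by (rule nn_integral_has_integral_lborel[OF _ _ I]) simp
    moreover have "indicator {0..T} t * (cmod (f n t - f m t))\<^sup>2 = (cmod (F n t - F m t))\<^sup>2" for t
      by (auto simp: F_def indicator_def)
    ultimately show ?thesis by simp
  qed
  have "\<exists>n0. \<forall>m n. n0 \<le> m \<longrightarrow> m \<le> n \<longrightarrow> sqint T (\<lambda>t. f n t - f m t) < (1/4) ^ k" for k
    by (rule cauchy) simp
  then obtain h where h: "\<And>k m n. h k \<le> m \<Longrightarrow> m \<le> n \<Longrightarrow> sqint T (\<lambda>t. f n t - f m t) < (1/4) ^ k" by metis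
  \<comment> \<open>The sum makes \<open>g\<close> nondecreasing with \<open>h k \<le> g k\<close>;
    the summand \<open>k\<close> sends it to infinity, so that in Fatou's lemma it passes any fixed
    index \<open>n\<close>.\<close>
  define g where "g = (\<lambda>k. k + (\<Sum>i\<le>k. h i))"
  have g: "h k \<le> g k" "g k \<le> g (Suc k)" "k \<le> g k" for k
    by (auto simp: g_def intro: trans_le_add2 member_le_sum)
  define X where "X = (\<lambda>k t. (cmod (F (g (Suc k)) t - F (g k) t))\<^sup>2)"
  have Xm [measurable]: "X k \<in> borel_measurable lborel" for k unfolding X_def by measurable
  \<comment> \<open>The weight \<open>2 ^ k\<close> still leaves summable integrals, being set
    against \<open>(1/4) ^ k\<close>, and finiteness of the weighted sum forces X k t \<le> C / 2^k
    almost everywhere. Hence the increments are dominated by a geometric series.\<close>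
  have "(\<integral>\<^sup>+ t. (\<Sum>k. ennreal (2 ^ k * X k t)) \<partial>lborel) = (\<Sum>k. (\<integral>\<^sup>+ t. ennreal (2 ^ k * X k t) \<partial>lborel))"
    by (intro nn_integral_suminf) simp
  also have "\<dots> \<le> (\<Sum>k. ennreal ((1/2) ^ k))"
  proof (intro suminf_le allI summableI)
    fix k
    have "(\<integral>\<^sup>+ t. ennreal (2 ^ k * X k t) \<partial>lborel) = ennreal (2 ^ k) * (\<integral>\<^sup>+ t. ennreal (X k t) \<partial>lborel)"
    proof -
      have "ennreal (2 ^ k * X k t) = ennreal (2 ^ k) * ennreal (X k t)" for t by (rule ennreal_mult) (auto simp: X_def)
      then show ?thesis by (simp only:) (rule nn_integral_cmult, measurable)
    qed
    also have "\<dots> = ennreal (2 ^ k) * ennreal (sqint T (\<lambda>t. f (g (Suc k)) t - f (g k) t))"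
      unfolding X_def nn ..
    also have "\<dots> \<le> ennreal (2 ^ k) * ennreal ((1/4) ^ k)"
      using h[OF g(1) g(2), of k] by (intro mult_left_mono ennreal_leI) auto
    also have "\<dots> = ennreal (2 ^ k * (1/4) ^ k)" by (rule ennreal_mult[symmetric]) auto
    also have "(2::real) ^ k * (1/4) ^ k = (2 * (1/4)) ^ k" by (rule power_mult_distrib[symmetric])
    also have "(2 * (1/4)) = (1/2 :: real)" by simp
    finally show "(\<integral>\<^sup>+ t. ennreal (2 ^ k * X k t) \<partial>lborel) \<le> ennreal ((1/2) ^ k)" .
  qed
  also have "\<dots> = ennreal (\<Sum>k. (1/2) ^ k)" by (rule suminf_ennreal2) (auto intro: summable_geometric)
  also have "\<dots> < \<infinity>" by simp
  finally have "(\<integral>\<^sup>+ t. (\<Sum>k. ennreal (2 ^ k * X k t)) \<partial>lborel) \<noteq> \<infinity>" by simp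
  then have "AE t in lborel. (\<Sum>k. ennreal (2 ^ k * X k t)) \<noteq> \<infinity>"
    by (intro nn_integral_PInf_AE) auto
  then have conv: "AE t in lborel. convergent (\<lambda>k. F (g k) t)"
  proof eventually_elim
    case (elim t)
    define C where "C = enn2real (\<Sum>k. ennreal (2 ^ k * X k t))"
    have X0: "X k t \<ge> 0" for k by (simp add: X_def)
    have "2 ^ k * X k t \<le> C" for k
    proof -
      have "ennreal (2 ^ k * X k t) \<le> (\<Sum>k. ennreal (2 ^ k * X k t))"
        using sum_le_suminf[of "\<lambda>k. ennreal (2 ^ k * X k t)" "{k}"] by (simp add: summableI)
      also have "\<dots> = ennreal C" using elim by (simp add: C_def less_top)
      finally show ?thesis by (simp add: C_def)
    qed
    then have Xle: "X k t \<le> C * (1/2) ^ k" for k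
      by (simp add: power_divide pos_le_divide_eq mult.commute)
    have le: "norm (F (g (Suc k)) t - F (g k) t) \<le> sqrt C * sqrt (1/2) ^ k" for k
    proof -
      have "norm (F (g (Suc k)) t - F (g k) t) = sqrt (X k t)" by (simp add: X_def)
      also have "\<dots> \<le> sqrt (C * (1/2) ^ k)" using Xle by simp
      finally show ?thesis by (simp add: real_sqrt_mult real_sqrt_power)
    qed
    have "sqrt (1/2) < sqrt 1" by (rule real_sqrt_less_mono) simp
    then have "norm (sqrt (1/2)) < 1" by simp
    then have "summable (\<lambda>k. sqrt C * sqrt (1/2) ^ k)" by (intro summable_mult summable_geometric)
    then have "summable (\<lambda>k. F (g (Suc k)) t - F (g k) t)" by (rule summable_comparison_test'[OF _ le])
    then have "convergent (\<lambda>n. \<Sum>k<n. F (g (Suc k)) t - F (g k) t)" by (simp add: summable_iff_convergent)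
    then have "convergent (\<lambda>n. F (g n) t - F (g 0) t)" by (simp only: sum_lessThan_telescope[of "\<lambda>k. F (g k) t"])
    then have "convergent (\<lambda>n. (F (g n) t - F (g 0) t) + F (g 0) t)" by (intro convergent_add convergent_const)
    then show ?case by simp
  qed
  define u where "u = (\<lambda>t. lim (\<lambda>k. F (g k) t))"
  have um [measurable]: "u \<in> borel_measurable lborel" unfolding u_def by measurable
  have u0: "u t = 0" if "t \<notin> {0..T}" for t using that by (simp add: u_def F_def)
  have lim_u: "AE t in lborel. (\<lambda>k. F (g k) t) \<longlonglongrightarrow> u t"
    using conv by eventually_elim (simp add: u_def convergent_LIMSEQ_iff)
  have fatou: "(\<integral>\<^sup>+ t. ennreal ((cmod (F n t - u t))\<^sup>2) \<partial>lborel) \<le> ennreal e" if e: "e > 0" "\<And>m. n \<le> m \<Longrightarrow> sqint T (\<lambda>t. f m t - f n t) < e" for n e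
  proof -
    have "(\<integral>\<^sup>+ t. ennreal ((cmod (F n t - u t))\<^sup>2) \<partial>lborel) = (\<integral>\<^sup>+ t. liminf (\<lambda>k. ennreal ((cmod (F (g k) t - F n t))\<^sup>2)) \<partial>lborel)"
    proof (rule nn_integral_cong_AE, use lim_u in eventually_elim)
      case (elim t)
      have "(\<lambda>k. ennreal ((cmod (F (g k) t - F n t))\<^sup>2)) \<longlonglongrightarrow> ennreal ((cmod (u t - F n t))\<^sup>2)"
        by (intro tendsto_intros elim)
      from lim_imp_Liminf[OF _ this] show ?case by (simp add: norm_minus_commute)
    qed
    also have "\<dots> \<le> liminf (\<lambda>k. \<integral>\<^sup>+ t. ennreal ((cmod (F (g k) t - F n t))\<^sup>2) \<partial>lborel)"
      by (rule nn_integral_liminf) simp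
    also have "\<dots> \<le> liminf (\<lambda>k. ennreal e)"
    proof (rule Liminf_mono)
      show "\<forall>\<^sub>F k in sequentially. (\<integral>\<^sup>+ t. ennreal ((cmod (F (g k) t - F n t))\<^sup>2) \<partial>lborel) \<le> ennreal e"
        unfolding eventually_sequentially
      proof (intro exI[of _ n] allI impI)
        fix k assume "n \<le> k"
        then have "n \<le> g k" using g(3)[of k] by simp
        then show "(\<integral>\<^sup>+ t. ennreal ((cmod (F (g k) t - F n t))\<^sup>2) \<partial>lborel) \<le> ennreal e"
          unfolding nn using e by (intro ennreal_leI less_imp_le)
      qed
    qed
    also have "\<dots> = ennreal e" by (simp add: Liminf_const)
    finally show ?thesis .
  qed
  obtain n1 where n1: "\<And>n. n1 \<le> n \<Longrightarrow> sqint T (\<lambda>t. f n t - f n1 t) < 1" using cauchy[of 1] by auto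
  have Fint: "integrable lborel (\<lambda>t. (cmod (F n t - F m t))\<^sup>2)" for n m
    by (rule integrableI_bounded) (auto simp: nn)
  have int_bound: "integrable lborel a" if "integrable lborel b" "a \<in> borel_measurable lborel" "\<And>t. \<bar>a t\<bar> \<le> b t" for a b :: "real \<Rightarrow> real"
    by (rule Bochner_Integration.integrable_bound[OF that(1,2)]) (use that(3) in \<open>auto intro!: AE_I2 order_trans[OF _ abs_ge_self]\<close>)
  have "(\<integral>\<^sup>+ t. ennreal ((cmod (F n1 t - u t))\<^sup>2) \<partial>lborel) \<le> ennreal 1" using n1 by (intro fatou) auto
  also have "\<dots> < \<infinity>" by simp
  finally have int1: "integrable lborel (\<lambda>t. (cmod (F n1 t - u t))\<^sup>2)"
    by (intro integrableI_bounded) auto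
  have intn: "integrable lborel (\<lambda>t. (cmod (F n t - u t))\<^sup>2)" for n
  proof (rule int_bound)
    show "integrable lborel (\<lambda>t. 2 * (cmod (F n t - F n1 t))\<^sup>2 + 2 * (cmod (F n1 t - u t))\<^sup>2)"
      by (intro Bochner_Integration.integrable_add integrable_mult_right Fint int1)
    show "\<bar>(cmod (F n t - u t))\<^sup>2\<bar> \<le> 2 * (cmod (F n t - F n1 t))\<^sup>2 + 2 * (cmod (F n1 t - u t))\<^sup>2" for t
      using norm_add_sq_le[of "F n t - F n1 t" "F n1 t - u t"] by simp
  qed measurable
  have intF: "integrable lborel (\<lambda>t. (cmod (F n t))\<^sup>2)" for n
  proof -
    have "set_integrable lborel {0..T} (\<lambda>t. (cmod (f n t))\<^sup>2)"
      by (intro borel_integrable_atLeastAtMost' continuous_intros continuous_on_subset[OF f]) auto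
    moreover have "indicator {0..T} t *\<^sub>R (cmod (f n t))\<^sup>2 = (cmod (F n t))\<^sup>2" for t by (auto simp: F_def indicator_def)
    ultimately show ?thesis unfolding set_integrable_def by simp
  qed
  have intu: "integrable lborel (\<lambda>t. (cmod (u t))\<^sup>2)"
  proof (rule int_bound)
    show "integrable lborel (\<lambda>t. 2 * (cmod (F n1 t))\<^sup>2 + 2 * (cmod (F n1 t - u t))\<^sup>2)"
      by (intro Bochner_Integration.integrable_add integrable_mult_right intF int1)
    show "\<bar>(cmod (u t))\<^sup>2\<bar> \<le> 2 * (cmod (F n1 t))\<^sup>2 + 2 * (cmod (F n1 t - u t))\<^sup>2" for t
      using norm_add_sq_le[of "F n1 t" "u t - F n1 t"] by (simp add: norm_minus_commute)
  qed measurable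
  have eqd: "indicator {0..T} t *\<^sub>R (cmod (f n t - u t))\<^sup>2 = (cmod (F n t - u t))\<^sup>2" for n t
    using u0[of t] by (auto simp: F_def indicator_def)
  have equ: "indicator {0..T} t *\<^sub>R (cmod (u t))\<^sup>2 = (cmod (u t))\<^sup>2" for t
    using u0[of t] by (auto simp: indicator_def)
  have "(\<lambda>n. LINT t:{0..T}|lborel. (cmod (f n t - u t))\<^sup>2) \<longlonglongrightarrow> 0"
  proof (rule LIMSEQ_I)
    fix e :: real assume e: "e > 0"
    from cauchy[of "e / 2"] e obtain n0 where n0: "\<And>m n. n0 \<le> m \<Longrightarrow> m \<le> n \<Longrightarrow> sqint T (\<lambda>t. f n t - f m t) < e / 2" by auto
    have "norm ((LINT t:{0..T}|lborel. (cmod (f n t - u t))\<^sup>2) - 0) < e" if "n \<ge> n0" for n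
    proof -
      have "ennreal (LINT t|lborel. (cmod (F n t - u t))\<^sup>2) = (\<integral>\<^sup>+ t. ennreal ((cmod (F n t - u t))\<^sup>2) \<partial>lborel)"
        by (rule nn_integral_eq_integral[symmetric, OF intn]) auto
      also have "\<dots> \<le> ennreal (e / 2)" by (rule fatou) (use e n0 that in auto)
      finally have "(LINT t|lborel. (cmod (F n t - u t))\<^sup>2) \<le> e / 2" using e by simp
      moreover have "0 \<le> (LINT t|lborel. (cmod (F n t - u t))\<^sup>2)" by (rule integral_nonneg_AE) auto
      ultimately show ?thesis unfolding set_lebesgue_integral_def eqd using e by simp
    qed
    then show "\<exists>n0. \<forall>n\<ge>n0. norm ((LINT t:{0..T}|lborel. (cmod (f n t - u t))\<^sup>2) - 0) < e" by blast
  qed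
  moreover have "set_integrable lborel {0..T} (\<lambda>t. (cmod (u t))\<^sup>2)"
    unfolding set_integrable_def equ by (rule intu)
  moreover have "\<forall>n. set_integrable lborel {0..T} (\<lambda>t. (cmod (f n t - u t))\<^sup>2)"
    unfolding set_integrable_def eqd using intn by blast
  ultimately show ?thesis unfolding L2_limit_on_def using um by blast
qed

lemma L2_limit_bounds:
  assumes lim: "L2_limit_on T f u" and f: "continuous_on UNIV (f n)"
  shows "sqint T (f n) \<le> 2 * (LINT t:{0..T}|lborel. (cmod (u t))\<^sup>2) + 2 * (LINT t:{0..T}|lborel. (cmod (f n t - u t))\<^sup>2)"
    and "(LINT t:{0..T}|lborel. (cmod (u t))\<^sup>2) \<le> 2 * sqint T (f n) + 2 * (LINT t:{0..T}|lborel. (cmod (f n t - u t))\<^sup>2)"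
proof -
  have iu: "set_integrable lborel {0..T} (\<lambda>t. (cmod (u t))\<^sup>2)" and id: "set_integrable lborel {0..T} (\<lambda>t. (cmod (f n t - u t))\<^sup>2)"
    using lim by (auto simp: L2_limit_on_def)
  have if': "set_integrable lborel {0..T} (\<lambda>t. (cmod (f n t))\<^sup>2)"
    by (intro borel_integrable_atLeastAtMost' continuous_intros continuous_on_subset[OF f]) auto
  have sq: "sqint T (f n) = (LINT t:{0..T}|lborel. (cmod (f n t))\<^sup>2)"
    unfolding sqint_def by (rule set_borel_integral_eq_integral(2)[OF if', symmetric])
  have "(cmod (f n t))\<^sup>2 \<le> 2 * (cmod (u t))\<^sup>2 + 2 * (cmod (f n t - u t))\<^sup>2" for t
    using norm_add_sq_le[of "u t" "f n t - u t"] by simp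
  then have "(LINT t:{0..T}|lborel. (cmod (f n t))\<^sup>2) \<le> (LINT t:{0..T}|lborel. 2 * (cmod (u t))\<^sup>2 + 2 * (cmod (f n t - u t))\<^sup>2)"
    by (intro set_integral_mono set_integral_add(1) set_integrable_mult_right iu id if')
  also have "\<dots> = 2 * (LINT t:{0..T}|lborel. (cmod (u t))\<^sup>2) + 2 * (LINT t:{0..T}|lborel. (cmod (f n t - u t))\<^sup>2)"
    by (subst set_integral_add(2)) (auto intro!: iu id)
  finally show "sqint T (f n) \<le> 2 * (LINT t:{0..T}|lborel. (cmod (u t))\<^sup>2) + 2 * (LINT t:{0..T}|lborel. (cmod (f n t - u t))\<^sup>2)"
    unfolding sq .
  have "(cmod (u t))\<^sup>2 \<le> 2 * (cmod (f n t))\<^sup>2 + 2 * (cmod (f n t - u t))\<^sup>2" for t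
    using norm_add_sq_le[of "f n t" "u t - f n t"] by (simp add: norm_minus_commute)
  then have "(LINT t:{0..T}|lborel. (cmod (u t))\<^sup>2) \<le> (LINT t:{0..T}|lborel. 2 * (cmod (f n t))\<^sup>2 + 2 * (cmod (f n t - u t))\<^sup>2)"
    by (intro set_integral_mono set_integral_add(1) set_integrable_mult_right iu id if')
  also have "\<dots> = 2 * (LINT t:{0..T}|lborel. (cmod (f n t))\<^sup>2) + 2 * (LINT t:{0..T}|lborel. (cmod (f n t - u t))\<^sup>2)"
    by (subst set_integral_add(2)) (auto intro!: if' id)
  finally show "(LINT t:{0..T}|lborel. (cmod (u t))\<^sup>2) \<le> 2 * sqint T (f n) + 2 * (LINT t:{0..T}|lborel. (cmod (f n t - u t))\<^sup>2)"
    unfolding sq .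
qed

subsection \<open>Passage to the limit\<close>

context obs_setting
begin

text \<open>The weight \<open>p\<close> divides the coefficient at \<open>Zi\<close> by
  \<open>d n\<close>, which restores \<open>D n\<close> in u1.\<close>

primrec coef :: "(nat \<Rightarrow> complex) \<Rightarrow> (nat \<Rightarrow> complex) \<Rightarrow> (nat \<Rightarrow> real) \<Rightarrow> real \<Rightarrow> idx \<Rightarrow> complex" where
  "coef C D R E (Wi j) = cnj_ext C j"
| "coef C D R E (Zi j) = cnj_ext (\<lambda>n. d n * D n) j"
| "coef C D R E (Ri n) = of_real (R n)"
| "coef C D R E Ei = of_real E"

lemma esum_indices:
  "esum z v s (indices N) t = (\<Sum>n=1..N. (\<Sum>i\<in>{Wi (int n), Wi (- int n), Zi (int n), Zi (- int n), Ri n}. s i * v i * exp (z i * of_real t)))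
     + s Ei * v Ei * exp (z Ei * of_real t)"
proof -
  let ?f = "\<lambda>i. s i * v i * exp (z i * of_real t)"
  have "esum z v s (indices N) t = (\<Sum>i\<in>pairs 0 N. ?f i) + (\<Sum>i\<in>Ri ` {0<..N}. ?f i) + ?f Ei"
    unfolding esum_def indices_def
    by (subst sum.union_disjoint, simp, simp, force simp: pairs_def, subst sum.union_disjoint) (auto simp: pairs_def)
  also have "(\<Sum>i\<in>Ri ` {0<..N}. ?f i) = (\<Sum>n\<in>{0<..N}. ?f (Ri n))"
    by (subst sum.reindex) (auto simp: inj_on_def)
  also have "(\<Sum>i\<in>pairs 0 N. ?f i) + (\<Sum>n\<in>{0<..N}. ?f (Ri n)) =
     (\<Sum>n\<in>{0<..N}. ?f (Wi (int n)) + ?f (Wi (- int n)) + ?f (Zi (int n)) + ?f (Zi (- int n)) + ?f (Ri n))"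
    unfolding sum_pairs by (simp only: sum.distrib[symmetric])
  also have "\<dots> = (\<Sum>n=1..N. (\<Sum>i\<in>{Wi (int n), Wi (- int n), Zi (int n), Zi (- int n), Ri n}. ?f i))"
    by (rule sum.cong) (auto simp: add.assoc)
  finally show ?thesis .
qed

text \<open>\<open>E\<close> is arbitrary because \<open>p Ei = 0\<close>, just as \<open>R\<close>
  is for u2 because \<open>q (Ri n) = 0\<close>; thus a single \<open>coef C D R E\<close>
  represents both sums.\<close>

lemma u1_partial_eq: "u1_partial \<omega> \<zeta> r C D R N = esum z p (coef C D R E) (indices N)"
proof
  fix t
  have "(\<Sum>i\<in>{Wi (int n), Wi (- int n), Zi (int n), Zi (- int n), Ri n}. coef C D R E i * p i * exp (z i * of_real t)) =
      C n * exp (\<i> * \<omega> n * of_real t) + cnj (C n) * exp (- \<i> * cnj (\<omega> n) * of_real t) + of_real (R n * exp (r n * t))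
      + D n * exp (\<i> * \<zeta> n * of_real t) + cnj (D n) * exp (- \<i> * cnj (\<zeta> n) * of_real t)" if "n \<in> {1..N}" for n
    using that d_nonzero[of n] by (simp add: cnj_ext_def sym_ext_def exp_of_real[symmetric])
  then show "u1_partial \<omega> \<zeta> r C D R N t = esum z p (coef C D R E) (indices N) t"
    unfolding u1_partial_def esum_indices by simp
qed

lemma u2_partial_eq: "u2_partial \<omega> \<zeta> c d C D E \<eta> N = esum z q (coef C D R E) (indices N)"
proof
  fix t
  have "(\<Sum>i\<in>{Wi (int n), Wi (- int n), Zi (int n), Zi (- int n), Ri n}. coef C D R E i * q i * exp (z i * of_real t)) =
      d n * D n * exp (\<i> * \<zeta> n * of_real t) + cnj (d n * D n) * exp (- \<i> * cnj (\<zeta> n) * of_real t)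
      + c n * C n * exp (\<i> * \<omega> n * of_real t) + cnj (c n * C n) * exp (- \<i> * cnj (\<omega> n) * of_real t)" if "n \<in> {1..N}" for n
    using that by (simp add: cnj_ext_def sym_ext_def)
  then show "u2_partial \<omega> \<zeta> c d C D E \<eta> N t = esum z q (coef C D R E) (indices N) t"
    unfolding u2_partial_def esum_indices by (simp add: exp_of_real[symmetric])
qed

lemma esum_indices_diff:
  assumes "m \<le> N"
  shows "(\<lambda>t. esum z v s (indices N) t - esum z v s (indices m) t) = esum z v s (pairs m N \<union> Ri ` {m<..N})"
proof -
  have "indices N = indices m \<union> (pairs m N \<union> Ri ` {m<..N})"
    using assms by (auto simp: indices_def pairs_def sym_range_def image_iff)
  moreover have "indices m \<inter> (pairs m N \<union> Ri ` {m<..N}) = {}" by (auto simp: indices_def pairs_def sym_range_def)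
  ultimately have "esum z v s (indices N) = (\<lambda>t. esum z v s (indices m) t + esum z v s (pairs m N \<union> Ri ` {m<..N}) t)"
    using esum_union[of "indices m" "pairs m N \<union> Ri ` {m<..N}" z v s] by simp
  then show ?thesis by simp
qed

lemma sum_pairs_coef: "(\<Sum>i\<in>pairs m N. (cmod (coef C D R E i))\<^sup>2) = 2 * (\<Sum>n\<in>{m<..N}. (cmod (C n))\<^sup>2 + (cmod (d n * D n))\<^sup>2)"
  unfolding sum_pairs sum_distrib_left by (rule sum.cong) (auto simp: cmod_cnj_ext)

text \<open>The constants for truncated sums do not depend on \<open>N\<close>. Block estimates make
  the partial sums Cauchy in L2, and both bounds then pass to the limit functions.\<close>

lemma observability:
  assumes w: "summable (\<lambda>n. (w n)\<^sup>2)" "\<And>n. w n \<ge> 0"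
  shows "\<exists>A B. 0 < A \<and> A \<le> B \<and> (\<forall>C D R E.
      (\<forall>n\<ge>1. \<bar>R n\<bar> \<le> w n * sqrt ((cmod (C n))\<^sup>2 + (cmod (d n * D n))\<^sup>2)) \<longrightarrow>
      summable (\<lambda>n. (cmod (C (Suc n)))\<^sup>2 + (cmod (d (Suc n) * D (Suc n)))\<^sup>2) \<longrightarrow>
      E\<^sup>2 \<le> M * (\<Sum>n. (cmod (C (Suc n)))\<^sup>2 + (cmod (d (Suc n) * D (Suc n)))\<^sup>2) \<longrightarrow>
      (\<exists>u\<^sub>1 u\<^sub>2. L2_limit_on T (u1_partial \<omega> \<zeta> r C D R) u\<^sub>1 \<and>
               L2_limit_on T (u2_partial \<omega> \<zeta> c d C D E \<eta>) u\<^sub>2 \<and>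
        A * (\<Sum>n. (cmod (C (Suc n)))\<^sup>2 + (cmod (d (Suc n) * D (Suc n)))\<^sup>2)
          \<le> (LINT t:{0..T}|lborel. (cmod (u\<^sub>1 t))\<^sup>2 + (cmod (u\<^sub>2 t))\<^sup>2) \<and>
        (LINT t:{0..T}|lborel. (cmod (u\<^sub>1 t))\<^sup>2 + (cmod (u\<^sub>2 t))\<^sup>2)
          \<le> B * (\<Sum>n. (cmod (C (Suc n)))\<^sup>2 + (cmod (d (Suc n) * D (Suc n)))\<^sup>2)))"
proof -
  obtain A where A: "A > 0" "\<And>N s. dominated w N s \<Longrightarrow> (cmod (s Ei))\<^sup>2 \<le> M * (\<Sum>i\<in>pairs 0 N. (cmod (s i))\<^sup>2) \<Longrightarrow>
    A * (\<Sum>i\<in>pairs 0 N. (cmod (s i))\<^sup>2) \<le> enorm T z p q s (indices N)"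
    using finite_lower[OF w less_imp_le[OF const(2)]] by blast
  obtain B where B: "B > 0" "\<And>s m N. dominated w N s \<Longrightarrow> enorm T z p q s (pairs m N \<union> Ri ` {m<..N}) \<le> B * (\<Sum>i\<in>pairs m N. (cmod (s i))\<^sup>2)"
    using block_upper[OF w(1)] by blast
  define \<beta> where "\<beta> = sqint T (\<lambda>t. exp (of_real (- \<eta>) * of_real t))"
  have \<beta>: "\<beta> \<ge> 0" by (simp add: \<beta>_def sqint_nonneg)
  \<comment> \<open>From I \<le> 2 enorm + 2 \<delta> and enorm \<le> 2 B (2 S) + 2 \<beta> M S,
    where 2 S counts each n with both signs. The maximum secures \<open>A \<le> B'\<close>.\<close>
  define B' where "B' = max A (8 * B + 4 * \<beta> * M)"
  show ?thesis
  proof (rule exI[of _ A], rule exI[of _ B'], intro conjI allI impI)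
    show "0 < A" "A \<le> B'" using A by (auto simp: B'_def)
    fix C D :: "nat \<Rightarrow> complex" and R :: "nat \<Rightarrow> real" and E :: real
    define e where "e = (\<lambda>n. (cmod (C n))\<^sup>2 + (cmod (d n * D n))\<^sup>2)"
    define S where "S = (\<Sum>n. e (Suc n))"
    define s where "s = coef C D R E"
    assume R: "\<forall>n\<ge>1. \<bar>R n\<bar> \<le> w n * sqrt ((cmod (C n))\<^sup>2 + (cmod (d n * D n))\<^sup>2)"
      and "summable (\<lambda>n. (cmod (C (Suc n)))\<^sup>2 + (cmod (d (Suc n) * D (Suc n)))\<^sup>2)"
      and "E\<^sup>2 \<le> M * (\<Sum>n. (cmod (C (Suc n)))\<^sup>2 + (cmod (d (Suc n) * D (Suc n)))\<^sup>2)"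
    then have sum: "summable (\<lambda>n. e (Suc n))" and E: "E\<^sup>2 \<le> M * S" by (auto simp: e_def S_def)
    have e0: "e n \<ge> 0" for n by (simp add: e_def)
    have S0: "S \<ge> 0" unfolding S_def by (intro suminf_nonneg sum e0)
    have part: "(\<Sum>n\<in>{m<..N}. e n) = (\<Sum>n\<in>{m..<N}. e (Suc n))" for m N
      by (rule sum.reindex_bij_witness[of _ Suc "\<lambda>n. n - 1"]) auto
    have PIs: "(\<Sum>i\<in>pairs m N. (cmod (s i))\<^sup>2) = 2 * (\<Sum>n\<in>{m..<N}. e (Suc n))" for m N
      unfolding s_def sum_pairs_coef part[symmetric] by (simp add: e_def)
    have dom: "dominated w N s" for N
      using R by (auto simp: dominated_def s_def cmod_cnj_ext)
    have f1: "u1_partial \<omega> \<zeta> r C D R = (\<lambda>N. esum z p s (indices N))" unfolding s_def by (intro ext) (simp add: u1_partial_eq[of C D R _ E])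
    have f2: "u2_partial \<omega> \<zeta> c d C D E \<eta> = (\<lambda>N. esum z q s (indices N))" unfolding s_def by (intro ext) (simp add: u2_partial_eq[of C D E _ R])
    have cauchy: "\<exists>n0. \<forall>m n. n0 \<le> m \<longrightarrow> m \<le> n \<longrightarrow> sqint T (\<lambda>t. esum z p s (indices n) t - esum z p s (indices m) t) < \<epsilon>
        \<and> sqint T (\<lambda>t. esum z q s (indices n) t - esum z q s (indices m) t) < \<epsilon>" if \<epsilon>: "\<epsilon> > 0" for \<epsilon>
    proof -
      have "\<epsilon> / (2 * B) > 0" using \<epsilon> B by simp
      then obtain n0 where n0: "\<And>m n. m \<ge> n0 \<Longrightarrow> norm (\<Sum>k\<in>{m..<n}. e (Suc k)) < \<epsilon> / (2 * B)"
        using sum[unfolded summable_Cauchy] by blast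
      have "sqint T (\<lambda>t. esum z p s (indices n) t - esum z p s (indices m) t) < \<epsilon>
        \<and> sqint T (\<lambda>t. esum z q s (indices n) t - esum z q s (indices m) t) < \<epsilon>" if mn: "n0 \<le> m" "m \<le> n" for m n
      proof -
        have "enorm T z p q s (pairs m n \<union> Ri ` {m<..n}) \<le> B * (2 * (\<Sum>k\<in>{m..<n}. e (Suc k)))"
          using B(2)[OF dom, of m n] unfolding PIs .
        also have "\<dots> < \<epsilon>" using n0[OF mn(1), of n] B(1) e0 by (simp add: field_simps sum_nonneg)
        finally have "enorm T z p q s (pairs m n \<union> Ri ` {m<..n}) < \<epsilon>" .
        then show ?thesis unfolding esum_indices_diff[OF mn(2)] enorm_def
          using sqint_nonneg[of T "esum z p s (pairs m n \<union> Ri ` {m<..n})"] sqint_nonneg[of T "esum z q s (pairs m n \<union> Ri ` {m<..n})"] by linarith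
      qed
      then show ?thesis by blast
    qed
    have "\<exists>u. L2_limit_on T (\<lambda>N. esum z p s (indices N)) u"
      by (rule L2_limit_exists[OF continuous_on_esum]) (use cauchy in blast)
    then obtain u1 where u1: "L2_limit_on T (\<lambda>N. esum z p s (indices N)) u1" by blast
    have "\<exists>u. L2_limit_on T (\<lambda>N. esum z q s (indices N)) u"
      by (rule L2_limit_exists[OF continuous_on_esum]) (use cauchy in blast)
    then obtain u2 where u2: "L2_limit_on T (\<lambda>N. esum z q s (indices N)) u2" by blast
    define I where "I = (LINT t:{0..T}|lborel. (cmod (u1 t))\<^sup>2 + (cmod (u2 t))\<^sup>2)"
    define \<delta> where "\<delta> = (\<lambda>N. (LINT t:{0..T}|lborel. (cmod (esum z p s (indices N) t - u1 t))\<^sup>2) + (LINT t:{0..T}|lborel. (cmod (esum z q s (indices N) t - u2 t))\<^sup>2))"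
    have \<delta>: "\<delta> \<longlonglongrightarrow> 0" unfolding \<delta>_def using u1 u2 by (intro tendsto_add_zero) (auto simp: L2_limit_on_def)
    have I: "I = (LINT t:{0..T}|lborel. (cmod (u1 t))\<^sup>2) + (LINT t:{0..T}|lborel. (cmod (u2 t))\<^sup>2)"
      unfolding I_def using u1 u2 by (intro set_integral_add) (auto simp: L2_limit_on_def)
    have en1: "enorm T z p q s (indices N) \<le> 2 * I + 2 * \<delta> N" for N
      using L2_limit_bounds(1)[OF u1 continuous_on_esum, of N] L2_limit_bounds(1)[OF u2 continuous_on_esum, of N]
      unfolding enorm_def I \<delta>_def by argo
    have en2: "I \<le> 2 * enorm T z p q s (indices N) + 2 * \<delta> N" for N
      using L2_limit_bounds(2)[OF u1 continuous_on_esum, of N] L2_limit_bounds(2)[OF u2 continuous_on_esum, of N]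
      unfolding enorm_def I \<delta>_def by argo
    have Slim: "(\<lambda>N. \<Sum>n\<in>{0..<N}. e (Suc n)) \<longlonglongrightarrow> S"
      using summable_LIMSEQ[OF sum] by (simp add: S_def lessThan_atLeast0)
    have I0: "I \<ge> 0" unfolding I_def set_lebesgue_integral_def by (intro integral_nonneg_AE) auto
    have low: "A * S \<le> I"
    proof (cases "S = 0")
      case True
      then show ?thesis using I0 by simp
    next
      case False
      \<comment> \<open>The bound on \<open>E\<close> refers to the full sum \<open>S\<close>, while
        the truncated estimate needs it for the sum over \<open>pairs 0 N\<close>. The latter counts
        each n twice, so it exceeds \<open>S\<close> once the partial sum exceeds
        \<open>S / 2\<close>; this happens eventually because S > 0.\<close>
      then have Spos: "S / 2 < S" using S0 by simp
      have "\<forall>\<^sub>F N in sequentially. A * (2 * (\<Sum>n\<in>{0..<N}. e (Suc n))) \<le> 2 * I + 2 * \<delta> N"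
        using order_tendstoD(1)[OF Slim Spos]
      proof eventually_elim
        case (elim N)
        have "(cmod (s Ei))\<^sup>2 = E\<^sup>2" by (simp add: s_def)
        also have "\<dots> \<le> M * (\<Sum>i\<in>pairs 0 N. (cmod (s i))\<^sup>2)"
          unfolding PIs using elim const(2) by (intro order_trans[OF E] mult_left_mono) auto
        finally have "A * (\<Sum>i\<in>pairs 0 N. (cmod (s i))\<^sup>2) \<le> enorm T z p q s (indices N)" by (rule A(2)[OF dom])
        then show ?case using en1[of N] unfolding PIs by linarith
      qed
      moreover have "(\<lambda>N. A * (2 * (\<Sum>n\<in>{0..<N}. e (Suc n)))) \<longlonglongrightarrow> A * (2 * S)" by (intro tendsto_intros Slim)
      moreover have "(\<lambda>N. 2 * I + 2 * \<delta> N) \<longlonglongrightarrow> 2 * I + 2 * 0" by (intro tendsto_intros \<delta>)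
      ultimately have "A * (2 * S) \<le> 2 * I + 2 * 0" by (intro tendsto_le[OF sequentially_bot])
      then show ?thesis by simp
    qed
    have up: "I \<le> (8 * B + 4 * \<beta> * M) * S"
    proof -
      have "I \<le> (8 * B + 4 * \<beta> * M) * S + 2 * \<delta> N" for N
      proof -
        have "indices N = (pairs 0 N \<union> Ri ` {0<..N}) \<union> {Ei}" by (simp add: indices_def)
        then have "enorm T z p q s (indices N) \<le> 2 * enorm T z p q s (pairs 0 N \<union> Ri ` {0<..N}) + 2 * enorm T z p q s {Ei}"
          using enorm_union_le[of "pairs 0 N \<union> Ri ` {0<..N}" "{Ei}" T z p q s] by (auto simp: pairs_def)
        moreover have "enorm T z p q s (pairs 0 N \<union> Ri ` {0<..N}) \<le> B * (2 * S)"
        proof -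
          have "enorm T z p q s (pairs 0 N \<union> Ri ` {0<..N}) \<le> B * (2 * (\<Sum>k\<in>{0..<N}. e (Suc k)))"
            using B(2)[OF dom, of 0 N] unfolding PIs .
          also have "\<dots> \<le> B * (2 * S)" unfolding S_def using B(1) e0 by (intro mult_left_mono sum_le_suminf sum) auto
          finally show ?thesis .
        qed
        moreover have "enorm T z p q s {Ei} \<le> \<beta> * (M * S)"
        proof -
          have "enorm T z p q s {Ei} = sqint T (\<lambda>t. 0) + sqint T (\<lambda>t. of_real E * exp (of_real (- \<eta>) * of_real t))"
            by (simp add: enorm_def esum_def s_def)
          also have "\<dots> = E\<^sup>2 * \<beta>" unfolding sqint_mult \<beta>_def by (simp add: sqint_def)
          also have "\<dots> \<le> M * S * \<beta>" using E \<beta> by (intro mult_right_mono)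
          finally show ?thesis by (simp add: mult.commute)
        qed
        ultimately have "enorm T z p q s (indices N) \<le> 2 * (B * (2 * S)) + 2 * (\<beta> * (M * S))" by linarith
        then show ?thesis using en2[of N] by (simp add: algebra_simps)
      qed
      moreover have "(\<lambda>N. (8 * B + 4 * \<beta> * M) * S + 2 * \<delta> N) \<longlonglongrightarrow> (8 * B + 4 * \<beta> * M) * S + 2 * 0"
        by (intro tendsto_intros \<delta>)
      ultimately have "I \<le> (8 * B + 4 * \<beta> * M) * S + 2 * 0"
        by (intro LIMSEQ_le_const) auto
      then show ?thesis by simp
    qed
    also have "\<dots> \<le> B' * S" using S0 by (intro mult_right_mono) (auto simp: B'_def)
    finally have up': "I \<le> B' * S" .
    show "\<exists>u\<^sub>1 u\<^sub>2. L2_limit_on T (u1_partial \<omega> \<zeta> r C D R) u\<^sub>1 \<and>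
               L2_limit_on T (u2_partial \<omega> \<zeta> c d C D E \<eta>) u\<^sub>2 \<and>
        A * (\<Sum>n. (cmod (C (Suc n)))\<^sup>2 + (cmod (d (Suc n) * D (Suc n)))\<^sup>2)
          \<le> (LINT t:{0..T}|lborel. (cmod (u\<^sub>1 t))\<^sup>2 + (cmod (u\<^sub>2 t))\<^sup>2) \<and>
        (LINT t:{0..T}|lborel. (cmod (u\<^sub>1 t))\<^sup>2 + (cmod (u\<^sub>2 t))\<^sup>2)
          \<le> B' * (\<Sum>n. (cmod (C (Suc n)))\<^sup>2 + (cmod (d (Suc n) * D (Suc n)))\<^sup>2)"
      using u1 u2 low up' unfolding f1 f2 I_def S_def e_def by blast
  qed
qed

end

text \<open>Apart from finitely many terms this is a multiple of the series of n^(-2 \<nu>), with 2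
  \<nu> > 1.\<close>

lemma summable_truncated_powr:
  assumes "\<nu> > 1/2"
  shows "summable (\<lambda>n. (if n \<le> n' then \<mu> else \<mu> * real n powr (- \<nu>))\<^sup>2)"
proof -
  have "summable (\<lambda>n. real n powr (- (2 * \<nu>)))" using assms by (simp add: summable_real_powr_iff)
  then have "summable (\<lambda>n. \<mu>\<^sup>2 * real n powr (- (2 * \<nu>)))" by (rule summable_mult)
  then show ?thesis
  proof (subst summable_cong)
    show "\<forall>\<^sub>F n in sequentially. (if n \<le> n' then \<mu> else \<mu> * real n powr (- \<nu>))\<^sup>2 = \<mu>\<^sup>2 * real n powr (- (2 * \<nu>))"
      using eventually_gt_at_top[of n'] by eventually_elim (simp add: power_mult_distrib power2_eq_square powr_add[symmetric])
  qed
qed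

theorem theorem5p17:
  fixes \<omega> \<zeta> c d :: "nat \<Rightarrow> complex" and r :: "nat \<Rightarrow> real"
    and \<gamma> \<alpha> \<chi>\<^sub>0 \<mu> \<nu> M c\<^sub>1 c\<^sub>2 \<eta> T :: real and n' :: nat
  assumes const: "\<gamma> > 0" "\<alpha> > 0" "\<chi>\<^sub>0 < 0" "\<mu> > 0" "\<nu> > 1/2" "M > 0" "0 < c\<^sub>1" "c\<^sub>1 \<le> c\<^sub>2"
    and H1: "liminf (\<lambda>n. ereal (Re (\<omega> (Suc n)) - Re (\<omega> n))) = ereal \<gamma>"
            "liminf (\<lambda>n. ereal (Re (\<zeta> (Suc n)) - Re (\<zeta> n))) = ereal \<gamma>"
    and H2: "(\<lambda>n. Im (\<omega> n)) \<longlonglongrightarrow> \<alpha>" "r \<longlonglongrightarrow> \<chi>\<^sub>0" "(\<lambda>n. Im (\<zeta> n)) \<longlonglongrightarrow> 0"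
    and H3: "\<And>n. n \<ge> 1 \<Longrightarrow> \<omega> n \<noteq> 0 \<and> \<zeta> n \<noteq> 0 \<and>
                 c\<^sub>1 * cmod (\<zeta> n) \<le> cmod (d n) \<and> cmod (d n) \<le> c\<^sub>2 * cmod (\<zeta> n) \<and>
                 cmod (c n) \<le> M / cmod (\<omega> n)"
    and D_inj: "inj_on \<omega> {1..}" "inj_on r {1..}" "inj_on \<zeta> {1..}"
    and D_dist: "\<And>n m. n \<ge> 1 \<Longrightarrow> m \<ge> 1 \<Longrightarrow>
                  \<omega> n \<noteq> \<zeta> m \<and> \<omega> n \<noteq> cnj (\<zeta> m) \<and>
                  complex_of_real (r n) \<noteq> \<i> * \<omega> m \<and> complex_of_real (r n) \<noteq> \<i> * \<zeta> m"
    and D_eta: "\<And>n. n \<ge> 1 \<Longrightarrow> r n \<noteq> - \<eta>"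
    and D_pos: "\<And>n. n \<ge> 1 \<Longrightarrow> Re (\<omega> n) > 0 \<and> Re (\<zeta> n) > 0"
    and T: "T > 2 * pi / \<gamma>"
  shows "\<exists>A B. 0 < A \<and> A \<le> B \<and>
    (\<forall>C D :: nat \<Rightarrow> complex. \<forall>R :: nat \<Rightarrow> real. \<forall>\<E> :: real.
      (\<forall>n. 1 \<le> n \<and> n' \<le> n \<longrightarrow> \<bar>R n\<bar> \<le> \<mu> * real n powr (- \<nu>) * sqrt ((cmod (C n))\<^sup>2 + (cmod (d n * D n))\<^sup>2)) \<longrightarrow>
      (\<forall>n. 1 \<le> n \<and> n \<le> n' \<longrightarrow> \<bar>R n\<bar> \<le> \<mu> * sqrt ((cmod (C n))\<^sup>2 + (cmod (d n * D n))\<^sup>2)) \<longrightarrow>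
      summable (\<lambda>n. (cmod (C (Suc n)))\<^sup>2 + (cmod (d (Suc n) * D (Suc n)))\<^sup>2) \<longrightarrow>
      \<E>\<^sup>2 \<le> M * (\<Sum>n. (cmod (C (Suc n)))\<^sup>2 + (cmod (d (Suc n) * D (Suc n)))\<^sup>2) \<longrightarrow>
      (\<forall>n\<ge>1. cmod (C n) \<le> M * cmod (d n * D n)) \<longrightarrow>
      (\<exists>u\<^sub>1 u\<^sub>2. L2_limit_on T (u1_partial \<omega> \<zeta> r C D R) u\<^sub>1 \<and>
               L2_limit_on T (u2_partial \<omega> \<zeta> c d C D \<E> \<eta>) u\<^sub>2 \<and>
        A * (\<Sum>n. (cmod (C (Suc n)))\<^sup>2 + (cmod (d (Suc n) * D (Suc n)))\<^sup>2)
          \<le> (LINT t:{0..T}|lborel. (cmod (u\<^sub>1 t))\<^sup>2 + (cmod (u\<^sub>2 t))\<^sup>2) \<and>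
        (LINT t:{0..T}|lborel. (cmod (u\<^sub>1 t))\<^sup>2 + (cmod (u\<^sub>2 t))\<^sup>2)
          \<le> B * (\<Sum>n. (cmod (C (Suc n)))\<^sup>2 + (cmod (d (Suc n) * D (Suc n)))\<^sup>2)))"
proof -
  interpret S: obs_setting \<omega> \<zeta> c d r \<gamma> \<alpha> \<chi>\<^sub>0 M c\<^sub>1 \<eta> T
    by unfold_locales (use assms in auto)
  \<comment> \<open>Merges the two bounds on \<open>R\<close> into one weight; at n = n' both bounds
    are assumed, and the one without decay is taken.\<close>
  define w where "w = (\<lambda>n. if n \<le> n' then \<mu> else \<mu> * real n powr (- \<nu>))"
  have w: "summable (\<lambda>n. (w n)\<^sup>2)" "\<And>n. w n \<ge> 0"
    using summable_truncated_powr[OF const(5)] const(4) by (auto simp: w_def)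
  have R_le: "\<forall>n\<ge>1. \<bar>R n\<bar> \<le> w n * sqrt ((cmod (C n))\<^sup>2 + (cmod (d n * D n))\<^sup>2)"
    if "\<forall>n. 1 \<le> n \<and> n' \<le> n \<longrightarrow> \<bar>R n\<bar> \<le> \<mu> * real n powr (- \<nu>) * sqrt ((cmod (C n))\<^sup>2 + (cmod (d n * D n))\<^sup>2)"
      "\<forall>n. 1 \<le> n \<and> n \<le> n' \<longrightarrow> \<bar>R n\<bar> \<le> \<mu> * sqrt ((cmod (C n))\<^sup>2 + (cmod (d n * D n))\<^sup>2)" for R :: "nat \<Rightarrow> real" and C D
    using that by (auto simp: w_def)
  from S.observability[OF w] obtain A B where "0 < A" "A \<le> B" and *: "\<And>C D R E.
      \<forall>n\<ge>1. \<bar>R n\<bar> \<le> w n * sqrt ((cmod (C n))\<^sup>2 + (cmod (d n * D n))\<^sup>2) \<Longrightarrow>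
      summable (\<lambda>n. (cmod (C (Suc n)))\<^sup>2 + (cmod (d (Suc n) * D (Suc n)))\<^sup>2) \<Longrightarrow>
      E\<^sup>2 \<le> M * (\<Sum>n. (cmod (C (Suc n)))\<^sup>2 + (cmod (d (Suc n) * D (Suc n)))\<^sup>2) \<Longrightarrow>
      (\<exists>u\<^sub>1 u\<^sub>2. L2_limit_on T (u1_partial \<omega> \<zeta> r C D R) u\<^sub>1 \<and>
               L2_limit_on T (u2_partial \<omega> \<zeta> c d C D E \<eta>) u\<^sub>2 \<and>
        A * (\<Sum>n. (cmod (C (Suc n)))\<^sup>2 + (cmod (d (Suc n) * D (Suc n)))\<^sup>2)
          \<le> (LINT t:{0..T}|lborel. (cmod (u\<^sub>1 t))\<^sup>2 + (cmod (u\<^sub>2 t))\<^sup>2) \<and>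
        (LINT t:{0..T}|lborel. (cmod (u\<^sub>1 t))\<^sup>2 + (cmod (u\<^sub>2 t))\<^sup>2)
          \<le> B * (\<Sum>n. (cmod (C (Suc n)))\<^sup>2 + (cmod (d (Suc n) * D (Suc n)))\<^sup>2))"
    by blast
  show ?thesis
    by (rule exI[of _ A], rule exI[of _ B], intro conjI allI impI \<open>0 < A\<close> \<open>A \<le> B\<close>) (rule *[OF R_le])
qed

end
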